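(* Let $V$ be an irreducible variety over a field $k$ of characteristic zero, with a singular foliation of dimension $r$ given by $\mathcal{L}\subset\mathrm{Der}_k(k(V),k(V))$. Let $I$ be a (nonzero) sheaf of ideals on $V$. Let $V_0\to V$ be the blowing up of $I$ and let $$\cdots\to V_2\to V_1\to V_0\to V$$ be obtained by subsequently applying the Gauss process for the foliation lifted to $V_0$, i.e. $V_{i+1}\to V_i$ is the Gauss blowup of the foliated variety $V_i$ for all $i\ge0$. Let $L_i=L_i(I)$ and $R=R(I)$ be as defined in the context. The following are equivalent: 1. The sheaf $R$ of graded $\mathcal{O}_V$-algebras is of finite type over $k$. 2. The tower $\cdots\to V_2\to V_1\to V_0\to V$ stabilizes (i.e. $V_{i+1}\to V_i$ is an isomorphism for all sufficiently large $i$). 3. The natural map $F(J)^{r+2}\to F(JF(J))$ is an isomorphism for some $J=IL_0L_1\cdots L_{t-1}$ with $t\ge0$ (where $J=I$ if $t=0$).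
   Context: Let $k(V)$ be the function field of $V$. A singular foliation on $V$ is a $k(V)$-linear sub Lie algebra $\mathcal{L}\subset\mathrm{Der}_k(k(V),k(V))$; its dimension is $r=\dim_{k(V)}\mathcal{L}$. If $V'\to V$ is birational, the lifted foliation on $V'$ is given by the same $\mathcal{L}$ under $k(V')=k(V)$. For coherent sheaves $A,B$ put $AB=(A\otimes B)/\text{torsion}$; powers are taken with this product. Let $\Omega$ be the image of the evaluation map $\Omega_{V/k}\to\widehat{\mathcal{L}}=\mathrm{Hom}_{k(V)}(\mathcal{L},k(V))$, $dx\mapsto(\delta\mapsto\delta(x))$ (the sheaf of differentials along the foliation). The Gauss blowup of a foliated variety $V$ is the lowest domain of definition of the Gauss rational map from $V$ to the Grassmannian (of rank $r$ quotients of the differentials); equivalently, it is the blowup of $V$ along the torsion free rank one coherent sheaf $\Lambda^r\Omega/\text{torsion}$. For a torsion free rank one coherent sheaf $I$, $P(I)$ is the sheaf of first principal parts of $I$ along the foliation: the extension $0\to I\Omega\to P(I)\to I\to0$ which is the push-out of the Atiyah extension class of $I$ in $\mathrm{Ext}^1(I,I\otimes\Omega_{V/k})$ along $I\otimes\Omega_{V/k}\to I\Omega$. Set $F(I)=\Lambda^{r+1}P(I)/\text{torsion}$. Concretely, choose a $k(V)$-basis $\delta_1,\dots,\delta_r$ of $\mathcal{L}$ and an embedding of $I$ in the constant sheaf $k(V)$. Then $F(I)$ is identified with the coherent subsheaf of $k(V)$ generated on affine open sets by the determinants of the $(r+1)\times(r+1)$ matrices with rows $(f_j,\delta_1f_j,\dots,\delta_rf_j)$,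 $j=0,\dots,r$, with $f_0,\dots,f_r$ sections of $I$; products of sheaves correspond to products of subsheaves of $k(V)$. With these identifications there is (in characteristic zero) an inclusion $F(J)^{r+2}\subset F(JF(J))$ of subsheaves of $k(V)$, for every torsion free rank one coherent sheaf $J$; this is the natural map $F(J)^{r+2}\to F(JF(J))$, and it is independent of the choices. Define inductively $J_0=I$, $L_i=F(J_i)$, $J_{i+1}=IL_0L_1\cdots L_i$ for $i\ge0$. Put $R_0=\mathcal{O}_V$ and, for $i\ge1$, $R_i=L_0^{a_0}L_1^{a_1}\cdots L_s^{a_s}$, where $i=a_0+a_1(r+2)+\cdots+a_s(r+2)^s$ with $0\le a_\alpha<r+2$ is the base $(r+2)$ expansion of $i$. Then $R=R(I)=\bigoplus_{i\ge0}R_i$ is a graded sheaf of $\mathcal{O}_V$-algebras whose multiplication $R_iR_j\to R_{i+j}$ is the one induced by the natural maps $L_s^{r+2}\to L_{s+1}$ (carrying in base $r+2$); after the identifications above it is just multiplication in $k(V)$. "Finite type over $k$" means that over affine open subsets of $V$ it is a finitely generated $k$-algebra. *)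

theory Defs
  imports
    "Jordan_Normal_Form.Determinant"
    "HOL-Computational_Algebra.Polynomial"
    "HOL-Library.Function_Algebras"
begin

text \<open>
  Everything takes place inside one function field: the type \<open>'a\<close> is \<open>k(V)\<close>, and \<open>k\<close> is a
  subfield of it. An integral separated scheme of finite type over \<open>k\<close> with function field \<open>k(V)\<close>
  is represented by its Chevalley schema (Zariski's ``model''), i.e. by the set of its local rings
  as subrings of the function field. A birational morphism \<open>V' \<rightarrow> V\<close> inducing the identity on
  \<open>k(V)\<close> exists iff every local ring of \<open>V'\<close> dominates a local ring of \<open>V\<close>, and is then unique:
  it sends a local ring to the one it dominates.
\<close>

section \<open>Subrings, submodules and determinants\<close>

definition is_subring :: "'b::comm_ring_1 set \<Rightarrow> bool" where
  "is_subring A \<longleftrightarrow> 1 \<in> A \<and> (\<forall>x\<in>A. \<forall>y\<in>A. x - y \<in> A \<and> x * y \<in> A)"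

definition is_subfield :: "'a::field set \<Rightarrow> bool" where
  "is_subfield k \<longleftrightarrow> is_subring k \<and> (\<forall>x\<in>k. inverse x \<in> k)"

definition is_submodule :: "'a::comm_ring_1 set \<Rightarrow> 'a set \<Rightarrow> bool" where
  "is_submodule A M \<longleftrightarrow>
     0 \<in> M \<and> (\<forall>x\<in>M. \<forall>y\<in>M. x + y \<in> M) \<and> (\<forall>a\<in>A. \<forall>x\<in>M. a * x \<in> M)"

definition is_submodule_vec :: "'a::comm_ring_1 set \<Rightarrow> nat \<Rightarrow> 'a vec set \<Rightarrow> bool" where
  "is_submodule_vec A n M \<longleftrightarrow> M \<subseteq> carrier_vec n \<and>
     0\<^sub>v n \<in> M \<and> (\<forall>v\<in>M. \<forall>w\<in>M. v + w \<in> M) \<and> (\<forall>a\<in>A. \<forall>v\<in>M. a \<cdot>\<^sub>v v \<in> M)"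

definition prime_ideal_in :: "'a::comm_ring_1 set \<Rightarrow> 'a set \<Rightarrow> bool" where
  "prime_ideal_in A p \<longleftrightarrow> p \<subseteq> A \<and> is_submodule A p \<and> 1 \<notin> p \<and>
     (\<forall>x\<in>A. \<forall>y\<in>A. x * y \<in> p \<longrightarrow> x \<in> p \<or> y \<in> p)"

text \<open>
  For an \<open>A\<close>-submodule \<open>M\<close> of \<open>K\<^sup>n\<close> spanning \<open>K\<^sup>n\<close> over the fraction field \<open>K\<close> of \<open>A\<close>, the kernel of
  \<open>\<Lambda>\<^sup>nM \<rightarrow> \<Lambda>\<^sup>nK\<^sup>n = K\<close> is the torsion submodule, so the image of this map is \<open>\<Lambda>\<^sup>nM / torsion\<close>.
\<close>
definition top_wedge :: "'a::comm_ring_1 set \<Rightarrow> nat \<Rightarrow> 'a vec set \<Rightarrow> 'a set" where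
  "top_wedge A n M =
     is_submodule A hull {det (mat_of_rows n ws) | ws. length ws = n \<and> set ws \<subseteq> M}"

lemma is_submodule_hull: "is_submodule A (is_submodule A hull S)"
  by (rule hull_in) (auto simp: is_submodule_def)

lemma is_submodule_vec_hull:
  assumes "S \<subseteq> carrier_vec n"
  shows "is_submodule_vec A n (is_submodule_vec A n hull S)"
proof -
  have "is_submodule_vec A n (carrier_vec n)"
    unfolding is_submodule_vec_def by auto
  then have "is_submodule_vec A n hull S \<subseteq> carrier_vec n"
    using assms by (intro hull_minimal)
  then show ?thesis
    by (auto simp: hull_def is_submodule_vec_def)
qed

text \<open>It suffices to take determinants of generators of the module.\<close>
lemma top_wedge_hull:
  assumes S: "S \<subseteq> carrier_vec n"
  shows "top_wedge A n (is_submodule_vec A n hull S) = top_wedge A n S"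
proof
  let ?H = "is_submodule_vec A n hull S" and ?T = "top_wedge A n S"
  show "?T \<subseteq> top_wedge A n ?H"
    unfolding top_wedge_def using hull_subset[of S "is_submodule_vec A n"]
    by (intro hull_mono) blast
  have T: "is_submodule A ?T"
    unfolding top_wedge_def by (rule is_submodule_hull)
  have H: "is_submodule_vec A n ?H"
    using S by (rule is_submodule_vec_hull)
  then have HC: "?H \<subseteq> carrier_vec n"
    unfolding is_submodule_vec_def by blast
  have main: "det (mat\<^sub>r n n c) \<in> ?T"
    if "m \<le> n" "\<And>i. i < m \<Longrightarrow> c i \<in> ?H" "\<And>i. m \<le> i \<Longrightarrow> i < n \<Longrightarrow> c i \<in> S" for m c
    using that
  proof (induction m arbitrary: c)
    case 0
    have "mat\<^sub>r n n c = mat_of_rows n (map c [0..<n])"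
      by (intro eq_matI) (auto simp: mat_of_rows_def)
    moreover have "det (mat_of_rows n (map c [0..<n])) \<in>
        {det (mat_of_rows n ws) | ws. length ws = n \<and> set ws \<subseteq> S}"
      using 0 by (intro CollectI exI[of _ "map c [0..<n]"]) auto
    ultimately show ?case
      unfolding top_wedge_def by (metis (lifting) hull_inc)
  next
    case (Suc m)
    have m: "m < n" using Suc.prems by simp
    define d where "d w = det (mat\<^sub>r n n (\<lambda>i. if i = m then w else c i))" for w
    have c: "c \<in> {0..<n} \<rightarrow> carrier_vec n"
    proof
      fix i assume "i \<in> {0..<n}"
      then show "c i \<in> carrier_vec n"
        using Suc.prems(2)[of i] Suc.prems(3)[of i] S HC by (cases "i < Suc m") auto
    qed
    define N where "N = {w \<in> carrier_vec n. d w \<in> ?T}"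
    have "S \<subseteq> N"
    proof
      fix w assume w: "w \<in> S"
      have "d w \<in> ?T"
        unfolding d_def using w Suc.prems by (intro Suc.IH) auto
      then show "w \<in> N" using w S by (auto simp: N_def)
    qed
    moreover have "is_submodule_vec A n N"
      unfolding is_submodule_vec_def
    proof (intro conjI ballI)
      show "N \<subseteq> carrier_vec n" by (auto simp: N_def)
      have "d (0\<^sub>v n) = 0" unfolding d_def by (rule det_row_0[OF m c])
      then show "0\<^sub>v n \<in> N" using T by (auto simp: N_def is_submodule_def)
    next
      fix v w assume vw: "v \<in> N" "w \<in> N"
      have "d (v + w) = d v + d w"
        unfolding d_def using det_row_add[of "\<lambda>_. v" m n "\<lambda>_. w" c] vw m c by (auto simp: N_def)
      then show "v + w \<in> N" using T vw by (auto simp: N_def is_submodule_def)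
    next
      fix a v assume av: "a \<in> A" "v \<in> N"
      have "mat\<^sub>r n n (\<lambda>i. if i = m then a \<cdot>\<^sub>v v else c i) =
          mat\<^sub>r n n (\<lambda>i. (if i = m then a else 1) \<cdot>\<^sub>v (if i = m then v else c i))"
        using av c by (intro eq_matI) (auto simp: N_def)
      moreover have "(\<lambda>i. if i = m then v else c i) \<in> {0..<n} \<rightarrow> carrier_vec n"
        using av c by (auto simp: N_def)
      ultimately have "d (a \<cdot>\<^sub>v v) = prod (\<lambda>i. if i = m then a else 1) {0..<n} * d v"
        unfolding d_def by (simp only: det_rows_mul)
      also have "prod (\<lambda>i. if i = m then a else 1) {0..<n} = a" using m by simp
      finally show "a \<cdot>\<^sub>v v \<in> N" using T av by (auto simp: N_def is_submodule_def)
    qed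
    ultimately have "?H \<subseteq> N" by (rule hull_minimal)
    then have "d (c m) \<in> ?T" using Suc.prems(2)[of m] by (auto simp: N_def)
    moreover have "(\<lambda>i. if i = m then c m else c i) = c" by auto
    ultimately show ?case unfolding d_def by simp
  qed
  show "top_wedge A n ?H \<subseteq> ?T"
    unfolding top_wedge_def[of A n ?H]
  proof (rule hull_minimal)
    show "{det (mat_of_rows n ws) | ws. length ws = n \<and> set ws \<subseteq> ?H} \<subseteq> ?T"
    proof (intro subsetI, elim CollectE exE conjE)
      fix x ws assume x: "x = det (mat_of_rows n ws)" and ws: "length ws = n" "set ws \<subseteq> ?H"
      have "mat_of_rows n ws = mat\<^sub>r n n (\<lambda>i. ws ! i)"
        using ws(1) by (intro eq_matI) (auto simp: mat_of_rows_def)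
      moreover have "det (mat\<^sub>r n n (\<lambda>i. ws ! i)) \<in> ?T"
        using ws by (intro main[of n]) (auto simp: subset_iff)
      ultimately show "x \<in> ?T" using x by simp
    qed
    show "is_submodule A ?T" by (rule T)
  qed
qed

section \<open>Varieties\<close>

definition localization :: "'a::field set \<Rightarrow> 'a set \<Rightarrow> 'a set" where
  "localization A p = {a / s | a s. a \<in> A \<and> s \<in> A - p}"

definition affine_model :: "'a::field set \<Rightarrow> 'a set set" where
  "affine_model A = {localization A p | p. prime_ideal_in A p}"

definition fin_gen_algebra :: "'b::comm_ring_1 set \<Rightarrow> 'b set \<Rightarrow> bool" where
  "fin_gen_algebra k A \<longleftrightarrow> (\<exists>S. finite S \<and> A = is_subring hull (k \<union> S))"

definition affine_algebra :: "'a::field set \<Rightarrow> 'a set \<Rightarrow> bool" where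
  "affine_algebra k A \<longleftrightarrow>
     fin_gen_algebra k A \<and> (\<forall>x. \<exists>a\<in>A. \<exists>b\<in>A. b \<noteq> 0 \<and> x = a / b)"

definition nonunits :: "'a::field set \<Rightarrow> 'a set" where
  "nonunits P = {x\<in>P. x = 0 \<or> inverse x \<notin> P}"

definition is_local_subring :: "'a::field set \<Rightarrow> bool" where
  "is_local_subring P \<longleftrightarrow> is_subring P \<and> (\<forall>x\<in>nonunits P. \<forall>y\<in>nonunits P. x + y \<in> nonunits P)"

definition dominates :: "'a::field set \<Rightarrow> 'a set \<Rightarrow> bool" where
  "dominates Q P \<longleftrightarrow> P \<subseteq> Q \<and> nonunits P \<subseteq> nonunits Q"

text \<open>The last condition is separatedness.\<close>
definition variety :: "'a::field set \<Rightarrow> 'a set set \<Rightarrow> bool" where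
  "variety k V \<longleftrightarrow>
     (\<exists>\<A>. finite \<A> \<and> \<A> \<noteq> {} \<and> (\<forall>A\<in>\<A>. affine_algebra k A) \<and> V = (\<Union>A\<in>\<A>. affine_model A)) \<and>
     (\<forall>P\<in>V. \<forall>Q\<in>V. \<forall>R. is_local_subring R \<and> dominates R P \<and> dominates R Q \<longrightarrow> P = Q)"

text \<open>
  Affine open subsets are given by their coordinate rings. For a variety \<open>V\<close>, any \<open>affine_model A \<subseteq> V\<close>
  as below is open, being the set of all members of \<open>V\<close> that contain a finite set of generators of
  \<open>A\<close>.
\<close>
definition affine_opens :: "'a::field set \<Rightarrow> 'a set set \<Rightarrow> 'a set set" where
  "affine_opens k V = {A. affine_algebra k A \<and> affine_model A \<subseteq> V}"

text \<open>The morphism \<open>V' \<rightarrow> V\<close> that is the identity on \<open>k(V)\<close> exists.\<close>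
definition birational_morphism :: "'a::field set set \<Rightarrow> 'a set set \<Rightarrow> bool" where
  "birational_morphism V' V \<longleftrightarrow> (\<forall>P'\<in>V'. \<exists>P\<in>V. dominates P' P)"

text \<open>It exists and has an inverse; the inverse is again the identity on \<open>k(V)\<close>.\<close>
definition birational_isomorphism :: "'a::field set set \<Rightarrow> 'a set set \<Rightarrow> bool" where
  "birational_isomorphism V' V \<longleftrightarrow> birational_morphism V' V \<and> birational_morphism V V'"

lemma is_local_subring_localization:
  fixes A :: "'a::field set"
  assumes A: "is_subring A" and p: "prime_ideal_in A p"
  shows "is_local_subring (localization A p)"
proof -
  let ?P = "localization A p"
  have one: "1 \<in> A" "1 \<notin> p" and pA: "p \<subseteq> A" and "0 \<in> p"
    using A p unfolding is_subring_def prime_ideal_in_def is_submodule_def by simp_all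
  then have zero: "0 \<in> A" "0 \<in> p" by auto
  have diff: "x - y \<in> A" and mult: "x * y \<in> A" if "x \<in> A" "y \<in> A" for x y
    using A that unfolding is_subring_def by auto
  have neg: "- x \<in> A" if "x \<in> A" for x using diff[OF zero(1) that] by simp
  have add: "x + y \<in> A" if "x \<in> A" "y \<in> A" for x y
    using diff[OF that(1) neg[OF that(2)]] by simp
  have S: "x * y \<in> A - p" if "x \<in> A - p" "y \<in> A - p" for x y
    using p mult that unfolding prime_ideal_in_def by blast
  have nz: "s \<noteq> 0" if "s \<in> A - p" for s using that zero by auto
  have padd: "x + y \<in> p" if "x \<in> p" "y \<in> p" for x y
    using p that unfolding prime_ideal_in_def is_submodule_def by auto
  have pmul: "a * x \<in> p" if "a \<in> A" "x \<in> p" for a x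
    using p that unfolding prime_ideal_in_def is_submodule_def by auto
  have I: "a / s \<in> ?P" if "a \<in> A" "s \<in> A - p" for a s
    using that unfolding localization_def by blast
  have sub: "is_subring ?P"
    unfolding is_subring_def
  proof (intro conjI ballI)
    show "1 \<in> ?P" using I[OF one(1), of 1] one by simp
    fix x y assume "x \<in> ?P" "y \<in> ?P"
    then obtain a s b t where *: "x = a / s" "y = b / t" "a \<in> A" "b \<in> A" "s \<in> A - p" "t \<in> A - p"
      unfolding localization_def by blast
    have "x - y = (a * t - b * s) / (s * t)" "x * y = (a * b) / (s * t)"
      using * nz by (auto simp: field_simps)
    then show "x - y \<in> ?P" "x * y \<in> ?P"
      using I[OF diff[OF mult mult] S] I[OF mult S] * by auto
  qed
  have nu: "x \<in> nonunits ?P \<longleftrightarrow> (\<exists>a\<in>p. \<exists>s\<in>A - p. x = a / s)" for x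
  proof
    assume "x \<in> nonunits ?P"
    then obtain a s where x: "x = a / s" "a \<in> A" "s \<in> A - p" "x = 0 \<or> inverse x \<notin> ?P"
      unfolding nonunits_def localization_def by blast
    have "a \<in> p"
    proof (rule ccontr)
      assume a: "a \<notin> p"
      then have "inverse x \<in> ?P" using I[of s a] x by (simp add: inverse_eq_divide)
      then show False using x a zero nz[OF x(3)] by auto
    qed
    then show "\<exists>a\<in>p. \<exists>s\<in>A - p. x = a / s" using x by blast
  next
    assume "\<exists>a\<in>p. \<exists>s\<in>A - p. x = a / s"
    then obtain a s where x: "x = a / s" "a \<in> p" "s \<in> A - p" by blast
    have "inverse x \<notin> ?P" if "x \<noteq> 0"
    proof
      assume "inverse x \<in> ?P"
      then obtain b t where b: "inverse x = b / t" "b \<in> A" "t \<in> A - p"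
        unfolding localization_def by blast
      have "s * t = b * a"
        using b(1) x(1) nz[OF x(3)] nz[OF b(3)] that by (auto simp: field_simps)
      then have "s * t \<in> p" using pmul[OF b(2) x(2)] by simp
      then show False using S[OF x(3) b(3)] by simp
    qed
    then show "x \<in> nonunits ?P" using x pA I unfolding nonunits_def by auto
  qed
  show ?thesis
    unfolding is_local_subring_def
  proof (intro conjI ballI sub)
    fix x y assume "x \<in> nonunits ?P" "y \<in> nonunits ?P"
    then obtain a s b t where *: "x = a / s" "y = b / t" "a \<in> p" "b \<in> p" "s \<in> A - p" "t \<in> A - p"
      unfolding nu by blast
    have "x + y = (t * a + s * b) / (s * t)" using * nz by (auto simp: field_simps)
    moreover have "t * a + s * b \<in> p" using * padd pmul by auto
    ultimately show "x + y \<in> nonunits ?P" unfolding nu using S * by blast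
  qed
qed

lemma is_subring_hull: "is_subring (is_subring hull S)"
  by (rule hull_in) (auto simp: is_subring_def)

lemma variety_local_subring:
  assumes "variety k V" "P \<in> V"
  shows "is_local_subring P"
proof -
  obtain A where "affine_algebra k A" and P: "P \<in> affine_model A"
    using assms unfolding variety_def by blast
  then have "is_subring A"
    unfolding affine_algebra_def fin_gen_algebra_def using is_subring_hull by auto
  then show ?thesis
    using P is_local_subring_localization unfolding affine_model_def by auto
qed

lemma birational_isomorphism_iff_eq:
  assumes "variety k V'" "variety k V"
  shows "birational_isomorphism V' V \<longleftrightarrow> V' = V"
proof
  have *: "V1 \<subseteq> V2" if V12: "variety k V1" "variety k V2"
    "birational_morphism V1 V2" "birational_morphism V2 V1" for V1 V2 :: "'a set set"
  proof
    fix P assume P: "P \<in> V1"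
    obtain Q where "Q \<in> V2" "dominates P Q"
      using V12(3) P unfolding birational_morphism_def by blast
    moreover from this obtain P' where "P' \<in> V1" "dominates Q P'"
      using V12(4) unfolding birational_morphism_def by blast
    ultimately have Q: "Q \<in> V2" "dominates P Q" "P' \<in> V1" "dominates Q P'" by simp_all
    then have "dominates P P'" "dominates P P" unfolding dominates_def by auto
    then have "P = P'"
      using V12(1) P Q(3) variety_local_subring[OF V12(1) P] unfolding variety_def by blast
    then have "P = Q" using Q unfolding dominates_def by auto
    then show "P \<in> V2" using Q by simp
  qed
  show "V' = V" if "birational_isomorphism V' V"
    using that *[of V' V] *[OF assms(2,1)] assms unfolding birational_isomorphism_def by blast
  show "birational_isomorphism V' V" if "V' = V"
    using that unfolding birational_isomorphism_def birational_morphism_def dominates_def by blast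
qed

section \<open>Coherent subsheaves of the constant sheaf\<close>

text \<open>
  A coherent subsheaf of the constant sheaf \<open>k(V)\<close> is given by its modules of sections over affine
  open sets, and only the values there matter; inclusion and equality of sheaves are inclusion and equality over all affine opens.
  An inclusion \<open>A \<subseteq> B\<close> of affine opens corresponds to an open immersion \<open>Spec B \<rightarrow> Spec A\<close>, and
  \<open>B \<otimes>\<^sub>A M\<close> is then the span \<open>BM\<close>.
\<close>
type_synonym 'a sheaf = "'a set \<Rightarrow> 'a set"

definition nonzero_ideal_sheaf :: "'a::field set \<Rightarrow> 'a set set \<Rightarrow> 'a sheaf \<Rightarrow> bool" where
  "nonzero_ideal_sheaf k V I \<longleftrightarrow>
     (\<forall>A\<in>affine_opens k V. I A \<subseteq> A \<and> is_submodule A (I A)) \<and>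
     (\<forall>A\<in>affine_opens k V. \<forall>B\<in>affine_opens k V. A \<subseteq> B \<longrightarrow> I B = is_submodule B hull I A) \<and>
     (\<exists>A\<in>affine_opens k V. I A \<noteq> {0})"

definition structure_sheaf :: "'a sheaf" where
  "structure_sheaf A = A"

definition sheaf_mult :: "'a::field sheaf \<Rightarrow> 'a sheaf \<Rightarrow> 'a sheaf" where
  "sheaf_mult M N A = is_submodule A hull {x * y | x y. x \<in> M A \<and> y \<in> N A}"

primrec sheaf_pow :: "'a::field sheaf \<Rightarrow> nat \<Rightarrow> 'a sheaf" where
  "sheaf_pow M 0 = structure_sheaf"
| "sheaf_pow M (Suc n) = sheaf_mult (sheaf_pow M n) M"

text \<open>The charts of the blowup \<open>Proj (\<Oplus>\<^sub>n I\<^sup>n)\<close> are the spectra of the rings \<open>A[I/f]\<close>.\<close>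
definition blowup :: "'a::field set \<Rightarrow> 'a set set \<Rightarrow> 'a sheaf \<Rightarrow> 'a set set" where
  "blowup k V I = (\<Union>A\<in>affine_opens k V. \<Union>f\<in>I A - {0}.
     affine_model (is_subring hull (A \<union> {g / f | g. g \<in> I A})))"

section \<open>Foliations\<close>

definition derivation :: "'a::field set \<Rightarrow> ('a \<Rightarrow> 'a) \<Rightarrow> bool" where
  "derivation k \<delta> \<longleftrightarrow> (\<forall>x y. \<delta> (x + y) = \<delta> x + \<delta> y) \<and> (\<forall>x y. \<delta> (x * y) = x * \<delta> y + y * \<delta> x) \<and>
     (\<forall>c\<in>k. \<forall>x. \<delta> (c * x) = c * \<delta> x)"

interpretation fun_vs: vector_space "\<lambda>(c::'a::field) (\<delta>::'a \<Rightarrow> 'a) x. c * \<delta> x"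
  by unfold_locales (auto simp: fun_eq_iff algebra_simps)

definition singular_foliation :: "'a::field set \<Rightarrow> ('a \<Rightarrow> 'a) set \<Rightarrow> bool" where
  "singular_foliation k \<L> \<longleftrightarrow> (\<forall>\<delta>\<in>\<L>. derivation k \<delta>) \<and> fun_vs.subspace \<L> \<and>
     (\<forall>\<delta>\<in>\<L>. \<forall>\<epsilon>\<in>\<L>. (\<lambda>x. \<delta> (\<epsilon> x) - \<epsilon> (\<delta> x)) \<in> \<L>)"

definition foliation_basis :: "('a::field \<Rightarrow> 'a) set \<Rightarrow> ('a \<Rightarrow> 'a) list \<Rightarrow> bool" where
  "foliation_basis \<L> \<delta>s \<longleftrightarrow>
     distinct \<delta>s \<and> \<not> fun_vs.dependent (set \<delta>s) \<and> fun_vs.span (set \<delta>s) = \<L>"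

text \<open>
  A basis \<open>\<delta>s\<close> identifies the dual of \<open>\<L>\<close> with \<open>k(V)\<^sup>r\<close>; the differential of \<open>x\<close> along the foliation
  becomes the vector of the \<open>\<delta> x\<close>.
\<close>
definition foliation_differentials :: "('a::field \<Rightarrow> 'a) list \<Rightarrow> 'a set \<Rightarrow> 'a vec set" where
  "foliation_differentials \<delta>s A = is_submodule_vec A (length \<delta>s) hull
     {vec_of_list (map (\<lambda>\<delta>. \<delta> x) \<delta>s) | x. x \<in> A}"

text \<open>
  The blowup along \<open>\<Lambda>\<^sup>r\<Omega> / torsion\<close>. The foliation lifted to a birational model is given by
  the same \<open>\<L>\<close>, hence the same \<open>\<delta>s\<close>.
\<close>
definition gauss_blowup :: "'a::field set \<Rightarrow> ('a \<Rightarrow> 'a) list \<Rightarrow> 'a set set \<Rightarrow> 'a set set" where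
  "gauss_blowup k \<delta>s V =
     blowup k V (\<lambda>A. top_wedge A (length \<delta>s) (foliation_differentials \<delta>s A))"

primrec gauss_tower ::
  "'a::field set \<Rightarrow> ('a \<Rightarrow> 'a) list \<Rightarrow> 'a set set \<Rightarrow> 'a sheaf \<Rightarrow> nat \<Rightarrow> 'a set set" where
  "gauss_tower k \<delta>s V I 0 = blowup k V I"
| "gauss_tower k \<delta>s V I (Suc i) = gauss_blowup k \<delta>s (gauss_tower k \<delta>s V I i)"

text \<open>
  \<open>P(I)\<close> embeds in \<open>k(V) \<oplus> k(V)\<^sup>r\<close> by sending the first principal part of a section \<open>f\<close> to
  \<open>(f, \<delta>\<^sub>1 f, \<dots>, \<delta>\<^sub>r f)\<close>. The span contains \<open>I\<Omega>\<close>, as \<open>0 \<oplus> f \<cdot> dx\<close> is the principal part of \<open>xf\<close>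
  minus \<open>x\<close> times that of \<open>f\<close>.
\<close>
definition principal_part :: "('a::field \<Rightarrow> 'a) list \<Rightarrow> 'a \<Rightarrow> 'a vec" where
  "principal_part \<delta>s f = vec_of_list (f # map (\<lambda>\<delta>. \<delta> f) \<delta>s)"

definition principal_parts :: "('a::field \<Rightarrow> 'a) list \<Rightarrow> 'a sheaf \<Rightarrow> 'a set \<Rightarrow> 'a vec set" where
  "principal_parts \<delta>s I A = is_submodule_vec A (Suc (length \<delta>s)) hull (principal_part \<delta>s ` I A)"

definition F_sheaf :: "('a::field \<Rightarrow> 'a) list \<Rightarrow> 'a sheaf \<Rightarrow> 'a sheaf" where
  "F_sheaf \<delta>s I A = top_wedge A (Suc (length \<delta>s)) (principal_parts \<delta>s I A)"

lemma F_sheaf_determinants: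
  "F_sheaf \<delta>s I A = is_submodule A hull
     {det (mat_of_rows (Suc (length \<delta>s)) (map (principal_part \<delta>s) fs)) | fs.
        length fs = Suc (length \<delta>s) \<and> set fs \<subseteq> I A}"
proof -
  let ?n = "Suc (length \<delta>s)"
  have "principal_part \<delta>s ` I A \<subseteq> carrier_vec ?n"
    by (auto simp: principal_part_def intro!: carrier_vecI simp del: vec_of_list_Cons vec_of_list_map)
  then have "F_sheaf \<delta>s I A = top_wedge A ?n (principal_part \<delta>s ` I A)"
    unfolding F_sheaf_def principal_parts_def by (rule top_wedge_hull)
  moreover have "{det (mat_of_rows ?n ws) | ws. length ws = ?n \<and> set ws \<subseteq> principal_part \<delta>s ` I A} =
      {det (mat_of_rows ?n (map (principal_part \<delta>s) fs)) | fs. length fs = ?n \<and> set fs \<subseteq> I A}"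
    (is "?D = ?E")
  proof
    show "?D \<subseteq> ?E"
    proof clarify
      fix ws assume ws: "length ws = ?n" "set ws \<subseteq> principal_part \<delta>s ` I A"
      then have "ws \<in> map (principal_part \<delta>s) ` lists (I A)"
        unfolding lists_image[symmetric] by (simp add: in_lists_conv_set subset_iff)
      then obtain fs where "ws = map (principal_part \<delta>s) fs" "set fs \<subseteq> I A"
        by (auto simp: in_lists_conv_set)
      then show "\<exists>fs. det (mat_of_rows ?n ws) = det (mat_of_rows ?n (map (principal_part \<delta>s) fs)) \<and>
          length fs = ?n \<and> set fs \<subseteq> I A"
        using ws(1) by (intro exI[of _ fs]) simp
    qed
    show "?E \<subseteq> ?D"
    proof clarify
      fix fs assume "length fs = ?n" "set fs \<subseteq> I A"
      then show "\<exists>ws. det (mat_of_rows ?n (map (principal_part \<delta>s) fs)) = det (mat_of_rows ?n ws) \<and>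
          length ws = ?n \<and> set ws \<subseteq> principal_part \<delta>s ` I A"
        by (intro exI[of _ "map (principal_part \<delta>s) fs"]) (simp add: image_mono)
    qed
  qed
  ultimately show ?thesis unfolding top_wedge_def by simp
qed

text \<open>
  The natural map \<open>F(J)\<^bsup>r+2\<^esup> \<rightarrow> F(JF(J))\<close> is an inclusion of subsheaves of \<open>k(V)\<close>, so it is an
  isomorphism iff the two subsheaves are equal.
\<close>
definition natural_map_iso ::
  "'a::field set \<Rightarrow> 'a set set \<Rightarrow> ('a \<Rightarrow> 'a) list \<Rightarrow> 'a sheaf \<Rightarrow> bool" where
  "natural_map_iso k V \<delta>s J \<longleftrightarrow> (\<forall>A\<in>affine_opens k V.
     sheaf_pow (F_sheaf \<delta>s J) (length \<delta>s + 2) A = F_sheaf \<delta>s (sheaf_mult J (F_sheaf \<delta>s J)) A)"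

text \<open>\<open>J\<^sub>i = I L\<^sub>0 \<dots> L\<^sub>i\<^sub>-\<^sub>1\<close> with \<open>L\<^sub>i = F(J\<^sub>i)\<close>, so \<open>J\<^sub>i\<^sub>+\<^sub>1 = J\<^sub>i L\<^sub>i\<close>.\<close>
primrec J_sheaf :: "('a::field \<Rightarrow> 'a) list \<Rightarrow> 'a sheaf \<Rightarrow> nat \<Rightarrow> 'a sheaf" where
  "J_sheaf \<delta>s I 0 = I"
| "J_sheaf \<delta>s I (Suc i) = sheaf_mult (J_sheaf \<delta>s I i) (F_sheaf \<delta>s (J_sheaf \<delta>s I i))"

definition L_sheaf :: "('a::field \<Rightarrow> 'a) list \<Rightarrow> 'a sheaf \<Rightarrow> nat \<Rightarrow> 'a sheaf" where
  "L_sheaf \<delta>s I i = F_sheaf \<delta>s (J_sheaf \<delta>s I i)"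

text \<open>
  The product of the powers \<open>L\<^sub>\<alpha>\<^bsup>a\<^sub>\<alpha>\<^esup>\<close> over the digits \<open>a\<^sub>\<alpha>\<close> of \<open>i\<close> in base \<open>b = r + 2\<close>. Since
  \<open>i < b\<^sup>i\<close>, all digits with \<open>\<alpha> \<ge> i\<close> vanish.
\<close>
definition R_sheaf :: "('a::field \<Rightarrow> 'a) list \<Rightarrow> 'a sheaf \<Rightarrow> nat \<Rightarrow> 'a sheaf" where
  "R_sheaf \<delta>s I i = (let b = length \<delta>s + 2 in
     foldl sheaf_mult structure_sheaf
       (map (\<lambda>\<alpha>. sheaf_pow (L_sheaf \<delta>s I \<alpha>) (i div b ^ \<alpha> mod b)) [0..<i]))"

text \<open>
  The sections of \<open>\<Oplus>\<^sub>i R\<^sub>i\<close> over an affine open set, as a subset of \<open>k(V)[T] = \<Oplus>\<^sub>i k(V) T\<^sup>i\<close>. The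
  multiplication of \<open>R\<close> is that of \<open>k(V)\<close>, in each pair of degrees.
\<close>
definition R_algebra :: "('a::field \<Rightarrow> 'a) list \<Rightarrow> 'a sheaf \<Rightarrow> 'a set \<Rightarrow> 'a poly set" where
  "R_algebra \<delta>s I A = {p. \<forall>i. coeff p i \<in> R_sheaf \<delta>s I i A}"

definition R_finite_type ::
  "'a::field set \<Rightarrow> 'a set set \<Rightarrow> ('a \<Rightarrow> 'a) list \<Rightarrow> 'a sheaf \<Rightarrow> bool" where
  "R_finite_type k V \<delta>s I \<longleftrightarrow>
     (\<forall>A\<in>affine_opens k V. fin_gen_algebra ((\<lambda>c. [:c:]) ` k) (R_algebra \<delta>s I A))"

end

(*
  Inside k(V), write F(J) for the span of the determinants of the (f_j, delta_1 f_j, ..., delta_r f_j).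
  Multiplying J by g multiplies F(J) by g^(r+1), and on a chart A[J/x] of the blowup of J, where J is
  generated by x, the span of the principal parts does not grow. Hence F(J) becomes x^(r+1) times
  Lambda^r of the differentials of A[J/x], so the Gauss blowup of the blowup of J is the blowup of J F(J),
  and V_i is the blowup of J_i.

  (3) => (2): if L_(t+1) = L_t^(r+2), then J_(t+2) = J_t L_t^(r+3), which has the same blowup as
  J_(t+1) = J_t L_t.

  (1) => (3): generators of R have degrees below (r+2)^(s+1) for large s, and then L_(s+1), the part of
  degree (r+2)^(s+1), is obtained by carrying from products of these, hence lies in L_s^(r+2).

  (2) => (1): once the tower is stationary from V_n on, L_(n+j) and L_n^((r+2)^j) agree on V_n. So every x
  in L_(n+j) satisfies x J_n^p <= J_n^p L_n^((r+2)^j) for some p. The bigraded algebra of the products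
  L_n^m J_n^N is noetherian, which makes the exponent p independent of j; therefore the part of R in
  degrees divisible by (r+2)^n is a finite module over the Rees algebra of L_n.
*)
theory Submission
  imports Defs
begin

text \<open>The exponent r + 2 is (r + 1) + 1: scaling supplies r + 1 factors F(J), and F(J) itself
  one more. Scaling yields only (r + 1)-st powers of single members; mixed products are reached by
  polarization, which is where characteristic zero enters. The obstacle in (2) => (1) is that
  stationarity controls L_(n+j) only after pullback to V_n, while R is formed on V, where L_(n+j)
  may be larger than the power of L_n. Coming back to V costs a power J_n^p, and if p grew with j
  the elements of R would have no common denominator. Independence of p concerns all degrees in L_n
  at once, hence a bigraded algebra in place of a single ring. With p uniform, a fixed h multiplies
  the part of degree q (r+2)^n into L_n^q for every q, so that h times these parts form an ideal of
  the Rees algebra of L_n, and noetherianity yields finiteness. Modules over different affine opens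
  are compared in common local rings. The local rings of a blowup are therefore described by
  homogeneous fractions, with no choice of chart, and F is shown to commute with localization and
  with passage to a chart.\<close>

section \<open>Subrings, submodules and spans inside a commutative ring\<close>

abbreviation mspan :: "'b::comm_ring_1 set \<Rightarrow> 'b set \<Rightarrow> 'b set" where
  "mspan A S \<equiv> is_submodule A hull S"

lemma subringD:
  assumes "is_subring A"
  shows subring_1: "1 \<in> A" and subring_0: "0 \<in> A"
    and subring_diff: "x \<in> A \<Longrightarrow> y \<in> A \<Longrightarrow> x - y \<in> A"
    and subring_uminus: "x \<in> A \<Longrightarrow> - x \<in> A"
    and subring_add: "x \<in> A \<Longrightarrow> y \<in> A \<Longrightarrow> x + y \<in> A"
    and subring_mult: "x \<in> A \<Longrightarrow> y \<in> A \<Longrightarrow> x * y \<in> A"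
proof -
  show 1: "1 \<in> A" using assms unfolding is_subring_def by blast
  have d: "x - y \<in> A" if "x \<in> A" "y \<in> A" for x y
    using assms that unfolding is_subring_def by blast
  then show "x \<in> A \<Longrightarrow> y \<in> A \<Longrightarrow> x - y \<in> A" .
  show 0: "0 \<in> A" using d[OF 1 1] by simp
  have u: "- x \<in> A" if "x \<in> A" for x using d[OF 0 that] by simp
  then show "x \<in> A \<Longrightarrow> - x \<in> A" .
  show "x \<in> A \<Longrightarrow> y \<in> A \<Longrightarrow> x + y \<in> A" using d[of x "- y"] u[of y] by simp
  show "x \<in> A \<Longrightarrow> y \<in> A \<Longrightarrow> x * y \<in> A"
    using assms unfolding is_subring_def by blast
qed

lemma subring_power: "is_subring A \<Longrightarrow> x \<in> A \<Longrightarrow> x ^ n \<in> A"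
  by (induction n) (auto intro: subringD)

lemma subring_sum: "is_subring A \<Longrightarrow> (\<And>i. i \<in> S \<Longrightarrow> f i \<in> A) \<Longrightarrow> sum f S \<in> A"
  by (induction S rule: infinite_finite_induct) (auto intro: subringD)

lemma subring_prod: "is_subring A \<Longrightarrow> (\<And>i. i \<in> S \<Longrightarrow> f i \<in> A) \<Longrightarrow> prod f S \<in> A"
  by (induction S rule: infinite_finite_induct) (auto intro: subringD)

lemma submoduleD:
  assumes "is_submodule A M"
  shows submodule_0: "0 \<in> M"
    and submodule_add: "x \<in> M \<Longrightarrow> y \<in> M \<Longrightarrow> x + y \<in> M"
    and submodule_scale: "a \<in> A \<Longrightarrow> x \<in> M \<Longrightarrow> a * x \<in> M"
  using assms unfolding is_submodule_def by blast+

lemma submoduleI: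
  assumes "0 \<in> M" "\<And>x y. x \<in> M \<Longrightarrow> y \<in> M \<Longrightarrow> x + y \<in> M"
    "\<And>a x. a \<in> A \<Longrightarrow> x \<in> M \<Longrightarrow> a * x \<in> M"
  shows "is_submodule A M"
  using assms unfolding is_submodule_def by blast

lemma submodule_sum: "is_submodule A M \<Longrightarrow> (\<And>i. i \<in> S \<Longrightarrow> f i \<in> M) \<Longrightarrow> sum f S \<in> M"
  by (induction S rule: infinite_finite_induct) (auto intro: submoduleD)

lemma submodule_diff:
  assumes "is_subring A" "is_submodule A M" "x \<in> M" "y \<in> M"
  shows "x - y \<in> M"
  using submodule_add[OF assms(2,3), of "- 1 * y"] submodule_scale[OF assms(2), of "-1" y] assms
  by (auto intro: subringD)

lemma submodule_subring: "is_subring A \<Longrightarrow> is_submodule A A"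
  by (auto simp: is_submodule_def intro: subringD)

lemma submodule_restrict: "is_submodule B M \<Longrightarrow> A \<subseteq> B \<Longrightarrow> is_submodule A M"
  by (auto simp: is_submodule_def)

lemma subring_submodule: "is_subring B \<Longrightarrow> A \<subseteq> B \<Longrightarrow> is_submodule A B"
  by (meson submodule_restrict submodule_subring)

lemma submodule_mspan [simp]: "is_submodule A (mspan A S)"
  by (rule is_submodule_hull)

lemma mspan_least: "is_submodule A M \<Longrightarrow> S \<subseteq> M \<Longrightarrow> mspan A S \<subseteq> M"
  by (rule hull_minimal)

lemma mspan_mspan: "A \<subseteq> B \<Longrightarrow> mspan B (mspan A X) = mspan B X"
proof
  show "mspan B X \<subseteq> mspan B (mspan A X)" by (intro hull_mono hull_subset)
  assume "A \<subseteq> B"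
  then show "mspan B (mspan A X) \<subseteq> mspan B X"
    by (intro mspan_least[OF submodule_mspan] mspan_least[OF submodule_restrict] hull_subset) auto
qed

lemma mspan_mono_ring: "A \<subseteq> B \<Longrightarrow> X \<subseteq> Y \<Longrightarrow> mspan A X \<subseteq> mspan B Y"
  by (meson hull_subset mspan_least order_trans submodule_mspan submodule_restrict)

lemma mspan_empty [simp]: "mspan A {} = {0}"
  using mspan_least[of A "{0}" "{}"] submodule_0[OF submodule_mspan, of A "{}"]
  by (simp add: is_submodule_def set_eq_subset)

lemma mspan_zero [simp]: "mspan A {0} = {0}"
  by (rule hull_same) (auto simp: is_submodule_def)

text \<open>This replaces induction over spans: once the condition \<open>u * y \<in> Z\<close> for
  all \<open>y\<close> is known to cut out a submodule, it need only be checked for \<open>u\<close>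
  in a set of generators.\<close>

lemma submodule_transporter: "is_submodule A Z \<Longrightarrow> is_submodule A {u. \<forall>y\<in>Y. u * y \<in> Z}"
  by (auto simp: is_submodule_def distrib_right mult.assoc)

lemma mspan_transport:
  assumes "x \<in> mspan A X" "is_submodule A Z" "\<And>x. x \<in> X \<Longrightarrow> x * y \<in> Z"
  shows "x * y \<in> Z"
  using mspan_least[OF submodule_transporter[OF assms(2), of "{y}"], of X] assms by auto

lemma mspan_scale_image:
  "mspan A ((*) g ` X) = (*) (g::'a::comm_ring_1) ` mspan A X"
proof
  have "is_submodule A ((*) g ` mspan A X)"
    
  proof (rule submoduleI)
    show "0 \<in> (*) g ` mspan A X" using submodule_0[OF submodule_mspan] by force
  next
    fix x y assume "x \<in> (*) g ` mspan A X" "y \<in> (*) g ` mspan A X"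
    then obtain u v where "u \<in> mspan A X" "v \<in> mspan A X" "x + y = g * (u + v)"
      by (auto simp: distrib_left)
    then show "x + y \<in> (*) g ` mspan A X"
      using submodule_add[OF submodule_mspan] by blast
  next
    fix a x assume "a \<in> A" "x \<in> (*) g ` mspan A X"
    then obtain u where "a \<in> A" "u \<in> mspan A X" "a * x = g * (a * u)"
      by (auto simp: mult.left_commute)
    then show "a * x \<in> (*) g ` mspan A X"
      using submodule_scale[OF submodule_mspan] by blast
  qed
  then show "mspan A ((*) g ` X) \<subseteq> (*) g ` mspan A X"
    by (intro mspan_least) (auto intro: hull_inc)
  show "(*) g ` mspan A X \<subseteq> mspan A ((*) g ` X)"
  proof clarify
    fix x assume "x \<in> mspan A X"
    then have "x * g \<in> mspan A ((*) g ` X)"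
      by (rule mspan_transport) (auto simp: mult.commute intro!: hull_inc)
    then show "g * x \<in> mspan A ((*) g ` X)" by (simp add: mult.commute)
  qed
qed

lemma mspan_one: "is_subring A \<Longrightarrow> mspan A {1} = A"
proof
  assume A: "is_subring A"
  show "mspan A {1} \<subseteq> A" using A by (intro mspan_least submodule_subring) (auto simp: subringD)
  show "A \<subseteq> mspan A {1}"
    using submodule_scale[OF submodule_mspan _ hull_inc[of 1 "{1}"]] by fastforce
qed

lemma mspan_single: "is_subring A \<Longrightarrow> mspan A {g} = (*) g ` A"
  using mspan_scale_image[of A g "{1}"] by (simp add: mspan_one)

section \<open>Products of submodules\<close>

definition smul :: "'b::comm_ring_1 set \<Rightarrow> 'b set \<Rightarrow> 'b set \<Rightarrow> 'b set" where
  "smul A X Y = mspan A {x * y | x y. x \<in> X \<and> y \<in> Y}"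

lemma submodule_smul [simp]: "is_submodule A (smul A X Y)"
  by (simp add: smul_def)

lemma smulI: "x \<in> X \<Longrightarrow> y \<in> Y \<Longrightarrow> x * y \<in> smul A X Y"
  unfolding smul_def by (rule hull_inc) blast

lemma smul_least:
  "is_submodule A Z \<Longrightarrow> (\<And>x y. x \<in> X \<Longrightarrow> y \<in> Y \<Longrightarrow> x * y \<in> Z) \<Longrightarrow> smul A X Y \<subseteq> Z"
  unfolding smul_def by (rule mspan_least) auto

lemma smul_mono: "X \<subseteq> X' \<Longrightarrow> Y \<subseteq> Y' \<Longrightarrow> smul A X Y \<subseteq> smul A X' Y'"
  unfolding smul_def by (rule hull_mono) blast

lemma smul_commute: "smul A X Y = smul A Y X"
  unfolding smul_def by (rule arg_cong[where f = "mspan A"]) (auto, (metis mult.commute)+)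

lemma smul_mspan_left [simp]: "smul A (mspan A X) Y = smul A X Y"
proof
  show "smul A (mspan A X) Y \<subseteq> smul A X Y"
    by (rule smul_least) (auto intro: mspan_transport smulI)
  show "smul A X Y \<subseteq> smul A (mspan A X) Y" by (intro smul_mono hull_subset) auto
qed

lemma smul_mspan_right [simp]: "smul A Y (mspan A X) = smul A Y X"
  using smul_mspan_left smul_commute by metis

lemma smul_assoc: "smul A (smul A X Y) Z = smul A X (smul A Y Z)"
proof -
  have *: "smul A (smul A X Y) Z \<subseteq> smul A X (smul A Y Z)" for X Y Z :: "'a set"
  proof (rule smul_least)
    fix u z assume u: "u \<in> smul A X Y" and z: "z \<in> Z"
    show "u * z \<in> smul A X (smul A Y Z)"
      using u[unfolded smul_def]
    proof (rule mspan_transport)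
      fix v assume "v \<in> {x * y |x y. x \<in> X \<and> y \<in> Y}"
      then obtain x y where "x \<in> X" "y \<in> Y" "v = x * y" by blast
      then show "v * z \<in> smul A X (smul A Y Z)"
        using smulI[OF \<open>x \<in> X\<close> smulI[OF \<open>y \<in> Y\<close> z]] by (simp add: mult.assoc)
    qed simp
  qed simp
  show ?thesis
    using *[of X Y Z] *[of Z Y X] by (auto simp: smul_commute)
qed

lemma smul_left_commute: "smul A X (smul A Y Z) = smul A Y (smul A X Z)"
  by (metis smul_assoc smul_commute)

lemmas smul_ac = smul_assoc smul_commute smul_left_commute

lemma smul_unit_left: "1 \<in> A \<Longrightarrow> is_submodule A X \<Longrightarrow> smul A A X = X"
proof
  assume *: "1 \<in> A" "is_submodule A X"
  show "smul A A X \<subseteq> X" using * by (intro smul_least) (auto simp: submodule_scale)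
  show "X \<subseteq> smul A A X" using smulI[OF *(1), of _ X A] by auto
qed

lemma smul_unit_right: "1 \<in> A \<Longrightarrow> is_submodule A X \<Longrightarrow> smul A X A = X"
  using smul_unit_left smul_commute by metis

lemma mspan_smul: "A \<subseteq> B \<Longrightarrow> mspan B (smul A X Y) = smul B (mspan B X) (mspan B Y)"
  unfolding smul_mspan_left smul_mspan_right by (simp add: smul_def mspan_mspan)

lemma smul_zero_left [simp]: "smul A {0} X = {0}"
proof
  show "smul A {0} X \<subseteq> {0}" by (rule smul_least) (auto simp: is_submodule_def)
  show "{0} \<subseteq> smul A {0} X" using submodule_0[OF submodule_smul] by auto
qed

lemma smul_zero_right [simp]: "smul A X {0} = {0}"
  using smul_commute smul_zero_left by metis

primrec spow :: "'b::comm_ring_1 set \<Rightarrow> 'b set \<Rightarrow> nat \<Rightarrow> 'b set" where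
  "spow A X 0 = A"
| "spow A X (Suc n) = smul A (spow A X n) X"

lemma submodule_spow [simp]: "is_subring A \<Longrightarrow> is_submodule A (spow A X n)"
  by (cases n) (auto simp: submodule_subring)

lemma spow_1: "is_subring A \<Longrightarrow> is_submodule A X \<Longrightarrow> spow A X (Suc 0) = X"
  by (simp add: smul_unit_left subringD)

lemma spow_add: "is_subring A \<Longrightarrow> spow A X (m + n) = smul A (spow A X m) (spow A X n)"
  by (induction n) (auto simp: smul_unit_right subringD smul_assoc)

lemma spow_mult: "is_subring A \<Longrightarrow> spow A (spow A X m) n = spow A X (m * n)"
  by (induction n) (auto simp: spow_add smul_commute)

lemma spow_smul: "is_subring A \<Longrightarrow> spow A (smul A X Y) n = smul A (spow A X n) (spow A Y n)"
  by (induction n) (auto simp: smul_unit_left submodule_subring subringD smul_ac)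

lemma spow_mspan [simp]: "spow A (mspan A X) n = spow A X n"
  by (induction n) auto

lemma spow_mono: "X \<subseteq> Y \<Longrightarrow> spow A X n \<subseteq> spow A Y n"
  by (induction n) (simp_all add: smul_mono)

lemma mspan_spow:
  assumes "is_subring B" "A \<subseteq> B" "1 \<in> A"
  shows "mspan B (spow A X n) = spow B (mspan B X) n"
proof (induction n)
  case 0
  have "b \<in> mspan B A" if "b \<in> B" for b
    using submodule_scale[OF submodule_mspan that hull_inc[OF assms(3), of "is_submodule B"]] by simp
  then have "mspan B A = B"
    using assms mspan_least[OF submodule_subring, of B A] by auto
  then show ?case by simp
next
  case (Suc n)
  then show ?case using assms by (simp add: mspan_smul)
qed

lemma power_in_spow: "is_subring A \<Longrightarrow> x \<in> X \<Longrightarrow> x ^ n \<in> spow A X n"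
  by (induction n) (auto simp: subringD smulI mult.commute[of x])

lemma spow_in_add:
  "is_subring A \<Longrightarrow> x \<in> spow A X m \<Longrightarrow> y \<in> spow A X n \<Longrightarrow> x * y \<in> spow A X (m + n)"
  by (simp add: spow_add smulI)

lemma submodule_scale_image: "is_submodule A M \<Longrightarrow> is_submodule A ((*) g ` M)"
  using mspan_scale_image[of A g M] submodule_mspan[of A "(*) g ` M"] by (simp add: hull_same)

lemma smul_scale_image: "smul A ((*) g ` X) Y = (*) g ` smul A X Y"
proof
  show "smul A ((*) g ` X) Y \<subseteq> (*) g ` smul A X Y"
  proof (rule smul_least[OF submodule_scale_image[OF submodule_smul]])
    fix x y assume "x \<in> (*) g ` X" "y \<in> Y"
    then obtain u where "u \<in> X" "x * y = g * (u * y)" by (auto simp: mult.assoc)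
    then show "x * y \<in> (*) g ` smul A X Y" using smulI[OF _ \<open>y \<in> Y\<close>] by blast
  qed
  show "(*) g ` smul A X Y \<subseteq> smul A ((*) g ` X) Y"
  proof clarify
    fix u assume "u \<in> smul A X Y"
    then have "u * g \<in> smul A ((*) g ` X) Y"
      unfolding smul_def[of A X]
    proof (rule mspan_transport[OF _ submodule_smul])
      fix v assume "v \<in> {x * y |x y. x \<in> X \<and> y \<in> Y}"
      then obtain x y where "x \<in> X" "y \<in> Y" "v * g = (g * x) * y" by (auto simp: mult_ac)
      then show "v * g \<in> smul A ((*) g ` X) Y" using smulI[of "g * x"] by simp
    qed
    then show "g * u \<in> smul A ((*) g ` X) Y" by (simp add: mult.commute)
  qed
qed

section \<open>Noetherian subrings\<close>

definition noeth :: "'b::comm_ring_1 set \<Rightarrow> bool" where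
  "noeth A \<longleftrightarrow> is_subring A \<and>
     (\<forall>Z\<subseteq>A. is_submodule A Z \<longrightarrow> (\<exists>S. finite S \<and> Z = mspan A S))"

lemma subring_subring_hull [simp]: "is_subring (is_subring hull S)"
  by (rule is_subring_hull)

lemma subring_hull_least: "is_subring B \<Longrightarrow> S \<subseteq> B \<Longrightarrow> is_subring hull S \<subseteq> B"
  by (rule hull_minimal)

lemma submodule_UN_chain:
  assumes C: "\<And>d::nat. is_submodule A (C d)" and mono: "\<And>d. C d \<subseteq> C (Suc d)"
  shows "is_submodule A (\<Union>d. C d)"
proof (rule submoduleI)
  show "0 \<in> (\<Union>d. C d)" using submodule_0[OF C] by blast
  fix p q assume "p \<in> (\<Union>d. C d)" "q \<in> (\<Union>d. C d)"
  then obtain i j where "p \<in> C i" "q \<in> C j" by auto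
  moreover have "C i \<subseteq> C (max i j)" "C j \<subseteq> C (max i j)"
    by (intro lift_Suc_mono_le[of C, OF mono]; simp)+
  ultimately show "p + q \<in> (\<Union>d. C d)" using submodule_add[OF C] by blast
next
  fix a x assume "a \<in> A" "x \<in> (\<Union>d. C d)"
  then show "a * x \<in> (\<Union>d. C d)" using submodule_scale[OF C] by auto
qed

lemma finite_subset_UN_chain:
  assumes "finite S" "S \<subseteq> (\<Union>d. C d)" "\<And>d::nat. C d \<subseteq> C (Suc d)"
  shows "\<exists>D. S \<subseteq> C D"
  using assms
proof (induction S)
  case (insert x S)
  then obtain D d where "S \<subseteq> C D" "x \<in> C d" by auto
  moreover have "C i \<subseteq> C j" if "i \<le> j" for i j
    using lift_Suc_mono_le[of C, OF insert.prems(2) that] .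
  ultimately have "insert x S \<subseteq> C (max D d)"
    by (meson in_mono insert_subset max.cobounded1 max.cobounded2 order_trans)
  then show ?case by blast
qed simp

text \<open>
  The usual leading coefficient argument, applied to \<open>A[x]\<close> directly: \<open>x\<close> need not be transcendental,
  \<open>C d\<close> consists of the leading coefficients of representations of length \<open>d\<close> of members of \<open>Z\<close>.
\<close>
lemma noeth_insert:
  assumes "noeth A"
  shows "noeth (is_subring hull (insert x A))"
  unfolding noeth_def
proof (intro conjI allI impI subring_subring_hull)
  let ?B = "is_subring hull (insert x A)"
  fix Z assume ZB: "Z \<subseteq> ?B" and Z: "is_submodule ?B Z"
  have A: "is_subring A" using assms by (simp add: noeth_def)
  have B: "is_subring ?B" by simp
  have AB: "A \<subseteq> ?B" and xB: "x \<in> ?B" by (auto intro: hull_inc)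
  define Q where "Q d = {\<Sum>i<d. a i * x ^ i | a. \<forall>i. a i \<in> A}" for d
  have QI: "(\<Sum>i<d. a i * x ^ i) \<in> Q d" if "\<And>i. a i \<in> A" for a d
    using that unfolding Q_def by auto
  have Qadd: "p + q \<in> Q d" if pq: "p \<in> Q d" "q \<in> Q d" for p q d
  proof -
    from pq obtain a b where ab: "\<And>i. a i \<in> A" "\<And>i. b i \<in> A"
      and "p = (\<Sum>i<d. a i * x ^ i)" "q = (\<Sum>i<d. b i * x ^ i)" unfolding Q_def by auto
    then have "p + q = (\<Sum>i<d. (a i + b i) * x ^ i)"
      by (simp add: sum.distrib distrib_right)
    then show ?thesis using QI[of "\<lambda>i. a i + b i" d] ab by (auto intro: subringD[OF A])
  qed
  have Qscale: "c * p \<in> Q d" if "c \<in> A" "p \<in> Q d" for c p d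
  proof -
    from that obtain a where a: "\<And>i. a i \<in> A" and "p = (\<Sum>i<d. a i * x ^ i)"
      unfolding Q_def by auto
    then have "c * p = (\<Sum>i<d. (c * a i) * x ^ i)" by (simp add: sum_distrib_left mult.assoc)
    then show ?thesis using QI[of "\<lambda>i. c * a i" d] a that by (auto intro: subringD[OF A])
  qed
  have Q0: "0 \<in> Q d" for d using QI[of "\<lambda>_. 0" d] subring_0[OF A] by simp
  have Qmod: "is_submodule A (Q d)" for d
    unfolding is_submodule_def using Q0 Qadd Qscale by auto
  have QSuc: "p \<in> Q (Suc d) \<longleftrightarrow> (\<exists>q\<in>Q d. \<exists>a\<in>A. p = q + a * x ^ d)" for p d
  proof
    assume "p \<in> Q (Suc d)"
    then show "\<exists>q\<in>Q d. \<exists>a\<in>A. p = q + a * x ^ d" unfolding Q_def by fastforce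
  next
    assume "\<exists>q\<in>Q d. \<exists>a\<in>A. p = q + a * x ^ d"
    then obtain a c where *: "\<And>i. a i \<in> A" "c \<in> A" "p = (\<Sum>i<d. a i * x ^ i) + c * x ^ d"
      unfolding Q_def by auto
    have "p = (\<Sum>i<Suc d. (if i = d then c else a i) * x ^ i)" using * by simp
    then show "p \<in> Q (Suc d)" using QI[of "\<lambda>i. if i = d then c else a i" "Suc d"] * by auto
  qed
  have Qmono: "Q d \<subseteq> Q (Suc d)" for d
    using subring_0[OF A] by (force simp: QSuc)
  have Qx: "x * p \<in> Q (Suc d)" if "p \<in> Q d" for p d
    using that
  proof (induction d arbitrary: p)
    case 0
    then have "p = 0" by (auto simp: Q_def)
    then show ?case using Q0 by simp
  next
    case (Suc d)
    then obtain q a where "q \<in> Q d" "a \<in> A" "p = q + a * x ^ d" by (auto simp: QSuc)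
    moreover from this have "x * p = x * q + a * x ^ Suc d"
      by (simp add: algebra_simps)
    ultimately show ?case
      using Suc.IH[of q] QSuc[of "x * p" "Suc d"] by blast
  qed
  have QB: "Q d \<subseteq> ?B" for d
    unfolding Q_def using AB xB by (auto intro!: subring_sum[OF B] subring_mult[OF B] subring_power[OF B])
  have "?B \<subseteq> (\<Union>d. Q d)"
  proof -
    have mod: "is_submodule A (\<Union>d. Q d)"
      using Qmod Qmono by (rule submodule_UN_chain)
    have powx: "x ^ n * q \<in> (\<Union>d. Q d)" if "q \<in> (\<Union>d. Q d)" for n q
    proof (induction n)
      case (Suc n)
      then obtain d where "x ^ n * q \<in> Q d" by blast
      from Qx[OF this] show ?case by (auto simp: mult.assoc)
    qed (use that in simp)
    have "is_subring (\<Union>d. Q d)"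
      unfolding is_subring_def
    proof (intro conjI ballI)
      show "1 \<in> (\<Union>d. Q d)" using QI[of "\<lambda>_. 1" 1] subring_1[OF A] by auto
      fix p q assume pq: "p \<in> (\<Union>d. Q d)" "q \<in> (\<Union>d. Q d)"
      then show "p - q \<in> (\<Union>d. Q d)" using submodule_diff[OF A mod] by blast
      obtain d a where "\<And>i. a i \<in> A" "p = (\<Sum>i<d. a i * x ^ i)"
        using pq unfolding Q_def by auto
      then have *: "p * q = (\<Sum>i<d. a i * (x ^ i * q))" and a: "\<And>i. a i \<in> A"
        by (simp_all add: sum_distrib_right mult.assoc)
      show "p * q \<in> (\<Union>d. Q d)"
        unfolding * by (intro submodule_sum[OF mod] submodule_scale[OF mod] a powx[OF pq(2)])
    qed
    moreover have "a \<in> Q 1" if "a \<in> A" for a using QI[of "\<lambda>_. a" 1] that by simp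
    moreover have "x \<in> Q 2"
      using QI[of "\<lambda>i. if i = 1 then 1 else 0" 2] subringD[OF A] by (simp add: numeral_2_eq_2)
    ultimately show ?thesis by (intro subring_hull_least) auto
  qed
  note BQ = this
  define C where "C d = {a \<in> A. \<exists>q\<in>Q d. q + a * x ^ d \<in> Z}" for d
  have Cmod: "is_submodule A (C d)" for d
    
  proof (rule submoduleI)
    show "0 \<in> C d"
      unfolding C_def using subring_0[OF A] Q0 submodule_0[OF Z] by auto
  next
    fix a b assume "a \<in> C d" "b \<in> C d"
    then obtain p q where *: "a \<in> A" "b \<in> A" "p \<in> Q d" "q \<in> Q d"
        "p + a * x ^ d \<in> Z" "q + b * x ^ d \<in> Z" unfolding C_def by auto
    then have "(p + q) + (a + b) * x ^ d \<in> Z"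
      using submodule_add[OF Z *(5,6)] by (simp add: algebra_simps)
    then show "a + b \<in> C d" unfolding C_def using * Qadd subring_add[OF A] by auto
  next
    fix c a assume c: "c \<in> A" and "a \<in> C d"
    then obtain p where *: "a \<in> A" "p \<in> Q d" "p + a * x ^ d \<in> Z" unfolding C_def by auto
    then have "c * p + (c * a) * x ^ d \<in> Z"
      using submodule_scale[OF Z _ *(3), of c] c AB by (auto simp: algebra_simps)
    then show "c * a \<in> C d" unfolding C_def using * c Qscale subring_mult[OF A] by auto
  qed
  have Cmono: "C d \<subseteq> C (Suc d)" for d
  proof
    fix a assume "a \<in> C d"
    then obtain p where *: "a \<in> A" "p \<in> Q d" "p + a * x ^ d \<in> Z" unfolding C_def by auto
    then have "x * p + a * x ^ Suc d \<in> Z"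
      using submodule_scale[OF Z xB *(3)] by (simp add: algebra_simps)
    then show "a \<in> C (Suc d)" unfolding C_def using * Qx by blast
  qed
  have "\<exists>S. finite S \<and> C d = mspan A S" for d
    using assms Cmod unfolding noeth_def by (auto simp: C_def)
  then obtain S where S: "\<And>d. finite (S d)" "\<And>d. C d = mspan A (S d)" by metis
  have "is_submodule A (\<Union>d. C d)"
    using Cmod Cmono by (rule submodule_UN_chain)
  moreover have "(\<Union>d. C d) \<subseteq> A" by (auto simp: C_def)
  ultimately obtain S' where S': "finite S'" "(\<Union>d. C d) = mspan A S'"
    using assms unfolding noeth_def by meson
  then obtain D where D: "S' \<subseteq> C D"
    using finite_subset_UN_chain[of S' C] Cmono hull_subset[of S' "is_submodule A"] by auto
  then have CD: "C d \<subseteq> C D" for d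
    using S'(2) mspan_least[OF Cmod D] by blast
  have "\<forall>d c. c \<in> S d \<longrightarrow> (\<exists>q\<in>Q d. q + c * x ^ d \<in> Z)"
    using S(2) hull_subset[of _ "is_submodule A"] unfolding C_def by blast
  then obtain w where w: "\<And>d c. c \<in> S d \<Longrightarrow> w d c \<in> Q d \<and> w d c + c * x ^ d \<in> Z" by metis
  define E where "E = (\<Union>d\<in>{..D}. (\<lambda>c. w d c + c * x ^ d) ` S d)"
  have EZ: "mspan ?B E \<subseteq> Z" using w unfolding E_def by (intro mspan_least[OF Z]) auto
  have low: "\<exists>q\<in>Q e. q + a * x ^ e \<in> mspan ?B E" if e: "e \<le> D" and "a \<in> C e" for a e
  proof -
    have "is_submodule A {a. \<exists>q\<in>Q e. q + a * x ^ e \<in> mspan ?B E}"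
      
    proof (rule submoduleI)
      show "0 \<in> {a. \<exists>q\<in>Q e. q + a * x ^ e \<in> mspan ?B E}"
        using Q0 submodule_0[OF submodule_mspan] by auto
    next
      fix a b assume "a \<in> {a. \<exists>q\<in>Q e. q + a * x ^ e \<in> mspan ?B E}"
        "b \<in> {a. \<exists>q\<in>Q e. q + a * x ^ e \<in> mspan ?B E}"
      then obtain p q where *: "p \<in> Q e" "q \<in> Q e"
         "p + a * x ^ e \<in> mspan ?B E" "q + b * x ^ e \<in> mspan ?B E" by auto
      then have "(p + q) + (a + b) * x ^ e \<in> mspan ?B E"
        using submodule_add[OF submodule_mspan *(3,4)] by (simp add: algebra_simps)
      then show "a + b \<in> {a. \<exists>q\<in>Q e. q + a * x ^ e \<in> mspan ?B E}" using * Qadd by auto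
    next
      fix c a assume c: "c \<in> A" and "a \<in> {a. \<exists>q\<in>Q e. q + a * x ^ e \<in> mspan ?B E}"
      then obtain p where *: "p \<in> Q e" "p + a * x ^ e \<in> mspan ?B E" by auto
      then have "c * p + (c * a) * x ^ e \<in> mspan ?B E"
        using submodule_scale[OF submodule_mspan _ *(2), of c] c AB by (auto simp: algebra_simps)
      then show "c * a \<in> {a. \<exists>q\<in>Q e. q + a * x ^ e \<in> mspan ?B E}" using * c Qscale by auto
    qed
    moreover have "S e \<subseteq> {a. \<exists>q\<in>Q e. q + a * x ^ e \<in> mspan ?B E}"
      using w e unfolding E_def by (auto intro!: hull_inc)
    ultimately show ?thesis using that S(2) mspan_least by blast
  qed
  have "Z \<inter> Q d \<subseteq> mspan ?B E" for d
  proof (induction d)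
    case 0
    then show ?case using submodule_0[OF submodule_mspan] by (auto simp: Q_def)
  next
    case (Suc d)
    show ?case
    proof
      fix z assume "z \<in> Z \<inter> Q (Suc d)"
      then obtain q a where z: "z \<in> Z" "q \<in> Q d" "a \<in> A" "z = q + a * x ^ d"
        by (auto simp: QSuc)
      \<comment> \<open>Beyond D the leading coefficients are already those found at D, so a
        representation at D is raised to d by a power of x; up to D the generators belonging to d
        itself are used.\<close>
      define e where "e = min d D"
      have "a \<in> C e"
        using z CD[of d] unfolding e_def C_def min_def by auto
      then obtain p where p: "p \<in> Q e" "p + a * x ^ e \<in> mspan ?B E"
        using low[of e a] by (auto simp: e_def)
      have pow: "x ^ n * p \<in> Q (e + n)" for n
        by (induction n) (use p Qx in \<open>auto simp: mult.assoc\<close>)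
      have de: "e + (d - e) = d" by (simp add: e_def)
      have "x ^ (d - e) * (p + a * x ^ e) \<in> mspan ?B E"
        by (rule submodule_scale[OF submodule_mspan subring_power[OF B xB] p(2)])
      moreover have "x ^ (d - e) * (p + a * x ^ e) = x ^ (d - e) * p + a * x ^ (e + (d - e))"
        by (simp add: power_add algebra_simps)
      ultimately have h: "x ^ (d - e) * p + a * x ^ d \<in> mspan ?B E" by (simp add: de)
      have "z - (x ^ (d - e) * p + a * x ^ d) \<in> Z"
        using h EZ z(1) submodule_diff[OF B Z] by blast
      moreover have "z - (x ^ (d - e) * p + a * x ^ d) = q - x ^ (d - e) * p"
        using z by simp
      moreover have "q - x ^ (d - e) * p \<in> Q d"
        using submodule_diff[OF A Qmod z(2)] pow[of "d - e"] de by simp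
      ultimately have "z - (x ^ (d - e) * p + a * x ^ d) \<in> mspan ?B E"
        using Suc.IH by (metis IntI subsetD)
      from submodule_add[OF submodule_mspan this h] show "z \<in> mspan ?B E" by simp
    qed
  qed
  then have "Z = mspan ?B E" using EZ ZB BQ by blast
  moreover have "finite E" unfolding E_def using S(1) by auto
  ultimately show "\<exists>S. finite S \<and> Z = mspan ?B S" by blast
qed

lemma noeth_fin_gen:
  assumes "noeth k" "fin_gen_algebra k A"
  shows "noeth A"
proof -
  obtain S where "finite S" "A = is_subring hull (k \<union> S)"
    using assms(2) unfolding fin_gen_algebra_def by blast
  moreover from this(1) have "noeth (is_subring hull (k \<union> S))"
  proof (induction S)
    case empty
    then show ?case using assms(1) by (simp add: hull_same noeth_def)
  next
    case (insert x S)
    have "is_subring hull (insert x (is_subring hull (k \<union> S))) = is_subring hull (k \<union> insert x S)"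
      by (metis Un_insert_right hull_insert)
    then show ?case using noeth_insert[OF insert.IH, of x] by metis
  qed
  ultimately show ?thesis by simp
qed

lemma noeth_subfield:
  fixes k :: "'a::field set"
  assumes "is_subfield k"
  shows "noeth k"
  unfolding noeth_def
proof (intro conjI allI impI)
  show k: "is_subring k" using assms by (simp add: is_subfield_def)
  fix Z assume "Z \<subseteq> k" and Z: "is_submodule k Z"
  show "\<exists>S. finite S \<and> Z = mspan k S"
  proof (cases "Z = {0}")
    case True
    then show ?thesis by (intro exI[of _ "{}"]) simp
  next
    case False
    then obtain z where "z \<in> Z" "z \<noteq> 0" using submodule_0[OF Z] by blast
    then have "1 \<in> Z"
      using submodule_scale[OF Z, of "inverse z" z] assms \<open>Z \<subseteq> k\<close> unfolding is_subfield_def by auto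
    then have "Z = mspan k {1}"
      using submodule_scale[OF Z, of _ 1] \<open>Z \<subseteq> k\<close> by (auto simp: mspan_one[OF k])
    then show ?thesis by blast
  qed
qed

section \<open>Fractional ideals\<close>

definition fractional_ideal :: "'a::field set \<Rightarrow> 'a set \<Rightarrow> bool" where
  "fractional_ideal A J \<longleftrightarrow> is_submodule A J \<and> (\<exists>d\<in>A. d \<noteq> 0 \<and> (\<forall>x\<in>J. d * x \<in> A))"

lemma fractional_ideal_fin_gen:
  assumes "noeth A" "fractional_ideal A J"
  obtains S where "finite S" "J = mspan A S"
proof -
  obtain d where d: "d \<noteq> 0" "\<forall>x\<in>J. d * x \<in> A" and J: "is_submodule A J"
    using assms(2) unfolding fractional_ideal_def by blast
  have "(*) d ` J \<subseteq> A" using d by auto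
  then obtain S where S: "finite S" "(*) d ` J = mspan A S"
    using assms(1) submodule_scale_image[OF J] unfolding noeth_def by meson
  have "J = (*) (inverse d) ` (*) d ` J" using d(1) by (simp add: image_image flip: mult.assoc)
  also have "\<dots> = mspan A ((*) (inverse d) ` S)" by (simp add: S(2) mspan_scale_image)
  finally show thesis using that S(1) by blast
qed

lemma fractional_ideal_ring: "is_subring A \<Longrightarrow> fractional_ideal A A"
  unfolding fractional_ideal_def
  by (auto simp: submodule_subring subringD intro!: bexI[of _ 1])

lemma fractional_ideal_ideal: "is_subring A \<Longrightarrow> is_submodule A J \<Longrightarrow> J \<subseteq> A \<Longrightarrow> fractional_ideal A J"
  unfolding fractional_ideal_def by (auto simp: subringD intro!: bexI[of _ 1])

lemma fractional_ideal_smul: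
  assumes A: "is_subring A" and "fractional_ideal A X" "fractional_ideal A Y"
  shows "fractional_ideal A (smul A X Y)"
proof -
  obtain d e where d: "d \<in> A" "d \<noteq> 0" "\<forall>x\<in>X. d * x \<in> A" and e: "e \<in> A" "e \<noteq> 0" "\<forall>x\<in>Y. e * x \<in> A"
    using assms unfolding fractional_ideal_def by blast
  have "is_submodule A {u. \<forall>y\<in>{d * e}. u * y \<in> A}"
    using A by (intro submodule_transporter submodule_subring)
  moreover have "x * y * (d * e) \<in> A" if "x \<in> X" "y \<in> Y" for x y
    using subring_mult[OF A, of "d * x" "e * y"] d e that by (auto simp: mult_ac)
  ultimately have "smul A X Y \<subseteq> {u. \<forall>y\<in>{d * e}. u * y \<in> A}" by (intro smul_least) auto
  then show ?thesis
    unfolding fractional_ideal_def using d e subring_mult[OF A]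
    by (intro conjI bexI[of _ "d * e"]) (auto simp: mult.commute[of "d * e"])
qed

lemma fractional_ideal_spow:
  "is_subring A \<Longrightarrow> fractional_ideal A X \<Longrightarrow> fractional_ideal A (spow A X n)"
  by (induction n) (simp_all add: fractional_ideal_smul fractional_ideal_ring)

section \<open>Local rings\<close>

lemma local_subring: "is_local_subring Q \<Longrightarrow> is_subring Q"
  by (simp add: is_local_subring_def)

lemma submodule_nonunits:
  assumes "is_local_subring Q"
  shows "is_submodule Q (nonunits Q)"
proof (rule submoduleI)
  have Q: "is_subring Q" using assms by (rule local_subring)
  show "0 \<in> nonunits Q" using Q by (simp add: nonunits_def subringD)
  show "x + y \<in> nonunits Q" if "x \<in> nonunits Q" "y \<in> nonunits Q" for x y
    using assms that unfolding is_local_subring_def by blast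
  fix a x assume a: "a \<in> Q" and x: "x \<in> nonunits Q"
  show "a * x \<in> nonunits Q"
  proof (rule ccontr)
    assume "a * x \<notin> nonunits Q"
    then have "a * x \<noteq> 0" "inverse (a * x) \<in> Q"
      using a x subring_mult[OF Q] by (auto simp: nonunits_def)
    then have "inverse x \<in> Q" using subring_mult[OF Q a, of "inverse (a * x)"] by (simp flip: mult.assoc)
    then show False using x \<open>a * x \<noteq> 0\<close> by (auto simp: nonunits_def)
  qed
qed

lemma prime_ideal_in_contract:
  assumes Q: "is_local_subring Q" and A: "is_subring A" "A \<subseteq> Q"
  shows "prime_ideal_in A (A \<inter> nonunits Q)"
  unfolding prime_ideal_in_def
proof (intro conjI ballI impI)
  have QR: "is_subring Q" using Q by (rule local_subring)
  note N = submodule_nonunits[OF Q]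
  show "is_submodule A (A \<inter> nonunits Q)"
    by (rule submoduleI)
      (use A submoduleD[OF N] subringD[OF A(1)] in auto)
  show "1 \<notin> A \<inter> nonunits Q" using QR by (simp add: nonunits_def subringD)
  fix x y assume "x \<in> A" "y \<in> A" "x * y \<in> A \<inter> nonunits Q"
  then show "x \<in> A \<inter> nonunits Q \<or> y \<in> A \<inter> nonunits Q"
    using A subring_mult[OF QR, of "inverse x" "inverse y"] by (auto simp: nonunits_def)
qed simp

text \<open>The prime is recovered from Q as the contraction of its nonunits, so membership can be
  expressed by units of Q alone. In this form one local ring can be compared across several
  coordinate rings.\<close>

lemma affine_model_iff:
  assumes A: "is_subring A"
  shows "Q \<in> affine_model A \<longleftrightarrow> is_local_subring Q \<and> A \<subseteq> Q \<and>
    (\<forall>x\<in>Q. \<exists>a\<in>A. \<exists>s\<in>A. s \<noteq> 0 \<and> inverse s \<in> Q \<and> x = a / s)"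
proof
  assume "Q \<in> affine_model A"
  then obtain p where p: "prime_ideal_in A p" "Q = localization A p"
    unfolding affine_model_def by blast
  have one: "1 \<in> A - p" and zero: "0 \<in> p"
    using A p(1) by (auto simp: prime_ideal_in_def subringD submoduleD)
  have "A \<subseteq> Q" using one unfolding p(2) localization_def by force
  moreover have "\<exists>a\<in>A. \<exists>s\<in>A. s \<noteq> 0 \<and> inverse s \<in> Q \<and> x = a / s" if "x \<in> Q" for x
  proof -
    obtain a s where *: "a \<in> A" "s \<in> A - p" "x = a / s"
      using \<open>x \<in> Q\<close> unfolding p(2) localization_def by blast
    moreover have "inverse s \<in> Q"
      using *(2) one unfolding p(2) localization_def by (auto simp: inverse_eq_divide)
    moreover have "s \<noteq> 0" using * zero by auto
    ultimately show ?thesis by blast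
  qed
  ultimately show "is_local_subring Q \<and> A \<subseteq> Q \<and>
      (\<forall>x\<in>Q. \<exists>a\<in>A. \<exists>s\<in>A. s \<noteq> 0 \<and> inverse s \<in> Q \<and> x = a / s)"
    using is_local_subring_localization[OF A p(1)] p(2) by blast
next
  assume *: "is_local_subring Q \<and> A \<subseteq> Q \<and>
      (\<forall>x\<in>Q. \<exists>a\<in>A. \<exists>s\<in>A. s \<noteq> 0 \<and> inverse s \<in> Q \<and> x = a / s)"
  then have Q: "is_subring Q" by (simp add: local_subring)
  have "Q = localization A (A \<inter> nonunits Q)"
  proof (intro equalityI subsetI)
    fix x assume "x \<in> Q"
    then obtain a s where "a \<in> A" "s \<in> A" "s \<noteq> 0" "inverse s \<in> Q" "x = a / s" using * by blast
    then show "x \<in> localization A (A \<inter> nonunits Q)"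
      unfolding localization_def nonunits_def by blast
  next
    fix x assume "x \<in> localization A (A \<inter> nonunits Q)"
    then obtain a s where "a \<in> A" "s \<in> A" "s \<notin> nonunits Q" "x = a / s"
      unfolding localization_def by blast
    then have "a \<in> Q" "inverse s \<in> Q" "x = a * inverse s"
      using * by (auto simp: nonunits_def divide_inverse)
    then show "x \<in> Q" using subring_mult[OF Q] by blast
  qed
  then show "Q \<in> affine_model A"
    using prime_ideal_in_contract[of Q A] A * unfolding affine_model_def by blast
qed

text \<open>This is the centre of Q on the spectrum of A: the contraction of the maximal ideal of Q
  is the prime to localize at.\<close>

lemma affine_model_localize:
  assumes A: "is_subring A" and Q: "is_local_subring Q" "A \<subseteq> Q"
  obtains P where "P \<in> affine_model A" "dominates Q P"
proof
  let ?p = "A \<inter> nonunits Q"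
  have p: "prime_ideal_in A ?p" by (rule prime_ideal_in_contract[OF Q(1) A Q(2)])
  show "localization A ?p \<in> affine_model A" using p unfolding affine_model_def by blast
  show "dominates Q (localization A ?p)"
    unfolding dominates_def
  proof (intro conjI subsetI)
    have QR: "is_subring Q" using Q(1) by (rule local_subring)
    have inv: "s \<in> Q \<and> inverse s \<in> Q \<and> s \<noteq> 0" if "s \<in> A - ?p" for s
      using that Q(2) by (auto simp: nonunits_def)
    fix x assume "x \<in> localization A ?p"
    then show "x \<in> Q"
      using inv Q(2) subring_mult[OF QR] unfolding localization_def by (auto simp: divide_inverse)
  next
    have QR: "is_subring Q" using Q(1) by (rule local_subring)
    fix x assume x: "x \<in> nonunits (localization A ?p)"
    then obtain a s where *: "a \<in> A" "s \<in> A - ?p" "x = a / s"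
      unfolding nonunits_def localization_def by blast
    have s: "s \<noteq> 0" "inverse s \<in> Q" using * Q(2) by (auto simp: nonunits_def)
    have "a \<in> nonunits Q"
    proof (rule ccontr)
      assume a: "a \<notin> nonunits Q"
      then have "inverse x \<in> localization A ?p"
        using * unfolding localization_def by force
      moreover have "x \<noteq> 0" using a * s Q(2) by (auto simp: nonunits_def)
      ultimately show False using x by (auto simp: nonunits_def)
    qed
    then show "x \<in> nonunits Q"
      using submodule_scale[OF submodule_nonunits[OF Q(1)] s(2)] *(3)
      by (simp add: divide_inverse mult.commute)
  qed
qed

text \<open>Zorn's lemma gives an ideal maximal among the proper ones above C. Maximality is used in
  the form \<open>inv\<close>: for x outside p some 1 - b x lies in p, and multiplying this by y
  yields primality.\<close>

lemma maximal_ideal_exists: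
  fixes B :: "'a::comm_ring_1 set"
  assumes B: "is_subring B" and C: "is_submodule B C" "C \<subseteq> B" "1 \<notin> C"
  obtains p where "prime_ideal_in B p" "C \<subseteq> p"
proof -
  define \<I> where "\<I> = {p. is_submodule B p \<and> p \<subseteq> B \<and> 1 \<notin> p \<and> C \<subseteq> p}"
  have "\<Union>\<C> \<in> \<I>" if ne: "\<C> \<noteq> {}" and ch: "subset.chain \<I> \<C>" for \<C>
  proof -
    have sub: "\<C> \<subseteq> \<I>" and tot: "\<And>X Y. X \<in> \<C> \<Longrightarrow> Y \<in> \<C> \<Longrightarrow> X \<subseteq> Y \<or> Y \<subseteq> X"
      using ch unfolding subset_chain_def by blast+
    have mod: "is_submodule B X" if "X \<in> \<C>" for X using sub that unfolding \<I>_def by blast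
    obtain X0 where X0: "X0 \<in> \<C>" using ne by (meson ex_in_conv)
    have "is_submodule B (\<Union>\<C>)"
    proof (rule submoduleI)
      show "0 \<in> \<Union>\<C>" using submodule_0[OF mod[OF X0]] X0 by (rule UnionI[rotated])
    next
      fix x y assume "x \<in> \<Union>\<C>" "y \<in> \<Union>\<C>"
      then obtain X Y where XY: "x \<in> X" "X \<in> \<C>" "y \<in> Y" "Y \<in> \<C>" by (elim UnionE)
      have "\<exists>Z\<in>\<C>. x \<in> Z \<and> y \<in> Z" using tot[OF XY(2,4)] XY by (meson subsetD)
      then obtain Z where Z: "Z \<in> \<C>" "x \<in> Z" "y \<in> Z" by (elim bexE conjE)
      show "x + y \<in> \<Union>\<C>" by (rule UnionI[OF Z(1) submodule_add[OF mod[OF Z(1)] Z(2,3)]])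
    next
      fix a x assume "a \<in> B" "x \<in> \<Union>\<C>"
      then obtain Z where Z: "a \<in> B" "Z \<in> \<C>" "x \<in> Z" by (elim UnionE)
      show "a * x \<in> \<Union>\<C>" by (rule UnionI[OF Z(2) submodule_scale[OF mod[OF Z(2)] Z(1,3)]])
    qed
    moreover have "\<Union>\<C> \<subseteq> B" "1 \<notin> \<Union>\<C>" using sub unfolding \<I>_def by auto
    moreover have "C \<subseteq> \<Union>\<C>" using X0 sub unfolding \<I>_def by auto
    ultimately show ?thesis unfolding \<I>_def by simp
  qed
  moreover have "\<I> \<noteq> {}" using C unfolding \<I>_def by blast
  ultimately obtain p where p: "p \<in> \<I>" and max: "\<And>X. X \<in> \<I> \<Longrightarrow> p \<subseteq> X \<Longrightarrow> X = p"
    using subset_Zorn_nonempty[of \<I>] by auto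
  have pm: "is_submodule B p" "p \<subseteq> B" "1 \<notin> p" "C \<subseteq> p" using p unfolding \<I>_def by auto
  have inv: "\<exists>b\<in>B. 1 - b * x \<in> p" if "x \<in> B" "x \<notin> p" for x
  proof (rule ccontr)
    assume no: "\<not> (\<exists>b\<in>B. 1 - b * x \<in> p)"
    let ?X = "{u + b * x | u b. u \<in> p \<and> b \<in> B}"
    have "is_submodule B ?X"
    proof (rule submoduleI)
      show "0 \<in> ?X" using submodule_0[OF pm(1)] subring_0[OF B] by force
    next
      fix y z assume "y \<in> ?X" "z \<in> ?X"
      then obtain u b v c where *: "u \<in> p" "b \<in> B" "v \<in> p" "c \<in> B" "y = u + b * x" "z = v + c * x"
        by blast
      then have "y + z = (u + v) + (b + c) * x" by (simp add: algebra_simps)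
      then show "y + z \<in> ?X" using * submodule_add[OF pm(1)] subring_add[OF B] by blast
    next
      fix a y assume a: "a \<in> B" and "y \<in> ?X"
      then obtain u b where *: "u \<in> p" "b \<in> B" "y = u + b * x" by blast
      then have "a * y = a * u + (a * b) * x" by (simp add: algebra_simps)
      then show "a * y \<in> ?X" using * a submodule_scale[OF pm(1)] subring_mult[OF B] by blast
    qed
    moreover have "?X \<subseteq> B" using pm(2) that(1) by (auto intro!: subring_add[OF B] subring_mult[OF B])
    moreover have "1 \<notin> ?X"
    proof
      assume "1 \<in> ?X"
      then obtain u b where "u \<in> p" "b \<in> B" "1 = u + b * x" by blast
      then have "1 - b * x \<in> p" by (metis add_diff_cancel_right')
      then show False using no \<open>b \<in> B\<close> by blast
    qed
    moreover have px: "p \<subseteq> ?X"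
    proof
      fix u assume "u \<in> p"
      then show "u \<in> ?X" using subring_0[OF B] by force
    qed
    ultimately have "?X = p" using max[of ?X] pm(4) unfolding \<I>_def by blast
    moreover have "x \<in> ?X" using submodule_0[OF pm(1)] subring_1[OF B] by force
    ultimately show False using that by blast
  qed
  have "x \<in> p \<or> y \<in> p" if xy: "x \<in> B" "y \<in> B" "x * y \<in> p" for x y
  proof (rule ccontr)
    assume "\<not> (x \<in> p \<or> y \<in> p)"
    then obtain b where b: "b \<in> B" "1 - b * x \<in> p" using inv xy by blast
    have "y * (1 - b * x) + b * (x * y) \<in> p"
      using submodule_add[OF pm(1) submodule_scale[OF pm(1) xy(2) b(2)] submodule_scale[OF pm(1) b(1) xy(3)]] .
    then have "y \<in> p" by (simp add: algebra_simps)
    then show False using \<open>\<not> (x \<in> p \<or> y \<in> p)\<close> by blast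
  qed
  then have "prime_ideal_in B p" unfolding prime_ideal_in_def using pm by blast
  then show thesis using that pm(4) by blast
qed

text \<open>The b with \<open>b * x \<in> X\<close> form an ideal of B. If it were proper, a prime p
  containing it would give a local ring over which x has a denominator outside p, contrary to the
  choice of p.\<close>

lemma submodule_local_global:
  assumes B: "is_subring B" and X: "is_submodule B X"
    and loc: "\<And>P. P \<in> affine_model B \<Longrightarrow> x \<in> mspan P X"
  shows "x \<in> X"
proof (rule ccontr)
  assume "x \<notin> X"
  let ?C = "{b \<in> B. b * x \<in> X}"
  have "is_submodule B ?C"
    by (rule submoduleI)
      (auto simp: distrib_right mult.assoc intro: subringD[OF B] submoduleD[OF X])
  moreover have "1 \<notin> ?C" using \<open>x \<notin> X\<close> by simp
  ultimately obtain p where p: "prime_ideal_in B p" "?C \<subseteq> p"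
    using maximal_ideal_exists[OF B, of ?C] by blast
  have "\<exists>s\<in>B - p. s * y \<in> X" if "y \<in> mspan (localization B p) X" for y
    using that
  proof (rule hull_induct)
    have one: "1 \<in> B - p" using p(1) B by (simp add: prime_ideal_in_def subringD)
    have S: "s * t \<in> B - p" if "s \<in> B - p" "t \<in> B - p" for s t
      using that p(1) subring_mult[OF B] unfolding prime_ideal_in_def by blast
    show "\<exists>s\<in>B - p. s * y \<in> X" if "y \<in> X" for y using one that by (intro bexI[of _ 1]) auto
    show "is_submodule (localization B p) {y. \<exists>s\<in>B - p. s * y \<in> X}"
    proof (rule submoduleI)
      show "0 \<in> {y. \<exists>s\<in>B - p. s * y \<in> X}" using one submodule_0[OF X] by auto
    next
      fix y z assume "y \<in> {y. \<exists>s\<in>B - p. s * y \<in> X}" "z \<in> {y. \<exists>s\<in>B - p. s * y \<in> X}"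
      then obtain s t where *: "s \<in> B - p" "t \<in> B - p" "s * y \<in> X" "t * z \<in> X" by blast
      then have "(s * t) * (y + z) = t * (s * y) + s * (t * z)" by (simp add: algebra_simps)
      then have "(s * t) * (y + z) \<in> X"
        using * submodule_add[OF X] submodule_scale[OF X] by auto
      then show "y + z \<in> {y. \<exists>s\<in>B - p. s * y \<in> X}" using S[OF *(1,2)] by blast
    next
      fix a y assume "a \<in> localization B p" "y \<in> {y. \<exists>s\<in>B - p. s * y \<in> X}"
      then obtain b t s where *: "b \<in> B" "t \<in> B - p" "a = b / t" "s \<in> B - p" "s * y \<in> X"
        unfolding localization_def by blast
      have "t \<noteq> 0" using *(2) p(1) submodule_0 unfolding prime_ideal_in_def by blast
      then have "(s * t) * (a * y) = b * (s * y)" using * by simp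
      then have "(s * t) * (a * y) \<in> X" using * submodule_scale[OF X] by auto
      then show "a * y \<in> {y. \<exists>s\<in>B - p. s * y \<in> X}" using S[OF *(4,2)] by blast
    qed
  qed
  moreover have "x \<in> mspan (localization B p) X"
    using p(1) by (intro loc) (auto simp: affine_model_def)
  ultimately show False using p(2) by blast
qed

section \<open>Locally principal submodules and blowing up\<close>

text \<open>X becomes invertible at Q with generator f; by \<open>gen_by_obtain\<close> the
  generator can be moved into X when Q is local.\<close>

definition gen_by :: "'a::field set \<Rightarrow> 'a set \<Rightarrow> 'a \<Rightarrow> bool" where
  "gen_by Q X f \<longleftrightarrow> f \<noteq> 0 \<and> mspan Q X = mspan Q {f}"

lemma gen_by_nonzero: "gen_by Q X f \<Longrightarrow> f \<noteq> 0"
  by (simp add: gen_by_def)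

lemma gen_by_divide: "is_subring Q \<Longrightarrow> gen_by Q X f \<Longrightarrow> x \<in> mspan Q X \<Longrightarrow> x / f \<in> Q"
  by (auto simp: gen_by_def mspan_single)

lemma gen_by_divide': "is_subring Q \<Longrightarrow> gen_by Q X f \<Longrightarrow> x \<in> X \<Longrightarrow> x / f \<in> Q"
  by (rule gen_by_divide) (auto intro: hull_inc)

lemma gen_byI:
  assumes Q: "is_subring Q" and f: "f \<noteq> 0" "f \<in> mspan Q X" and X: "\<And>x. x \<in> X \<Longrightarrow> x / f \<in> Q"
  shows "gen_by Q X f"
proof -
  have "x \<in> (*) f ` Q" if "x \<in> X" for x
    using X[OF that] f(1) by (intro image_eqI[of _ _ "x / f"]) auto
  then have "mspan Q X \<subseteq> mspan Q {f}"
    using submodule_scale_image[OF submodule_subring[OF Q], of f]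
    unfolding mspan_single[OF Q] by (intro mspan_least) auto
  moreover have "mspan Q {f} \<subseteq> mspan Q X" using f(2) by (intro mspan_least) auto
  ultimately show ?thesis using f(1) by (simp add: gen_by_def)
qed

lemma gen_by_mspan [simp]: "A \<subseteq> Q \<Longrightarrow> gen_by Q (mspan A X) f \<longleftrightarrow> gen_by Q X f"
  by (simp add: gen_by_def mspan_mspan)

text \<open>Nakayama in its simplest case: if \<open>g / f\<close> were a nonunit for every g in X,
  then f would lie in f times the maximal ideal of Q.\<close>

lemma gen_by_obtain:
  assumes Q: "is_local_subring Q" and f: "gen_by Q X f"
  obtains g where "g \<in> X" "gen_by Q X g"
proof -
  have QR: "is_subring Q" using Q by (rule local_subring)
  have f0: "f \<noteq> 0" using f by (rule gen_by_nonzero)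
  have "\<exists>g\<in>X. g / f \<notin> nonunits Q"
  proof (rule ccontr)
    assume no: "\<not> (\<exists>g\<in>X. g / f \<notin> nonunits Q)"
    have "X \<subseteq> (*) f ` nonunits Q"
    proof
      fix x assume "x \<in> X"
      then have "x / f \<in> nonunits Q" "x = f * (x / f)" using no f0 by auto
      then show "x \<in> (*) f ` nonunits Q" by blast
    qed
    then have "mspan Q X \<subseteq> (*) f ` nonunits Q"
      by (intro mspan_least submodule_scale_image submodule_nonunits Q)
    moreover have "f \<in> mspan Q X" using f by (auto simp: gen_by_def intro: hull_inc)
    ultimately have "1 \<in> nonunits Q" using f0 by auto
    then show False using QR by (simp add: nonunits_def subringD)
  qed
  then obtain g where g: "g \<in> X" "g / f \<notin> nonunits Q" by blast
  have "g / f \<in> Q" using gen_by_divide'[OF QR f g(1)] .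
  then have g0: "g \<noteq> 0" "f / g \<in> Q" using g(2) by (auto simp: nonunits_def)
  have "x / g \<in> Q" if "x \<in> X" for x
    using subring_mult[OF QR gen_by_divide'[OF QR f that] g0(2)] f0 by simp
  then have "gen_by Q X g" using g g0 by (intro gen_byI QR) (auto intro: hull_inc)
  then show thesis using that g(1) by blast
qed

lemma gen_by_smul:
  assumes Q: "is_subring Q" "A \<subseteq> Q" and "gen_by Q X f" "gen_by Q Y g"
  shows "gen_by Q (smul A X Y) (f * g)"
proof -
  have "mspan Q (smul A X Y) = smul Q {f} {g}"
    using assms by (simp add: mspan_smul gen_by_def del: smul_mspan_left smul_mspan_right) simp
  then show ?thesis
    using assms by (simp add: gen_by_def smul_def)
qed

lemma gen_by_ring: "is_subring Q \<Longrightarrow> A \<subseteq> Q \<Longrightarrow> 1 \<in> A \<Longrightarrow> gen_by Q A 1"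
  by (intro gen_byI) (auto intro: hull_inc)

lemma gen_by_spow:
  assumes Q: "is_subring Q" "A \<subseteq> Q" "1 \<in> A" and "gen_by Q X f"
  shows "gen_by Q (spow A X n) (f ^ n)"
proof (induction n)
  case (Suc n)
  then show ?case
    using gen_by_smul[OF Q(1,2) Suc assms(4)] by (simp add: mult.commute)
qed (use gen_by_ring Q in auto)

text \<open>Over a local ring the generator of the product can be chosen as x y with x in X and y in
  Y; dividing x' y and x y' by it shows that x and y divide all of X and Y.\<close>

lemma gen_by_smul_factor:
  assumes Q: "is_local_subring Q" "A \<subseteq> Q" and f: "gen_by Q (smul A X Y) f"
  obtains x y where "x \<in> X" "y \<in> Y" "gen_by Q X x" "gen_by Q Y y"
proof -
  have QR: "is_subring Q" using Q by (simp add: local_subring)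
  have "gen_by Q {x * y | x y. x \<in> X \<and> y \<in> Y} f"
    using f unfolding smul_def by (simp add: Q(2))
  then obtain x y where xy: "x \<in> X" "y \<in> Y" and g: "gen_by Q {x * y | x y. x \<in> X \<and> y \<in> Y} (x * y)"
    using gen_by_obtain[OF Q(1)] by (smt (verit) mem_Collect_eq)
  have nz: "x \<noteq> 0" "y \<noteq> 0" using gen_by_nonzero[OF g] by auto
  have "x' / x \<in> Q" if "x' \<in> X" for x'
    using gen_by_divide'[OF QR g, of "x' * y"] that xy nz by auto
  moreover have "y' / y \<in> Q" if "y' \<in> Y" for y'
    using gen_by_divide'[OF QR g, of "x * y'"] that xy nz by auto
  ultimately show thesis
    using that[OF xy] xy nz by (simp add: gen_byI[OF QR] hull_inc)
qed

lemma gen_by_spow_factor: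
  assumes Q: "is_local_subring Q" "A \<subseteq> Q" and f: "gen_by Q (spow A X (Suc n)) f"
  obtains x where "x \<in> X" "gen_by Q X x"
  using gen_by_smul_factor[OF Q f[unfolded spow.simps]] by blast

section \<open>Charts and local rings of a blowup\<close>

definition chart :: "'a::field set \<Rightarrow> 'a set \<Rightarrow> 'a \<Rightarrow> 'a set" where
  "chart A J f = is_subring hull (A \<union> {g / f | g. g \<in> J})"

lemma subring_chart [simp]: "is_subring (chart A J f)"
  by (simp add: chart_def)

lemma ring_subset_chart: "A \<subseteq> chart A J f"
  unfolding chart_def by (auto intro: hull_inc)

lemma divide_in_chart: "g \<in> J \<Longrightarrow> g / f \<in> chart A J f"
  unfolding chart_def by (rule hull_inc) auto

lemma spow_divide_in_chart:
  assumes A: "is_subring A" and "x \<in> spow A J n"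
  shows "x / f ^ n \<in> chart A J f"
  using assms(2)
proof (induction n arbitrary: x)
  case 0
  then show ?case using ring_subset_chart by auto
next
  case (Suc n)
  let ?B = "chart A J f"
  have "is_submodule A ?B"
    by (rule submodule_restrict[OF submodule_subring ring_subset_chart]) simp
  then have sub: "is_submodule A {u. \<forall>y\<in>{inverse (f ^ Suc n)}. u * y \<in> ?B}"
    by (rule submodule_transporter)
  have "smul A (spow A J n) J \<subseteq> {u. \<forall>y\<in>{inverse (f ^ Suc n)}. u * y \<in> ?B}"
  proof (rule smul_least[OF sub])
    fix x y assume "x \<in> spow A J n" "y \<in> J"
    then have "(x / f ^ n) * (y / f) \<in> ?B"
      by (intro subring_mult[OF subring_chart] Suc.IH divide_in_chart)
    then show "x * y \<in> {u. \<forall>y\<in>{inverse (f ^ Suc n)}. u * y \<in> ?B}"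
      by (simp add: divide_inverse mult_ac)
  qed
  then show ?case using Suc.prems by (auto simp: divide_inverse)
qed

text \<open>Replacing \<open>g / f\<close> by g uses up one factor f and brings in one factor from
  J, so the set M of the y in question is stable under the generators of the chart. Recording the
  factors J^n on the right is what later produces the powers of J_n.\<close>

lemma chart_smul_bound:
  assumes A: "is_subring A" and f: "f \<in> J" "f \<noteq> 0" and X: "is_submodule A X"
    and "y \<in> mspan (chart A J f) X"
  shows "\<exists>n. y * f ^ n \<in> smul A (spow A J n) X"
proof -
  define M where "M = {y. \<exists>n. y * f ^ n \<in> smul A (spow A J n) X}"
  have up: "y * f ^ (n + m) \<in> smul A (spow A J (n + m)) X"
    if "y * f ^ n \<in> smul A (spow A J n) X" for y n m
    using smulI[OF that power_in_spow[OF A f(1), of m], of A]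
    by (simp add: power_add spow_add[OF A] smul_ac mult_ac)
  have Madd: "y + z \<in> M" if yz: "y \<in> M" "z \<in> M" for y z
  proof -
    obtain n m where "y * f ^ n \<in> smul A (spow A J n) X" "z * f ^ m \<in> smul A (spow A J m) X"
      using yz unfolding M_def by blast
    from up[OF this(1), of m] up[OF this(2), of n]
    have "(y + z) * f ^ (n + m) \<in> smul A (spow A J (n + m)) X"
      unfolding distrib_right by (intro submodule_add[OF submodule_smul]) (simp_all add: add.commute)
    then show ?thesis unfolding M_def by blast
  qed
  have XM: "X \<subseteq> M"
    unfolding M_def using X by (auto intro!: exI[of _ 0] simp: smul_unit_left subringD[OF A])
  have AM: "a * y \<in> M" if "a \<in> A" "y \<in> M" for a y
    using that submodule_scale[OF submodule_smul that(1)] unfolding M_def by (auto simp: mult.assoc)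
  have JM: "g / f * y \<in> M" if "g \<in> J" "y \<in> M" for g y
  proof -
    from \<open>y \<in> M\<close> obtain n where n: "y * f ^ n \<in> smul A (spow A J n) X" unfolding M_def by blast
    have "g / f * y * f ^ Suc n = g * (y * f ^ n)" using f(2) by simp
    moreover have "\<dots> \<in> smul A (spow A J (Suc n)) X"
      using smulI[OF that(1) n, of A] by (simp add: smul_ac)
    ultimately show ?thesis unfolding M_def by (metis (mono_tags, lifting) mem_Collect_eq)
  qed
  have zero: "0 \<in> M" using XM submodule_0[OF X] by blast
  \<comment> \<open>The multipliers of M form a ring, so it is enough that A and the
    \<open>g / f\<close> belong to it.\<close>
  define B' where "B' = {b. \<forall>y\<in>M. b * y \<in> M}"
  have neg: "- y \<in> M" if "y \<in> M" for y
    using AM[of "- 1" y] that subringD[OF A] by simp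
  have "is_subring B'"
    unfolding is_subring_def B'_def
  proof (intro conjI ballI, goal_cases)
    case (2 b c)
    have "b * y + - (c * y) \<in> M" if "y \<in> M" for y using 2 that Madd neg by blast
    then show ?case by (simp add: left_diff_distrib)
  qed (auto simp: mult.assoc)
  moreover have "A \<union> {g / f | g. g \<in> J} \<subseteq> B'" using AM JM unfolding B'_def by blast
  ultimately have "chart A J f \<subseteq> B'" unfolding chart_def by (rule subring_hull_least)
  then have "is_submodule (chart A J f) M"
    using zero Madd unfolding B'_def by (intro submoduleI) auto
  then have "mspan (chart A J f) X \<subseteq> M" using XM by (rule mspan_least)
  then show ?thesis using assms(5) unfolding M_def by blast
qed

lemma chart_bound:
  assumes A: "is_subring A" and f: "f \<in> J" "f \<noteq> 0" and "y \<in> chart A J f"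
  shows "\<exists>n. y * f ^ n \<in> spow A J n"
proof -
  have "y \<in> mspan (chart A J f) A"
    using submodule_scale[OF submodule_mspan assms(4) hull_inc[OF subring_1[OF A]]] by simp
  then show ?thesis
    using chart_smul_bound[OF A f submodule_subring[OF A]]
    by (simp add: smul_unit_right subringD[OF A] A)
qed

text \<open>
  \<open>Q\<close> is one of the local rings of the blowup of \<open>Spec A\<close> along \<open>J\<close>, stated without reference to
  charts.
\<close>
definition blow :: "'a::field set \<Rightarrow> 'a set \<Rightarrow> 'a set \<Rightarrow> bool" where
  "blow A J Q \<longleftrightarrow> is_local_subring Q \<and> A \<subseteq> Q \<and> (\<exists>f\<in>J. gen_by Q J f) \<and>
     (\<forall>x\<in>Q. \<exists>N. \<exists>a\<in>spow A J N. \<exists>s\<in>spow A J N. gen_by Q (spow A J N) s \<and> x = a / s)"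

text \<open>Fractions over the chart correspond to homogeneous fractions: powers of f bring
  numerator and denominator into a common degree N, and division by \<open>f ^ N\<close> goes back,
  where \<open>f ^ N / s\<close> lies in Q because s generates \<open>spow A J N\<close>
  there.\<close>

lemma affine_model_chart_iff:
  assumes A: "is_subring A" and f: "f \<in> J" "f \<noteq> 0"
  shows "Q \<in> affine_model (chart A J f) \<longleftrightarrow> blow A J Q \<and> gen_by Q J f"
proof
  assume "Q \<in> affine_model (chart A J f)"
  then have Q: "is_local_subring Q" "chart A J f \<subseteq> Q"
    and frac: "\<And>x. x \<in> Q \<Longrightarrow> \<exists>a\<in>chart A J f. \<exists>s\<in>chart A J f. s \<noteq> 0 \<and> inverse s \<in> Q \<and> x = a / s"
    using affine_model_iff[OF subring_chart, of Q] by blast+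
  have QR: "is_subring Q" using Q by (simp add: local_subring)
  have AQ: "A \<subseteq> Q" using Q ring_subset_chart by blast
  have gf: "gen_by Q J f"
    using f Q(2) divide_in_chart[of _ J f A] by (intro gen_byI[OF QR]) (auto intro: hull_inc)
  have gfn: "gen_by Q (spow A J n) (f ^ n)" for n
    by (rule gen_by_spow[OF QR AQ subring_1[OF A] gf])
  have "\<exists>N. \<exists>a\<in>spow A J N. \<exists>s\<in>spow A J N. gen_by Q (spow A J N) s \<and> x = a / s" if "x \<in> Q" for x
  proof -
    obtain a s where as: "a \<in> chart A J f" "s \<in> chart A J f" "s \<noteq> 0" "inverse s \<in> Q" "x = a / s"
      using frac[OF \<open>x \<in> Q\<close>] by blast
    obtain m n where mn: "a * f ^ m \<in> spow A J m" "s * f ^ n \<in> spow A J n"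
      using chart_bound[OF A f as(1)] chart_bound[OF A f as(2)] by blast
    let ?N = "m + n"
    have "(a * f ^ m) * f ^ n \<in> spow A J ?N" "f ^ m * (s * f ^ n) \<in> spow A J ?N"
      using mn power_in_spow[OF A f(1)] by (auto intro: spow_in_add[OF A])
    then have mem: "a * f ^ ?N \<in> spow A J ?N" "s * f ^ ?N \<in> spow A J ?N"
      by (simp_all add: power_add mult_ac)
    have "gen_by Q (spow A J ?N) (s * f ^ ?N)"
    proof (rule gen_byI[OF QR])
      show "s * f ^ ?N \<noteq> 0" using as f by simp
      show "s * f ^ ?N \<in> mspan Q (spow A J ?N)" using mem by (simp add: hull_inc)
      fix y assume "y \<in> spow A J ?N"
      then have "y / f ^ ?N \<in> Q" by (rule gen_by_divide'[OF QR gfn])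
      then have "inverse s * (y / f ^ ?N) \<in> Q" using as(4) by (intro subring_mult[OF QR])
      then show "y / (s * f ^ ?N) \<in> Q" by (simp add: field_simps)
    qed
    moreover have "x = (a * f ^ ?N) / (s * f ^ ?N)" using as f by simp
    ultimately show ?thesis using mem by blast
  qed
  then show "blow A J Q \<and> gen_by Q J f" unfolding blow_def using Q AQ gf f by blast
next
  assume *: "blow A J Q \<and> gen_by Q J f"
  then have Q: "is_local_subring Q" "A \<subseteq> Q" and gf: "gen_by Q J f"
    and frac: "\<And>x. x \<in> Q \<Longrightarrow> \<exists>N. \<exists>a\<in>spow A J N. \<exists>s\<in>spow A J N. gen_by Q (spow A J N) s \<and> x = a / s"
    unfolding blow_def by blast+
  have QR: "is_subring Q" using Q by (simp add: local_subring)
  have "chart A J f \<subseteq> Q"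
    unfolding chart_def using Q(2) gen_by_divide'[OF QR gf] by (intro subring_hull_least QR) auto
  moreover have "\<exists>a\<in>chart A J f. \<exists>s\<in>chart A J f. s \<noteq> 0 \<and> inverse s \<in> Q \<and> x = a / s" if "x \<in> Q" for x
  proof -
    obtain N a s where as: "a \<in> spow A J N" "s \<in> spow A J N" "gen_by Q (spow A J N) s" "x = a / s"
      using frac[OF \<open>x \<in> Q\<close>] by blast
    have s: "s \<noteq> 0" using as(3) by (rule gen_by_nonzero)
    have "f ^ N / s \<in> Q" using gen_by_divide'[OF QR as(3) power_in_spow[OF A f(1)]] .
    moreover have "x = (a / f ^ N) / (s / f ^ N)" "inverse (s / f ^ N) = f ^ N / s"
      using as(4) f(2) s by simp_all
    moreover have "s / f ^ N \<noteq> 0" using s f(2) by simp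
    ultimately show ?thesis using spow_divide_in_chart[OF A as(1)] spow_divide_in_chart[OF A as(2)] by metis
  qed
  ultimately show "Q \<in> affine_model (chart A J f)"
    using affine_model_iff[OF subring_chart] Q(1) by blast
qed

lemma blow_iff_chart:
  assumes A: "is_subring A"
  shows "blow A J Q \<longleftrightarrow> (\<exists>f\<in>J - {0}. Q \<in> affine_model (chart A J f))"
proof
  assume b: "blow A J Q"
  then obtain f where "f \<in> J" "gen_by Q J f" unfolding blow_def by blast
  then show "\<exists>f\<in>J - {0}. Q \<in> affine_model (chart A J f)"
    using affine_model_chart_iff[OF A, of f J Q] b gen_by_nonzero by blast
qed (use affine_model_chart_iff[OF A] in blast)

lemma blowD:
  assumes "blow A J Q"
  shows blow_local: "is_local_subring Q" and blow_subring: "is_subring Q" and blow_subset: "A \<subseteq> Q"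
  using assms unfolding blow_def by (auto simp: local_subring)

lemma blow_obtain:
  assumes "blow A J Q" obtains f where "f \<in> J" "gen_by Q J f"
  using assms unfolding blow_def by blast

lemma blow_fraction:
  assumes "blow A J Q" "x \<in> Q"
  obtains N a s where "a \<in> spow A J N" "s \<in> spow A J N" "gen_by Q (spow A J N) s" "x = a / s"
  using assms unfolding blow_def by blast

text \<open>An ideal X that is already principal at Q contributes nothing new: multiplying numerator
  and denominator by \<open>y ^ N\<close> turns fractions of degree N for M into such fractions for
  M X.\<close>

lemma blow_smul:
  assumes A: "is_subring A" and b: "blow A M Q" and y: "y \<in> X" "gen_by Q X y"
  shows "blow A (smul A M X) Q"
  unfolding blow_def
proof (intro conjI ballI)
  show "is_local_subring Q" "A \<subseteq> Q" by (rule blowD[OF b])+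
  have QR: "is_subring Q" by (rule blow_subring[OF b])
  note AQ = blow_subset[OF b]
  obtain f where f: "f \<in> M" "gen_by Q M f" using b by (rule blow_obtain)
  show "\<exists>f\<in>smul A M X. gen_by Q (smul A M X) f"
    using gen_by_smul[OF QR AQ f(2) y(2)] smulI[OF f(1) y(1)] by blast
  fix x assume "x \<in> Q"
  then obtain N a s where as: "a \<in> spow A M N" "s \<in> spow A M N" "gen_by Q (spow A M N) s" "x = a / s"
    using b by (elim blow_fraction)
  have yN: "y ^ N \<in> spow A X N" "gen_by Q (spow A X N) (y ^ N)"
    using power_in_spow[OF A y(1)] gen_by_spow[OF QR AQ subring_1[OF A] y(2)] by blast+
  have "a * y ^ N \<in> spow A (smul A M X) N" "s * y ^ N \<in> spow A (smul A M X) N"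
    using as yN by (simp_all add: spow_smul[OF A] smulI)
  moreover have "gen_by Q (spow A (smul A M X) N) (s * y ^ N)"
    unfolding spow_smul[OF A] by (rule gen_by_smul[OF QR AQ as(3) yN(2)])
  moreover have "x = (a * y ^ N) / (s * y ^ N)" using as(4) gen_by_nonzero[OF yN(2)] by simp
  ultimately show "\<exists>N. \<exists>a\<in>spow A (smul A M X) N. \<exists>s\<in>spow A (smul A M X) N.
      gen_by Q (spow A (smul A M X) N) s \<and> x = a / s" by blast
qed

text \<open>For the power of M only degrees divisible by e are available; a fraction of degree N is
  moved to degree e N by multiplying both of its parts by a power of the generator f.\<close>

lemma blow_spow_iff:
  assumes A: "is_subring A" and e: "0 < e"
  shows "blow A (spow A M e) Q \<longleftrightarrow> blow A M Q"
proof
  assume b: "blow A (spow A M e) Q"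
  note AQ = blow_subset[OF b] and QL = blow_local[OF b]
  show "blow A M Q"
    unfolding blow_def
  proof (intro conjI ballI QL AQ)
    obtain f where "gen_by Q (spow A M e) f" using b by (rule blow_obtain)
    then show "\<exists>f\<in>M. gen_by Q M f"
      using gen_by_spow_factor[OF QL AQ, of M "e - 1" f] e by auto
    fix x assume "x \<in> Q"
    with b show "\<exists>N. \<exists>a\<in>spow A M N. \<exists>s\<in>spow A M N. gen_by Q (spow A M N) s \<and> x = a / s"
      by (rule blow_fraction) (auto simp: spow_mult[OF A])
  qed
next
  assume b: "blow A M Q"
  note AQ = blow_subset[OF b] and QL = blow_local[OF b] and QR = blow_subring[OF b]
  obtain f where f: "f \<in> M" "gen_by Q M f" using b by (rule blow_obtain)
  have fn: "f ^ n \<in> spow A M n" "gen_by Q (spow A M n) (f ^ n)" for n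
    using power_in_spow[OF A f(1)] gen_by_spow[OF QR AQ subring_1[OF A] f(2)] by blast+
  show "blow A (spow A M e) Q"
    unfolding blow_def
  proof (intro conjI ballI QL AQ)
    show "\<exists>f\<in>spow A M e. gen_by Q (spow A M e) f" using fn by blast
    fix x assume "x \<in> Q"
    with b obtain N a s where as: "a \<in> spow A M N" "s \<in> spow A M N" "gen_by Q (spow A M N) s" "x = a / s"
      by (rule blow_fraction)
    obtain d where "e = Suc d" using e by (cases e) auto
    then have d: "e * N = N + d * N" by simp
    have "a * f ^ (d * N) \<in> spow A (spow A M e) N" "s * f ^ (d * N) \<in> spow A (spow A M e) N"
      unfolding spow_mult[OF A] d using as fn by (auto intro: spow_in_add[OF A])
    moreover have "gen_by Q (spow A (spow A M e) N) (s * f ^ (d * N))"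
      unfolding spow_mult[OF A] d spow_add[OF A] by (rule gen_by_smul[OF QR AQ as(3) fn(2)])
    moreover have "x = (a * f ^ (d * N)) / (s * f ^ (d * N))" using as(4) gen_by_nonzero[OF f(2)] by simp
    ultimately show "\<exists>N. \<exists>a\<in>spow A (spow A M e) N. \<exists>s\<in>spow A (spow A M e) N.
        gen_by Q (spow A (spow A M e) N) s \<and> x = a / s" by blast
  qed
qed

section \<open>Determinants of principal parts\<close>

lemma derivationD:
  assumes "derivation k \<delta>"
  shows derivation_add: "\<delta> (x + y) = \<delta> x + \<delta> y"
    and derivation_mult: "\<delta> (x * y) = x * \<delta> y + y * \<delta> x"
    and derivation_zero: "\<delta> 0 = 0" and derivation_one: "\<delta> 1 = 0"
    and derivation_diff: "\<delta> (x - y) = \<delta> x - \<delta> y"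
proof -
  show add: "\<delta> (x + y) = \<delta> x + \<delta> y" for x y
    using assms unfolding derivation_def by blast
  show mult: "\<delta> (x * y) = x * \<delta> y + y * \<delta> x" for x y
    using assms unfolding derivation_def by blast
  show "\<delta> 0 = 0" using mult[of 0 0] by simp
  show "\<delta> 1 = 0" using mult[of 1 1] by (metis add_cancel_right_right mult_1)
  show "\<delta> (x - y) = \<delta> x - \<delta> y" using add[of "x - y" y] by simp
qed

lemma derivation_const:
  assumes "derivation k \<delta>" "c \<in> k"
  shows "\<delta> c = 0"
proof -
  have "\<delta> (c * 1) = c * \<delta> 1" using assms unfolding derivation_def by blast
  then show ?thesis using derivation_one[OF assms(1)] by simp
qed

lemma principal_part_dim [simp]: "dim_vec (principal_part \<delta>s f) = Suc (length \<delta>s)"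
  by (simp add: principal_part_def del: vec_of_list_Cons vec_of_list_map)

lemma principal_part_carrier [simp]: "principal_part \<delta>s f \<in> carrier_vec (Suc (length \<delta>s))"
  by (intro carrier_vecI) simp

lemma principal_part_index:
  "i < Suc (length \<delta>s) \<Longrightarrow> principal_part \<delta>s f $ i = (if i = 0 then f else (\<delta>s ! (i - 1)) f)"
  by (cases i)
     (auto simp: principal_part_def vec_of_list_index simp del: vec_of_list_Cons vec_of_list_map)

abbreviation wronskian :: "('a::field \<Rightarrow> 'a) list \<Rightarrow> 'a list \<Rightarrow> 'a" where
  "wronskian \<delta>s fs \<equiv> det (mat_of_rows (Suc (length \<delta>s)) (map (principal_part \<delta>s) fs))"

text \<open>\<open>F_sheaf\<close> looks at its sheaf only over the given ring, so a constant family
  makes it an operation on single modules, also over charts and local rings that are not affine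
  opens of V.\<close>

abbreviation F_mod :: "('a::field \<Rightarrow> 'a) list \<Rightarrow> 'a set \<Rightarrow> 'a set \<Rightarrow> 'a set" where
  "F_mod \<delta>s A J \<equiv> F_sheaf \<delta>s (\<lambda>_. J) A"

lemma F_sheaf_eq_F_mod: "F_sheaf \<delta>s I A = F_mod \<delta>s A (I A)"
  by (simp add: F_sheaf_determinants)

lemma submodule_F_mod [simp]: "is_submodule A (F_mod \<delta>s A J)"
  by (simp add: F_sheaf_determinants)

lemma F_modI: "length fs = Suc (length \<delta>s) \<Longrightarrow> set fs \<subseteq> J \<Longrightarrow> wronskian \<delta>s fs \<in> F_mod \<delta>s A J"
  unfolding F_sheaf_determinants by (rule hull_inc) blast

lemma F_mod_least:
  assumes "is_submodule A Z"
    and "\<And>fs. length fs = Suc (length \<delta>s) \<Longrightarrow> set fs \<subseteq> J \<Longrightarrow> wronskian \<delta>s fs \<in> Z"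
  shows "F_mod \<delta>s A J \<subseteq> Z"
  unfolding F_sheaf_determinants using assms by (intro mspan_least) auto

lemma F_mod_mono: "A \<subseteq> B \<Longrightarrow> J \<subseteq> J' \<Longrightarrow> F_mod \<delta>s A J \<subseteq> F_mod \<delta>s B J'"
  by (intro F_mod_least submodule_restrict[OF submodule_F_mod, of A B]) (auto intro!: F_modI)

text \<open>Multiplication by \<open>g\<close> is a triangular matrix \<open>C\<close> on principal parts.\<close>
lemma wronskian_scale:
  assumes \<delta>s: "\<forall>\<delta>\<in>set \<delta>s. derivation k \<delta>" and len: "length fs = Suc (length \<delta>s)"
  shows "wronskian \<delta>s (map ((*) g) fs) = g ^ Suc (length \<delta>s) * wronskian \<delta>s fs"
proof -
  let ?n = "Suc (length \<delta>s)"
  define C where "C = mat ?n ?n (\<lambda>(i, j). if i = j then g else if i = 0 then (\<delta>s ! (j - 1)) g else 0)"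
  let ?M = "mat_of_rows ?n (map (principal_part \<delta>s) fs)"
  have M: "?M \<in> carrier_mat ?n ?n" using len by (simp add: mat_of_rows_def)
  have C: "C \<in> carrier_mat ?n ?n" by (simp add: C_def)
  have "mat_of_rows ?n (map (principal_part \<delta>s) (map ((*) g) fs)) = ?M * C"
  proof (rule eq_matI)
    fix i j assume "i < dim_row (?M * C)" "j < dim_col (?M * C)"
    then have i: "i < length fs" and j: "j < ?n" using M C len by auto
    have "(?M * C) $$ (i, j) = (\<Sum>l<?n. principal_part \<delta>s (fs ! i) $ l * C $$ (l, j))"
      using i j len C by (simp add: mat_of_rows_index scalar_prod_def atLeast0LessThan)
    \<comment> \<open>Column j of C has the entry g in row j and, for j > 0, the Leibniz term
      \<delta> g in row 0; the two summands separate these.\<close>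
    also have "\<dots> = (\<Sum>l<?n. (if l = j then g * principal_part \<delta>s (fs ! i) $ l else 0)
        + (if l = 0 then if j = 0 then 0 else fs ! i * (\<delta>s ! (j - 1)) g else 0))"
      using j by (intro sum.cong refl) (auto simp: C_def principal_part_index)
    also have "\<dots> = g * principal_part \<delta>s (fs ! i) $ j
        + (if j = 0 then 0 else fs ! i * (\<delta>s ! (j - 1)) g)"
      unfolding sum.distrib using j by (simp only: sum.delta[OF finite_lessThan]) auto
    also have "\<dots> = principal_part \<delta>s (g * fs ! i) $ j"
      using j derivation_mult[of k "\<delta>s ! (j - 1)" g "fs ! i"] \<delta>s
      by (auto simp: principal_part_index)
    finally show "mat_of_rows ?n (map (principal_part \<delta>s) (map ((*) g) fs)) $$ (i, j) = (?M * C) $$ (i, j)"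
      using i j by (simp add: mat_of_rows_index)
  qed (use M C len in auto)
  moreover have "det C = g ^ ?n"
  proof -
    have "upper_triangular C" by (auto simp: C_def upper_triangular_def)
    then have "det C = prod_list (diag_mat C)" using C by (rule det_upper_triangular)
    also have "diag_mat C = replicate ?n g"
      by (intro nth_equalityI) (auto simp: diag_mat_def C_def simp del: upt_Suc replicate_Suc)
    finally show ?thesis by (simp add: prod_list_replicate)
  qed
  ultimately show ?thesis using det_mult[OF M C] by simp
qed

lemma F_mod_scale:
  assumes \<delta>s: "\<forall>\<delta>\<in>set \<delta>s. derivation k \<delta>"
  shows "F_mod \<delta>s A ((*) g ` J) = (*) (g ^ Suc (length \<delta>s)) ` F_mod \<delta>s A J"
proof -
  let ?D = "\<lambda>J. {wronskian \<delta>s fs | fs. length fs = Suc (length \<delta>s) \<and> set fs \<subseteq> J}"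
  have "?D ((*) g ` J) = (*) (g ^ Suc (length \<delta>s)) ` ?D J"
  proof (intro equalityI subsetI)
    fix x assume "x \<in> ?D ((*) g ` J)"
    then obtain fs where fs: "x = wronskian \<delta>s fs" "length fs = Suc (length \<delta>s)" "set fs \<subseteq> (*) g ` J"
      by blast
    from fs(3) have "fs \<in> map ((*) g) ` lists J"
      unfolding lists_image[symmetric] by (simp add: in_lists_conv_set subset_iff)
    then obtain gs where "fs = map ((*) g) gs" "set gs \<subseteq> J" by (auto simp: in_lists_conv_set)
    then show "x \<in> (*) (g ^ Suc (length \<delta>s)) ` ?D J"
      using fs wronskian_scale[OF \<delta>s, of gs g] by auto
  next
    fix x assume "x \<in> (*) (g ^ Suc (length \<delta>s)) ` ?D J"
    then obtain fs where fs: "length fs = Suc (length \<delta>s)" "set fs \<subseteq> J"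
      and x: "x = g ^ Suc (length \<delta>s) * wronskian \<delta>s fs" by blast
    have "x = wronskian \<delta>s (map ((*) g) fs)" using wronskian_scale[OF \<delta>s fs(1), of g] x by simp
    then show "x \<in> ?D ((*) g ` J)" using fs by (intro CollectI exI[of _ "map ((*) g) fs"]) auto
  qed
  then show ?thesis unfolding F_sheaf_determinants by (simp only: mspan_scale_image)
qed

text \<open>Scaling by g = 0 maps {0} to itself and multiplies F by a positive power of 0.\<close>

lemma F_mod_zero:
  assumes \<delta>s: "\<forall>\<delta>\<in>set \<delta>s. derivation k \<delta>"
  shows "F_mod \<delta>s A {0} = {0}"
  using F_mod_scale[OF assms, where A = A and g = 0 and J = "{0}"]
    submodule_0[OF submodule_F_mod[where A = A and \<delta>s = \<delta>s and J = "{0}"]] by auto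

lemma det_in_subring:
  assumes A: "is_subring A" and M: "M \<in> carrier_mat n n"
    and entries: "\<And>i j. i < n \<Longrightarrow> j < n \<Longrightarrow> M $$ (i, j) \<in> A"
  shows "det M \<in> A"
proof -
  have "signof p \<in> A" for p :: "nat \<Rightarrow> nat"
  proof -
    have "{1, - 1} \<subseteq> A" using subring_1[OF A] subring_uminus[OF A] by simp
    then show ?thesis using signof_pm_one[of p] by (rule subsetD)
  qed
  then show ?thesis
    unfolding det_def'[OF M]
    by (intro subring_sum[OF A] subring_mult[OF A] subring_prod[OF A] entries)
       (auto simp: permutes_def permutes_in_image)
qed

section \<open>Differentials of an affine algebra\<close>

lemma top_wedge_differentials:
  "top_wedge A (length \<delta>s) (foliation_differentials \<delta>s A) = mspan A
     {det (mat_of_rows (length \<delta>s) (map (\<lambda>x. vec_of_list (map (\<lambda>\<delta>. \<delta> x) \<delta>s)) xs)) | xs.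
        length xs = length \<delta>s \<and> set xs \<subseteq> A}"
proof -
  let ?v = "\<lambda>x. vec_of_list (map (\<lambda>\<delta>. \<delta> x) \<delta>s)" and ?n = "length \<delta>s"
  have "{?v x | x. x \<in> A} \<subseteq> carrier_vec ?n"
    by (auto intro!: carrier_vecI simp del: vec_of_list_map)
  then have "top_wedge A ?n (foliation_differentials \<delta>s A) = top_wedge A ?n {?v x | x. x \<in> A}"
    unfolding foliation_differentials_def by (rule top_wedge_hull)
  moreover have "{det (mat_of_rows ?n ws) | ws. length ws = ?n \<and> set ws \<subseteq> {?v x | x. x \<in> A}} =
      {det (mat_of_rows ?n (map ?v xs)) | xs. length xs = ?n \<and> set xs \<subseteq> A}" (is "?D = ?E")
  proof (intro equalityI subsetI)
    fix d assume "d \<in> ?D"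
    then obtain ws where ws: "d = det (mat_of_rows ?n ws)" "length ws = ?n" "set ws \<subseteq> ?v ` A"
      by (auto simp: image_def simp del: vec_of_list_map)
    from ws(3) have "ws \<in> map ?v ` lists A"
      unfolding lists_image[symmetric] by (simp add: in_lists_conv_set subset_iff del: vec_of_list_map)
    then obtain xs where "ws = map ?v xs" "set xs \<subseteq> A" by (auto simp: in_lists_conv_set)
    then show "d \<in> ?E" using ws by (intro CollectI exI[of _ xs]) (simp del: vec_of_list_map)
  next
    fix d assume "d \<in> ?E"
    then obtain xs where "d = det (mat_of_rows ?n (map ?v xs))" "length xs = ?n" "set xs \<subseteq> A" by blast
    then show "d \<in> ?D"
      by (intro CollectI exI[of _ "map ?v xs"]) (auto simp del: vec_of_list_map)
  qed
  ultimately show ?thesis unfolding top_wedge_def by simp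
qed

text \<open>The row of 1 is (1, 0, ..., 0), so inserting 1 as first function turns a minor of
  differentials into a determinant of principal parts. Conversely, expansion along the first column,
  whose entries lie in A, leaves only minors of differentials. This is what lets the Gauss blowup be
  treated as a blowup along F of the structure sheaf.\<close>

lemma F_mod_ring:
  assumes \<delta>s: "\<forall>\<delta>\<in>set \<delta>s. derivation k \<delta>" and A: "is_subring A"
  shows "F_mod \<delta>s A A = top_wedge A (length \<delta>s) (foliation_differentials \<delta>s A)"
proof
  let ?v = "\<lambda>x. vec_of_list (map (\<lambda>\<delta>. \<delta> x) \<delta>s)" and ?n = "length \<delta>s"
  have v: "?v x $ j = (\<delta>s ! j) x" if "j < ?n" for x j
    using that by (simp add: vec_of_list_index del: vec_of_list_map)
  let ?W = "\<lambda>fs. mat_of_rows (Suc ?n) (map (principal_part \<delta>s) fs)"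
  have W: "?W fs \<in> carrier_mat (Suc ?n) (Suc ?n)" if "length fs = Suc ?n" for fs
    using that by (simp add: mat_of_rows_def)
  have minor: "mat_delete (?W fs) i 0 = mat_of_rows ?n (map ?v (take i fs @ drop (Suc i) fs))"
    if "length fs = Suc ?n" "i < Suc ?n" for fs i
    by (rule eq_matI)
       (use that in \<open>auto simp: mat_delete_def mat_of_rows_index principal_part_index v nth_append
          min_def simp del: vec_of_list_map\<close>)
  show "F_mod \<delta>s A A \<subseteq> top_wedge A ?n (foliation_differentials \<delta>s A)"
  proof (rule F_mod_least)
    show T: "is_submodule A (top_wedge A ?n (foliation_differentials \<delta>s A))"
      by (simp add: top_wedge_differentials)
    fix fs assume fs: "length fs = Suc ?n" "set fs \<subseteq> A"
    have "det (mat_delete (?W fs) i 0) \<in> top_wedge A ?n (foliation_differentials \<delta>s A)"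
      if "i < Suc ?n" for i
      unfolding minor[OF fs(1) that] top_wedge_differentials
      by (rule hull_inc, intro CollectI exI[of _ "take i fs @ drop (Suc i) fs"])
         (use fs that in \<open>auto dest: in_set_takeD in_set_dropD\<close>)
    moreover have "?W fs $$ (i, 0) * (- 1) ^ i \<in> A" if "i < Suc ?n" for i
      using fs that nth_mem[of i fs]
      by (auto simp: mat_of_rows_index principal_part_index intro!: subring_mult[OF A]
        subring_power[OF A] subring_uminus[OF A] subring_1[OF A])
    ultimately show "wronskian \<delta>s fs \<in> top_wedge A ?n (foliation_differentials \<delta>s A)"
      unfolding laplace_expansion_column[OF W[OF fs(1)] zero_less_Suc] cofactor_def
      by (intro submodule_sum[OF T]) (auto simp flip: mult.assoc intro!: submodule_scale[OF T])
  qed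
  show "top_wedge A ?n (foliation_differentials \<delta>s A) \<subseteq> F_mod \<delta>s A A"
    unfolding top_wedge_differentials
  proof (rule mspan_least, simp, clarify)
    fix xs assume xs: "length xs = ?n" "set xs \<subseteq> A"
    let ?fs = "1 # xs"
    have "?W ?fs $$ (0, j) = (if j = 0 then 1 else 0)" if "j < Suc ?n" for j
    proof -
      have "?W ?fs $$ (0, j) = (if j = 0 then 1 else (\<delta>s ! (j - 1)) 1)"
        using that by (subst mat_of_rows_index) (auto simp: principal_part_index)
      moreover have "(\<delta>s ! (j - 1)) 1 = 0" if "j \<noteq> 0"
        using \<delta>s \<open>j < Suc ?n\<close> that by (intro derivation_one[of k]) auto
      ultimately show ?thesis by auto
    qed
    moreover have len: "length ?fs = Suc ?n" using xs by simp
    ultimately have "wronskian \<delta>s ?fs = (\<Sum>j<Suc ?n. (if j = 0 then cofactor (?W ?fs) 0 j else 0))"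
      unfolding laplace_expansion_row[OF W[OF len] zero_less_Suc]
      by (intro sum.cong) auto
    also have "\<dots> = cofactor (?W ?fs) 0 0" by (subst sum.delta) auto
    also have "\<dots> = det (mat_of_rows ?n (map ?v xs))"
      unfolding cofactor_def using minor[of ?fs 0] xs by (simp del: vec_of_list_map)
    finally show "det (mat_of_rows ?n (map ?v xs)) \<in> F_mod \<delta>s A A"
      using F_modI[of ?fs \<delta>s A A] xs subring_1[OF A] by (simp del: vec_of_list_map)
  qed
qed

section \<open>Base change\<close>

text \<open>The differential of p sits in the last r coordinates, so that f times it is the element
  f dp of the submodule I\<Omega> of the principal parts.\<close>

definition differential :: "('a::field \<Rightarrow> 'a) list \<Rightarrow> 'a \<Rightarrow> 'a vec" where
  "differential \<delta>s p = vec (Suc (length \<delta>s)) (\<lambda>i. if i = 0 then 0 else (\<delta>s ! (i - 1)) p)"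

context
  fixes k :: "'a::field set" and \<delta>s :: "('a \<Rightarrow> 'a) list"
  assumes \<delta>s: "\<forall>\<delta>\<in>set \<delta>s. derivation k \<delta>"
begin

private lemma nth_derivation:
  "0 < i \<Longrightarrow> i < Suc (length \<delta>s) \<Longrightarrow> derivation k (\<delta>s ! (i - Suc 0))"
  using \<delta>s by auto

lemma principal_part_add: "principal_part \<delta>s (x + y) = principal_part \<delta>s x + principal_part \<delta>s y"
  by (rule eq_vecI) (auto simp: principal_part_index derivation_add[OF nth_derivation])

lemma principal_part_zero: "principal_part \<delta>s 0 = 0\<^sub>v (Suc (length \<delta>s))"
  by (rule eq_vecI) (auto simp: principal_part_index derivation_zero[OF nth_derivation])

lemma principal_part_mult:
  "principal_part \<delta>s (p * f) = p \<cdot>\<^sub>v principal_part \<delta>s f + f \<cdot>\<^sub>v differential \<delta>s p"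
  by (rule eq_vecI)
     (auto simp: principal_part_index differential_def derivation_mult[OF nth_derivation])

lemma differential_one: "differential \<delta>s 1 = 0\<^sub>v (Suc (length \<delta>s))"
  by (rule eq_vecI) (auto simp: differential_def derivation_one[OF nth_derivation])

lemma differential_diff:
  "differential \<delta>s (x - y) = differential \<delta>s x + (- 1) \<cdot>\<^sub>v differential \<delta>s y"
  by (rule eq_vecI) (auto simp: differential_def derivation_diff[OF nth_derivation])

lemma differential_mult:
  "differential \<delta>s (x * y) = x \<cdot>\<^sub>v differential \<delta>s y + y \<cdot>\<^sub>v differential \<delta>s x"
  by (rule eq_vecI) (auto simp: differential_def derivation_mult[OF nth_derivation])

lemma differential_inverse:
  assumes "s \<noteq> 0"
  shows "differential \<delta>s (inverse s) = (- (inverse s * inverse s)) \<cdot>\<^sub>v differential \<delta>s s"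
proof (rule eq_vecI)
  fix i assume "i < dim_vec ((- (inverse s * inverse s)) \<cdot>\<^sub>v differential \<delta>s s)"
  then have i: "i < Suc (length \<delta>s)" by (simp add: differential_def)
  show "differential \<delta>s (inverse s) $ i = ((- (inverse s * inverse s)) \<cdot>\<^sub>v differential \<delta>s s) $ i"
  proof (cases "i = 0")
    case False
    let ?d = "\<delta>s ! (i - 1)"
    have d: "derivation k ?d" using nth_derivation i False by simp
    have "?d (s * inverse s) = 0" using assms derivation_one[OF d] by simp
    then have "s * ?d (inverse s) = - (inverse s * ?d s)"
      unfolding derivation_mult[OF d] by (simp add: eq_neg_iff_add_eq_0)
    then have "inverse s * (s * ?d (inverse s)) = - (inverse s * inverse s * ?d s)"
      by (simp add: mult.assoc)
    then have "?d (inverse s) = - (inverse s * inverse s * ?d s)"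
      using assms by (simp flip: mult.assoc)
    then show ?thesis using i False by (simp add: differential_def)
  qed (use i in \<open>simp add: differential_def\<close>)
qed (simp add: differential_def)

abbreviation vspan :: "'a set \<Rightarrow> 'a set \<Rightarrow> 'a vec set" where
  "vspan P J \<equiv> is_submodule_vec P (Suc (length \<delta>s)) hull (principal_part \<delta>s ` J)"

lemma submodule_vspan: "is_submodule_vec P (Suc (length \<delta>s)) (vspan P J)"
  by (rule is_submodule_vec_hull) auto

lemma vspanD:
  shows vspan_0: "0\<^sub>v (Suc (length \<delta>s)) \<in> vspan P J"
    and vspan_add: "v \<in> vspan P J \<Longrightarrow> w \<in> vspan P J \<Longrightarrow> v + w \<in> vspan P J"
    and vspan_scale: "a \<in> P \<Longrightarrow> v \<in> vspan P J \<Longrightarrow> a \<cdot>\<^sub>v v \<in> vspan P J"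
    and vspan_base: "f \<in> J \<Longrightarrow> principal_part \<delta>s f \<in> vspan P J"
  using submodule_vspan[of P J] unfolding is_submodule_vec_def by (auto intro: hull_inc)

text \<open>Taking principal parts fails to be P-linear exactly by the terms f dp, by
  \<open>principal_part_mult\<close>. The p for which these terms do not enlarge the span form a
  ring, closed under those inverses that exist in P, so only generators of P have to be
  examined.\<close>

definition liftable :: "'a set \<Rightarrow> 'a set \<Rightarrow> 'a set" where
  "liftable P J = {p \<in> P. \<forall>f\<in>J. f \<cdot>\<^sub>v differential \<delta>s p \<in> vspan P J}"

lemma F_mod_base_change:
  assumes P: "is_subring P" "A \<subseteq> P" and liftable: "P \<subseteq> liftable P J"
  shows "F_mod \<delta>s P (mspan P J) = mspan P (F_mod \<delta>s A J)"
proof -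
  let ?n = "Suc (length \<delta>s)" and ?H = "vspan P J"
  \<comment> \<open>The clause on principal parts is the one wanted; the clause on z dp is carried
    along to make the set stable under multiplication by P.\<close>
  let ?Z = "{z \<in> mspan P J. principal_part \<delta>s z \<in> ?H \<and> (\<forall>p\<in>P. z \<cdot>\<^sub>v differential \<delta>s p \<in> ?H)}"
  have "is_submodule P ?Z"
  proof (rule submoduleI)
    have "0 \<cdot>\<^sub>v differential \<delta>s p = 0\<^sub>v ?n" for p by (rule eq_vecI) (auto simp: differential_def)
    then show "0 \<in> ?Z" using submodule_0[OF submodule_mspan] vspan_0 by (simp add: principal_part_zero)
  next
    fix x y assume "x \<in> ?Z" "y \<in> ?Z"
    moreover have "(x + y) \<cdot>\<^sub>v differential \<delta>s p = x \<cdot>\<^sub>v differential \<delta>s p + y \<cdot>\<^sub>v differential \<delta>s p" for p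
      by (rule add_smult_distrib_vec)
    ultimately show "x + y \<in> ?Z"
      by (auto simp: principal_part_add intro: submodule_add[OF submodule_mspan] vspan_add)
  next
    fix a z assume "a \<in> P" "z \<in> ?Z"
    moreover have "(a * z) \<cdot>\<^sub>v differential \<delta>s p = a \<cdot>\<^sub>v (z \<cdot>\<^sub>v differential \<delta>s p)" for p
      by (simp add: smult_smult_assoc)
    ultimately show "a * z \<in> ?Z"
      by (auto simp: principal_part_mult intro: submodule_scale[OF submodule_mspan] vspan_add vspan_scale)
  qed
  moreover have "J \<subseteq> ?Z" using liftable by (auto simp: liftable_def vspan_base intro: hull_inc)
  ultimately have "mspan P J \<subseteq> ?Z" by (rule mspan_least)
  then have "principal_part \<delta>s ` mspan P J \<subseteq> ?H" by blast
  then have "vspan P (mspan P J) \<subseteq> ?H" using submodule_vspan by (rule hull_minimal)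
  moreover have "?H \<subseteq> vspan P (mspan P J)" by (intro hull_mono image_mono hull_subset)
  ultimately have "vspan P (mspan P J) = ?H" by (rule equalityI)
  then have "F_mod \<delta>s P (mspan P J) = F_mod \<delta>s P J"
    unfolding F_sheaf_def principal_parts_def by (simp only:)
  also have "\<dots> = mspan P (F_mod \<delta>s A J)"
    unfolding F_sheaf_determinants by (simp only: mspan_mspan[OF P(2)])
  finally show ?thesis .
qed

lemma liftable_subring:
  assumes P: "is_subring P"
  shows "is_subring (liftable P J)"
  unfolding is_subring_def
proof (intro conjI ballI)
  have "f \<cdot>\<^sub>v 0\<^sub>v (Suc (length \<delta>s)) = 0\<^sub>v (Suc (length \<delta>s))" for f :: 'a by (rule eq_vecI) auto
  then show "1 \<in> liftable P J"
    using P vspan_0 by (simp add: liftable_def differential_one subringD)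
  fix x y assume xy: "x \<in> liftable P J" "y \<in> liftable P J"
  show "x - y \<in> liftable P J"
  proof -
    have "f \<cdot>\<^sub>v differential \<delta>s (x - y) = f \<cdot>\<^sub>v differential \<delta>s x + (- 1) \<cdot>\<^sub>v (f \<cdot>\<^sub>v differential \<delta>s y)" for f
      unfolding differential_diff by (rule eq_vecI) (auto simp: differential_def algebra_simps)
    moreover have "f \<cdot>\<^sub>v differential \<delta>s x + (- 1) \<cdot>\<^sub>v (f \<cdot>\<^sub>v differential \<delta>s y) \<in> vspan P J" if "f \<in> J" for f
      using xy that P by (intro vspan_add[OF _ vspan_scale]) (auto simp: liftable_def subringD)
    ultimately show ?thesis using xy P by (simp add: liftable_def subring_diff)
  qed
  show "x * y \<in> liftable P J"
  proof -
    have "f \<cdot>\<^sub>v differential \<delta>s (x * y) = x \<cdot>\<^sub>v (f \<cdot>\<^sub>v differential \<delta>s y) + y \<cdot>\<^sub>v (f \<cdot>\<^sub>v differential \<delta>s x)" for f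
      unfolding differential_mult by (rule eq_vecI) (auto simp: differential_def algebra_simps)
    moreover have "x \<cdot>\<^sub>v (f \<cdot>\<^sub>v differential \<delta>s y) + y \<cdot>\<^sub>v (f \<cdot>\<^sub>v differential \<delta>s x) \<in> vspan P J"
      if "f \<in> J" for f
      using xy that by (intro vspan_add[OF vspan_scale vspan_scale]) (auto simp: liftable_def)
    ultimately show ?thesis using xy P by (simp add: liftable_def subring_mult)
  qed
qed

lemma liftable_inverse:
  assumes P: "is_subring P" and s: "s \<in> liftable P J" "s \<noteq> 0" "inverse s \<in> P"
  shows "inverse s \<in> liftable P J"
proof -
  have "f \<cdot>\<^sub>v differential \<delta>s (inverse s) = (- (inverse s * inverse s)) \<cdot>\<^sub>v (f \<cdot>\<^sub>v differential \<delta>s s)" for f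
    unfolding differential_inverse[OF s(2)] by (simp add: smult_smult_assoc mult.commute)
  moreover have "(- (inverse s * inverse s)) \<cdot>\<^sub>v (f \<cdot>\<^sub>v differential \<delta>s s) \<in> vspan P J" if "f \<in> J" for f
    using s that P by (intro vspan_scale[of _ P "f \<cdot>\<^sub>v differential \<delta>s s"]) (auto simp: liftable_def subringD)
  ultimately show ?thesis using s(3) by (simp add: liftable_def)
qed

lemma ring_subset_liftable:
  assumes P: "is_subring P" "A \<subseteq> P" and J: "is_submodule A J"
  shows "A \<subseteq> liftable P J"
proof
  fix a assume a: "a \<in> A"
  have "f \<cdot>\<^sub>v differential \<delta>s a \<in> vspan P J" if "f \<in> J" for f
  proof -
    have "f \<cdot>\<^sub>v differential \<delta>s a = principal_part \<delta>s (a * f) + (- a) \<cdot>\<^sub>v principal_part \<delta>s f"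
      unfolding principal_part_mult by (rule eq_vecI) (auto simp: differential_def)
    moreover have "a * f \<in> J" by (rule submodule_scale[OF J a that])
    ultimately show ?thesis
      using a that P by (auto simp: subringD intro!: vspan_add vspan_scale vspan_base)
  qed
  then show "a \<in> liftable P J" using a P(2) by (auto simp: liftable_def)
qed

text \<open>Differentiating h = (h / x) x expresses x d(h / x) by the principal parts of h and x;
  multiplication by \<open>f / x\<close>, a member of P, gives f d(h / x). The new functions on the
  chart do not enlarge the span precisely because x divides all of J there.\<close>

lemma divide_liftable:
  assumes P: "is_subring P" and x: "x \<in> J" "x \<noteq> 0" and J: "\<And>f. f \<in> J \<Longrightarrow> f / x \<in> P" and h: "h \<in> J"
  shows "h / x \<in> liftable P J"
proof -
  have "f \<cdot>\<^sub>v differential \<delta>s (h / x) \<in> vspan P J" if f: "f \<in> J" for f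
  proof -
    have "principal_part \<delta>s h = (h / x) \<cdot>\<^sub>v principal_part \<delta>s x + x \<cdot>\<^sub>v differential \<delta>s (h / x)"
      using principal_part_mult[of "h / x" x] x by simp
    then have "f \<cdot>\<^sub>v differential \<delta>s (h / x) =
        (f / x) \<cdot>\<^sub>v (principal_part \<delta>s h + (- (h / x)) \<cdot>\<^sub>v principal_part \<delta>s x)"
      using x by (intro eq_vecI) (auto simp: differential_def)
    then show ?thesis
      using P J[OF h] J[OF f] h x(1)
      by (auto simp: subring_uminus intro!: vspan_add vspan_scale vspan_base)
  qed
  then show ?thesis using J h by (auto simp: liftable_def)
qed

lemma F_mod_affine_model:
  assumes A: "is_subring A" and P: "P \<in> affine_model A" and J: "is_submodule A J"
  shows "F_mod \<delta>s P (mspan P J) = mspan P (F_mod \<delta>s A J)"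
proof -
  have PR: "is_subring P" and AP: "A \<subseteq> P"
    and frac: "\<And>x. x \<in> P \<Longrightarrow> \<exists>a\<in>A. \<exists>s\<in>A. s \<noteq> 0 \<and> inverse s \<in> P \<and> x = a / s"
    using P affine_model_iff[OF A] local_subring by blast+
  have "P \<subseteq> liftable P J"
  proof
    fix x assume "x \<in> P"
    then obtain a s where "a \<in> A" "s \<in> A" "s \<noteq> 0" "inverse s \<in> P" "x = a * inverse s"
      using frac[of x] by (auto simp: divide_inverse)
    then show "x \<in> liftable P J"
      using ring_subset_liftable[OF PR AP J] liftable_inverse[OF PR] subring_mult[OF liftable_subring[OF PR]]
      by blast
  qed
  then show ?thesis by (rule F_mod_base_change[OF PR AP])
qed

lemma F_mod_chart:
  assumes A: "is_subring A" and J: "is_submodule A J" and x: "x \<in> J" "x \<noteq> 0"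
  shows "F_mod \<delta>s (chart A J x) (mspan (chart A J x) J) = mspan (chart A J x) (F_mod \<delta>s A J)"
proof (rule F_mod_base_change[OF subring_chart ring_subset_chart])
  let ?B = "chart A J x"
  have "A \<union> {g / x | g. g \<in> J} \<subseteq> liftable ?B J"
    using ring_subset_liftable[OF subring_chart ring_subset_chart J, of J x]
      divide_liftable[OF subring_chart x divide_in_chart] by blast
  then show "?B \<subseteq> liftable ?B J"
    unfolding chart_def[of A J x] by (intro subring_hull_least liftable_subring) auto
qed

lemma F_mod_blow:
  assumes A: "is_subring A" and J: "is_submodule A J" and Q: "blow A J Q"
  shows "F_mod \<delta>s Q (mspan Q J) = mspan Q (F_mod \<delta>s A J)"
proof -
  obtain x where x: "x \<in> J" "x \<noteq> 0" "Q \<in> affine_model (chart A J x)"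
    using Q blow_iff_chart[OF A] by auto
  have BQ: "chart A J x \<subseteq> Q" using x(3) affine_model_iff[OF subring_chart] by blast
  have "F_mod \<delta>s Q (mspan Q (mspan (chart A J x) J)) =
      mspan Q (F_mod \<delta>s (chart A J x) (mspan (chart A J x) J))"
    by (rule F_mod_affine_model[OF subring_chart x(3)]) simp
  then show ?thesis unfolding F_mod_chart[OF A J x(1,2)] by (simp add: mspan_mspan BQ)
qed

end

section \<open>Polarization\<close>

text \<open>Elimination as for a Vandermonde system: subtracting \<open>2 ^ Suc d\<close> times the
  value at t from the value at 2 t removes the top coefficient and multiplies \<open>c i\<close> by
  \<open>2 ^ i - 2 ^ Suc d\<close>, which is invertible in k in characteristic zero.\<close>

lemma coefficients_in_subspace:
  fixes U :: "'a::field_char_0 set"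
  assumes k: "is_subfield k" and U: "is_submodule k U"
    and "\<And>t::nat. (\<Sum>i\<le>d. of_nat t ^ i * c i) \<in> U"
  shows "\<forall>i\<le>d. c i \<in> U"
  using assms(3)
proof (induction d arbitrary: c)
  case 0
  then show ?case using 0[of 0] by simp
next
  case (Suc d)
  have kR: "is_subring k" using k by (simp add: is_subfield_def)
  have nat: "of_nat n \<in> k" for n by (induction n) (auto simp: subringD[OF kR])
  let ?b = "\<lambda>i. 2 ^ i - 2 ^ Suc d :: 'a"
  have "(\<Sum>i\<le>d. of_nat t ^ i * (?b i * c i)) \<in> U" for t
  proof -
    have "(\<Sum>i\<le>d. of_nat t ^ i * (?b i * c i)) = (\<Sum>i\<le>Suc d. of_nat t ^ i * (?b i * c i))" by simp
    also have "\<dots> = (\<Sum>i\<le>Suc d. of_nat (2 * t) ^ i * c i) - of_nat (2 ^ Suc d) * (\<Sum>i\<le>Suc d. of_nat t ^ i * c i)"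
      unfolding sum_distrib_left sum_subtractf[symmetric]
      by (intro sum.cong refl) (simp add: algebra_simps power_mult_distrib)
    also have "\<dots> \<in> U"
      by (intro submodule_diff[OF kR U] submodule_scale[OF U nat] Suc.prems)
    finally show ?thesis .
  qed
  then have b: "\<forall>i\<le>d. ?b i * c i \<in> U" by (rule Suc.IH)
  have low: "c i \<in> U" if "i \<le> d" for i
  proof -
    have "(2::nat) ^ i \<noteq> 2 ^ Suc d" using that by (subst power_inject_exp) auto
    then have "of_nat (2 ^ i) \<noteq> (of_nat (2 ^ Suc d) :: 'a)" unfolding of_nat_eq_iff .
    then have nz: "?b i \<noteq> 0" by simp
    have "?b i \<in> k"
      using subring_diff[OF kR nat[of "2 ^ i"] nat[of "2 ^ Suc d"]] by simp
    then have "inverse (?b i) \<in> k" using k unfolding is_subfield_def by blast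
    then have "inverse (?b i) * (?b i * c i) \<in> U"
      by (rule submodule_scale[OF U _ b[rule_format, OF that]])
    moreover have "inverse b * (b * c') = c'" if "b \<noteq> 0" for b c' :: 'a
      using that by (simp flip: mult.assoc)
    ultimately show ?thesis using nz by metis
  qed
  have "(\<Sum>i\<le>Suc d. c i) \<in> U" using Suc.prems[of 1] by simp
  then have "(\<Sum>i\<le>Suc d. c i) - (\<Sum>i\<le>d. c i) \<in> U"
    by (rule submodule_diff[OF kR U _ submodule_sum[OF U]]) (auto simp: low)
  then have "c (Suc d) \<in> U" by simp
  then show ?case using low le_Suc_eq by metis
qed

text \<open>Powers of x are traded for factors y one at a time: the coefficient of t in (t y + x)^e
  is e y x^(e-1), it is isolated by letting t run through the natural numbers, and e is invertible
  in k.\<close>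

lemma polarization:
  fixes U :: "'a::field_char_0 set"
  assumes k: "is_subfield k" and U: "is_submodule k U" and M: "is_submodule k M"
    and pow: "\<And>x. x \<in> M \<Longrightarrow> x ^ n \<in> U"
    and ys: "length ys = n" "set ys \<subseteq> M"
  shows "prod_list ys \<in> U"
proof -
  have kR: "is_subring k" using k by (simp add: is_subfield_def)
  have nat: "of_nat n \<in> k" for n by (induction n) (auto simp: subringD[OF kR])
  have "x ^ (n - length ys) * prod_list ys \<in> U"
    if "length ys \<le> n" "set ys \<subseteq> M" "x \<in> M" for ys x
    using that
  proof (induction ys arbitrary: x)
    case (Cons y ys)
    let ?e = "n - length ys" and ?p = "prod_list ys"
    let ?c = "\<lambda>i. of_nat (?e choose i) * y ^ i * x ^ (?e - i) * ?p"
    have "(\<Sum>i\<le>?e. of_nat t ^ i * ?c i) \<in> U" for t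
    proof -
      have "of_nat t * y + x \<in> M"
        using Cons.prems by (intro submodule_add[OF M] submodule_scale[OF M nat]) auto
      then have "(of_nat t * y + x) ^ ?e * ?p \<in> U" using Cons by auto
      also have "(of_nat t * y + x) ^ ?e * ?p = (\<Sum>i\<le>?e. of_nat t ^ i * ?c i)"
        unfolding binomial_ring sum_distrib_right
        by (intro sum.cong refl) (simp add: power_mult_distrib mult_ac)
      finally show ?thesis .
    qed
    then have "\<forall>i\<le>?e. ?c i \<in> U" by (rule coefficients_in_subspace[OF k U])
    moreover have e1: "1 \<le> ?e" using Cons.prems(1) by simp
    ultimately have "?c 1 \<in> U" by blast
    moreover have "inverse (of_nat ?e) \<in> k" using k nat unfolding is_subfield_def by blast
    ultimately have "inverse (of_nat ?e) * ?c 1 \<in> U" using submodule_scale[OF U] by blast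
    moreover have "inverse (of_nat ?e) * ?c 1 = x ^ (n - length (y # ys)) * prod_list (y # ys)"
    proof -
      have inv: "inverse b * (b * c') = c'" if "b \<noteq> 0" for b c' :: 'a
        using that by (simp flip: mult.assoc)
      have "(of_nat ?e :: 'a) \<noteq> 0" using e1 unfolding of_nat_eq_0_iff by simp
      from inv[OF this, of "y * x ^ (?e - 1) * ?p"]
      have "inverse (of_nat ?e) * (of_nat ?e * (y * x ^ (?e - 1) * ?p)) = y * x ^ (?e - 1) * ?p" .
      then have "inverse (of_nat ?e) * ?c 1 = y * x ^ (?e - 1) * ?p"
        by (simp only: mult.assoc choose_one power_one_right)
      then show ?thesis by (simp add: mult_ac)
    qed
    ultimately show ?case by (simp only:)
  qed (use pow in auto)
  \<comment> \<open>With all n factors in place the exponent of x is 0, so the member x = 0 of M can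
    be used.\<close>
  from this[of ys 0] show ?thesis using ys submodule_0[OF M] by simp
qed

lemma spow_eq_prod_list:
  assumes A: "is_subring A"
  shows "spow A X n = mspan A {prod_list ys | ys. length ys = n \<and> set ys \<subseteq> X}"
proof (induction n)
  case 0
  then show ?case using mspan_one[OF A] by simp
next
  case (Suc n)
  have "{x * y | x y. x \<in> {prod_list ys | ys. length ys = n \<and> set ys \<subseteq> X} \<and> y \<in> X} =
      {prod_list ys | ys. length ys = Suc n \<and> set ys \<subseteq> X}" (is "?L = ?R")
  proof (intro equalityI subsetI)
    fix z assume "z \<in> ?L"
    then obtain ys y where "z = prod_list ys * y" "length ys = n" "set ys \<subseteq> X" "y \<in> X" by blast
    then show "z \<in> ?R" by (intro CollectI exI[of _ "y # ys"]) auto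
  next
    fix z assume "z \<in> ?R"
    then obtain ys where ys: "z = prod_list ys" "length ys = Suc n" "set ys \<subseteq> X" by blast
    then obtain y ys' where "ys = y # ys'" by (cases ys) auto
    then show "z \<in> ?L" using ys by (intro CollectI exI[of _ "prod_list ys'"] exI[of _ y]) auto
  qed
  then show ?case by (simp add: Suc smul_def[symmetric]) (simp add: smul_def)
qed

text \<open>Multiplying all functions by one m in M gives the factor m^(r+1) only. Polarization, and
  with it characteristic zero, extends this to products of r + 1 different members of M.\<close>

lemma F_mod_smul_spow:
  fixes k :: "'a::field_char_0 set"
  assumes k: "is_subfield k" and \<delta>s: "\<forall>\<delta>\<in>set \<delta>s. derivation k \<delta>"
    and A: "is_subring A" "k \<subseteq> A" and M: "is_submodule A M"
  shows "smul A (F_mod \<delta>s A J) (spow A M (Suc (length \<delta>s))) \<subseteq> F_mod \<delta>s A (smul A J M)"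
proof -
  let ?n = "Suc (length \<delta>s)" and ?F = "F_mod \<delta>s A (smul A J M)"
  have W: "wronskian \<delta>s fs * u \<in> ?F"
    if fs: "length fs = ?n" "set fs \<subseteq> J" and u: "u \<in> spow A M ?n" for fs u
  proof -
    let ?U = "{u. \<forall>y\<in>{wronskian \<delta>s fs}. u * y \<in> ?F}"
    have U: "is_submodule A ?U" by (rule submodule_transporter) simp
    have "m ^ ?n \<in> ?U" if "m \<in> M" for m
    proof -
      have "wronskian \<delta>s (map ((*) m) fs) \<in> ?F"
        using fs smulI[OF _ that, of _ J A] by (intro F_modI) (auto simp: mult.commute[of m])
      then show ?thesis using wronskian_scale[OF \<delta>s fs(1), of m] by simp
    qed
    then have "prod_list ys \<in> ?U" if "length ys = ?n" "set ys \<subseteq> M" for ys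
      using polarization[OF k submodule_restrict[OF U A(2)] submodule_restrict[OF M A(2)] _ that] by blast
    then have "spow A M ?n \<subseteq> ?U"
      unfolding spow_eq_prod_list[OF A(1)] by (intro mspan_least[OF U]) blast
    then show ?thesis using u by (auto simp: mult.commute)
  qed
  show ?thesis
  proof (rule smul_least)
    fix x u assume x: "x \<in> F_mod \<delta>s A J" and u: "u \<in> spow A M ?n"
    show "x * u \<in> ?F"
      using x unfolding F_sheaf_determinants[of \<delta>s "\<lambda>_. J"]
      by (rule mspan_transport) (use W u in auto)
  qed simp
qed

section \<open>Boundedness of denominators\<close>

lemma common_denominator:
  fixes A :: "'a::field set"
  assumes A: "is_subring A" and frac: "\<forall>x. \<exists>a\<in>A. \<exists>b\<in>A. b \<noteq> 0 \<and> x = a / b" and "finite X"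
  shows "\<exists>d\<in>A. d \<noteq> 0 \<and> (\<forall>x\<in>X. d * x \<in> A)"
  using \<open>finite X\<close>
proof (induction X)
  case empty
  then show ?case using subring_1[OF A] by (intro bexI[of _ 1]) auto
next
  case (insert x X)
  then obtain d where d: "d \<in> A" "d \<noteq> 0" "\<forall>x\<in>X. d * x \<in> A" by blast
  obtain a b where ab: "a \<in> A" "b \<in> A" "b \<noteq> 0" "x = a / b" using frac by blast
  have "d * b * y \<in> A" if "y \<in> insert x X" for y
  proof (cases "y = x")
    case True
    then show ?thesis using ab d subring_mult[OF A] by simp
  next
    case False
    then have "d * y \<in> A" using that d(3) by blast
    then have "b * (d * y) \<in> A" by (rule subring_mult[OF A ab(2)])
    then show ?thesis by (simp add: mult_ac)
  qed
  then show ?case using d ab subring_mult[OF A] by (intro bexI[of _ "d * b"]) auto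
qed

lemma affine_algebra_subring: "affine_algebra k A \<Longrightarrow> is_subring A"
  by (auto simp: affine_algebra_def fin_gen_algebra_def is_subring_hull)

lemma affine_algebra_const: "affine_algebra k A \<Longrightarrow> k \<subseteq> A"
  by (auto simp: affine_algebra_def fin_gen_algebra_def intro: hull_inc)

lemma noeth_affine_algebra: "is_subfield k \<Longrightarrow> affine_algebra k A \<Longrightarrow> noeth A"
  by (auto simp: affine_algebra_def intro: noeth_fin_gen noeth_subfield)

text \<open>The a with all d \<delta> a in A form a ring by the Leibniz rule, and constants are
  killed by every \<delta>, so d has to clear only the derivatives of finitely many
  generators.\<close>

lemma derivation_denominator:
  assumes \<delta>s: "\<forall>\<delta>\<in>set \<delta>s. derivation k \<delta>" and A: "affine_algebra k A"
  shows "\<exists>d\<in>A. d \<noteq> 0 \<and> (\<forall>\<delta>\<in>set \<delta>s. \<forall>a\<in>A. d * \<delta> a \<in> A)"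
proof -
  have AR: "is_subring A" using A by (rule affine_algebra_subring)
  obtain S where S: "finite S" "A = is_subring hull (k \<union> S)"
    using A unfolding affine_algebra_def fin_gen_algebra_def by blast
  have "finite (\<Union>\<delta>\<in>set \<delta>s. \<delta> ` S)" using S(1) by simp
  then obtain d where d: "d \<in> A" "d \<noteq> 0" "\<forall>x\<in>(\<Union>\<delta>\<in>set \<delta>s. \<delta> ` S). d * x \<in> A"
    using common_denominator[OF AR] A unfolding affine_algebra_def by meson
  let ?B = "{a \<in> A. \<forall>\<delta>\<in>set \<delta>s. d * \<delta> a \<in> A}"
  have "is_subring ?B"
    unfolding is_subring_def
  proof (intro conjI ballI)
    have "d * \<delta> 1 \<in> A" if "\<delta> \<in> set \<delta>s" for \<delta>
      using derivation_one[of k \<delta>] \<delta>s that subring_0[OF AR] by simp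
    then show "1 \<in> ?B" using subring_1[OF AR] subring_0[OF AR] by auto
    fix x y assume xy: "x \<in> ?B" "y \<in> ?B"
    have "d * \<delta> (x - y) \<in> A \<and> d * \<delta> (x * y) \<in> A" if "\<delta> \<in> set \<delta>s" for \<delta>
    proof -
      have "derivation k \<delta>" using \<delta>s that by blast
      note der = derivation_diff[OF this, of x y] derivation_mult[OF this, of x y]
      have "d * \<delta> (x - y) = d * \<delta> x - d * \<delta> y"
           "d * \<delta> (x * y) = x * (d * \<delta> y) + y * (d * \<delta> x)"
        unfolding der by (simp_all add: algebra_simps)
      moreover have "x \<in> A" "y \<in> A" "d * \<delta> x \<in> A" "d * \<delta> y \<in> A" using xy that by auto
      ultimately show ?thesis by (simp only: subring_diff[OF AR] subring_mult[OF AR] subring_add[OF AR] simp_thms)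
    qed
    then show "x - y \<in> ?B" "x * y \<in> ?B"
      using xy by (auto intro: subring_diff[OF AR] subring_mult[OF AR])
  qed
  moreover have "k \<union> S \<subseteq> ?B"
  proof
    fix a assume a: "a \<in> k \<union> S"
    then have "a \<in> A" using S(2) by (auto intro: hull_inc)
    moreover have "d * \<delta> a \<in> A" if "\<delta> \<in> set \<delta>s" for \<delta>
    proof (cases "a \<in> S")
      case True
      then show ?thesis using d(3) that by blast
    next
      case False
      then have "\<delta> a = 0" using a \<delta>s that derivation_const[of k \<delta> a] by blast
      then show ?thesis using subring_0[OF AR] by simp
    qed
    ultimately show "a \<in> ?B" by blast
  qed
  ultimately have "A \<subseteq> ?B" using subring_hull_least[of ?B "k \<union> S"] S(2) by simp
  then show ?thesis using d by blast
qed

lemma fractional_ideal_F_mod: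
  assumes \<delta>s: "\<forall>\<delta>\<in>set \<delta>s. derivation k \<delta>" and A: "affine_algebra k A" and J: "fractional_ideal A J"
  shows "fractional_ideal A (F_mod \<delta>s A J)"
proof -
  have AR: "is_subring A" using A by (rule affine_algebra_subring)
  let ?n = "Suc (length \<delta>s)"
  obtain d where d: "d \<in> A" "d \<noteq> 0" "\<And>\<delta> a. \<delta> \<in> set \<delta>s \<Longrightarrow> a \<in> A \<Longrightarrow> d * \<delta> a \<in> A"
    using derivation_denominator[OF \<delta>s A] by blast
  obtain e where e: "e \<in> A" "e \<noteq> 0" "\<And>f. f \<in> J \<Longrightarrow> e * f \<in> A"
    using J unfolding fractional_ideal_def by blast
  \<comment> \<open>From \<open>e * e * \<delta> f = e * \<delta> (e * f) - (e * f) * \<delta>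
    e\<close>: both e f and e lie in A, and d clears their derivatives. The same D clears f itself,
    and its power with exponent r + 1 clears the determinant.\<close>
  define D where "D = d * e * e"
  have D: "D \<in> A" "D \<noteq> 0" using d e subring_mult[OF AR] by (auto simp: D_def)
  have pp: "D * principal_part \<delta>s f $ i \<in> A" if f: "f \<in> J" and i: "i < ?n" for f i
  proof (cases "i = 0")
    case True
    have "(d * e) * (e * f) \<in> A" using d e f subring_mult[OF AR] by simp
    then show ?thesis using True i by (simp add: principal_part_index D_def mult_ac)
  next
    case False
    let ?d = "\<delta>s ! (i - 1)"
    have mem: "?d \<in> set \<delta>s" using False i by simp
    then have der: "derivation k ?d" using \<delta>s by blast
    have "e * (d * ?d (e * f)) - (e * f) * (d * ?d e) \<in> A"
      by (intro subring_diff[OF AR] subring_mult[OF AR e(1) d(3)[OF mem]]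
        subring_mult[OF AR _ d(3)[OF mem]] e(1) e(3)[OF f])
    also have "e * (d * ?d (e * f)) - (e * f) * (d * ?d e) = D * ?d f"
      unfolding derivation_mult[OF der] by (simp add: D_def algebra_simps)
    finally show ?thesis using False i by (simp add: principal_part_index)
  qed
  have DA: "is_submodule A {u. \<forall>y\<in>{D ^ ?n}. u * y \<in> A}"
    using AR by (intro submodule_transporter submodule_subring)
  have "F_mod \<delta>s A J \<subseteq> {u. \<forall>y\<in>{D ^ ?n}. u * y \<in> A}"
  proof (rule F_mod_least[OF DA])
    fix fs assume fs: "length fs = ?n" "set fs \<subseteq> J"
    let ?W = "mat_of_rows ?n (map (principal_part \<delta>s) fs)"
    have W: "?W \<in> carrier_mat ?n ?n" using fs(1) by (simp add: mat_of_rows_def)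
    have "det (D \<cdot>\<^sub>m ?W) \<in> A"
    proof (rule det_in_subring[OF AR])
      show "D \<cdot>\<^sub>m ?W \<in> carrier_mat ?n ?n" using W by simp
      show "(D \<cdot>\<^sub>m ?W) $$ (i, j) \<in> A" if "i < ?n" "j < ?n" for i j
      proof -
        have "fs ! i \<in> J" using that fs nth_mem[of i fs] by auto
        then show ?thesis using that fs(1) pp[of "fs ! i" j] by (simp add: mat_of_rows_index)
      qed
    qed
    then show "wronskian \<delta>s fs \<in> {u. \<forall>y\<in>{D ^ ?n}. u * y \<in> A}"
      using fs(1) by (simp add: mult_ac)
  qed
  then have "\<forall>x\<in>F_mod \<delta>s A J. D ^ ?n * x \<in> A" by (auto simp: mult.commute)
  then show ?thesis
    unfolding fractional_ideal_def using D subring_power[OF AR D(1)]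
    by (intro conjI submodule_F_mod bexI[of _ "D ^ ?n"]) (auto simp del: power_Suc)
qed

section \<open>Uniform saturation\<close>

lemma prod_list_split_power:
  fixes g :: "'a::comm_monoid_mult"
  assumes "N \<le> count_list ys g"
  obtains ys' where "length ys = N + length ys'" "set ys' \<subseteq> set ys" "prod_list ys = g ^ N * prod_list ys'"
proof -
  have "\<exists>ys'. length ys = N + length ys' \<and> set ys' \<subseteq> set ys \<and> prod_list ys = g ^ N * prod_list ys'"
    using assms
  proof (induction ys arbitrary: N)
    case (Cons y ys)
    show ?case
    proof (cases "y = g \<and> N \<noteq> 0")
      case True
      then obtain n where n: "N = Suc n" by (cases N) auto
      then have "n \<le> count_list ys g" using True Cons.prems by simp
      then obtain ys' where "length ys = n + length ys'" "set ys' \<subseteq> set ys"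
          "prod_list ys = g ^ n * prod_list ys'" using Cons.IH by blast
      then show ?thesis using True n by (intro exI[of _ ys']) (auto simp: mult.assoc)
    next
      case False
      then have "N \<le> count_list ys g" using Cons.prems by auto
      then obtain ys' where "length ys = N + length ys'" "set ys' \<subseteq> set ys"
          "prod_list ys = g ^ N * prod_list ys'" using Cons.IH by blast
      then show ?thesis by (intro exI[of _ "y # ys'"]) (auto simp: mult_ac)
    qed
  qed simp
  then show thesis using that by blast
qed

lemma exponent_for_generators:
  assumes A: "is_subring A" and G: "finite G" "J = mspan A G"
    and X: "\<And>g. g \<in> G \<Longrightarrow> \<exists>n. y * g ^ n \<in> smul A (spow A J n) X"
  shows "\<exists>p. \<forall>z\<in>spow A J p. y * z \<in> smul A (spow A J p) X"
proof -
  have step: "y * z * z' \<in> smul A (spow A J (n + m)) X"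
    if "y * z \<in> smul A (spow A J n) X" "z' \<in> spow A J m" for z z' n m
    using smulI[OF that, of A] by (simp add: spow_add[OF A] smul_ac)
  obtain n where n: "\<And>g. g \<in> G \<Longrightarrow> y * g ^ n g \<in> smul A (spow A J (n g)) X"
    using X by metis
  define N where "N = Max (insert 0 (n ` G))"
  have N: "y * g ^ N \<in> smul A (spow A J N) X" if g: "g \<in> G" for g
  proof -
    have le: "n g \<le> N" unfolding N_def using G(1) g by simp
    have "g \<in> J" using g G(2) by (simp add: hull_inc)
    then have "g ^ (N - n g) \<in> spow A J (N - n g)" by (rule power_in_spow[OF A])
    from step[OF n[OF g] this] show ?thesis using le by (simp add: mult.assoc flip: power_add)
  qed
  \<comment> \<open>Pigeonhole: among more than card G times N factors from G, some g occurs at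
    least N times.\<close>
  define p where "p = Suc (card G * N)"
  have "y * prod_list ys \<in> smul A (spow A J p) X" if ys: "length ys = p" "set ys \<subseteq> G" for ys
  proof -
    have "\<exists>g\<in>G. N \<le> count_list ys g"
    proof (rule ccontr)
      assume "\<not> (\<exists>g\<in>G. N \<le> count_list ys g)"
      then have "sum (count_list ys) G \<le> card G * N"
        using sum_bounded_above[of G "count_list ys" N] by force
      moreover have "sum (count_list ys) G = length ys"
        using ys(2) G(1) by (rule sum_count_set)
      ultimately show False using ys(1) by (simp add: p_def)
    qed
    then obtain g where g: "g \<in> G" "N \<le> count_list ys g" by blast
    obtain ys' where ys': "length ys = N + length ys'" "set ys' \<subseteq> set ys"
        "prod_list ys = g ^ N * prod_list ys'"
      using prod_list_split_power[OF g(2)] by blast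
    have "prod_list ys' \<in> spow A J (length ys')"
      unfolding G(2) spow_mspan unfolding spow_eq_prod_list[OF A] using ys ys' by (intro hull_inc) blast
    from step[OF N[OF g(1)] this] show ?thesis using ys' ys(1) by (simp add: mult.assoc)
  qed
  then have gens: "prod_list ys * y \<in> smul A (spow A J p) X" if "length ys = p" "set ys \<subseteq> G" for ys
    using that by (simp add: mult.commute)
  have "spow A J p = mspan A {prod_list ys | ys. length ys = p \<and> set ys \<subseteq> G}"
    unfolding G(2) spow_mspan by (rule spow_eq_prod_list[OF A])
  then have "z * y \<in> smul A (spow A J p) X" if "z \<in> spow A J p" for z
    using that gens by (auto elim!: mspan_transport[OF _ submodule_smul])
  then show ?thesis by (auto simp: mult.commute)
qed

section \<open>The Rees algebra of two modules\<close>

text \<open>The constants of a polynomial ring are a field inside a type that is only a ring; h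
  carries the argument for subfields over to them.\<close>

lemma noeth_subfield_image:
  fixes k :: "'a::field set" and h :: "'a \<Rightarrow> 'b::comm_ring_1"
  assumes k: "is_subfield k" and h: "h 0 = 0" "h 1 = 1"
    "\<And>x y. h (x - y) = h x - h y" "\<And>x y. h (x * y) = h x * h y"
  shows "noeth (h ` k)"
  unfolding noeth_def
proof (intro conjI allI impI)
  have kR: "is_subring k" using k by (simp add: is_subfield_def)
  show hk: "is_subring (h ` k)"
    unfolding is_subring_def
  proof (intro conjI ballI)
    show "1 \<in> h ` k" using h(2) subring_1[OF kR] by (metis imageI)
    fix x y assume "x \<in> h ` k" "y \<in> h ` k"
    then obtain a b where "a \<in> k" "b \<in> k" "x = h a" "y = h b" by blast
    then show "x - y \<in> h ` k" "x * y \<in> h ` k"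
      using subring_diff[OF kR, of a b] subring_mult[OF kR, of a b] h(3,4)
      by (metis imageI)+
  qed
  fix Z assume sub: "Z \<subseteq> h ` k" and Z: "is_submodule (h ` k) Z"
  show "\<exists>S. finite S \<and> Z = mspan (h ` k) S"
  proof (cases "Z = {0}")
    case True
    then show ?thesis by (intro exI[of _ "{}"]) simp
  next
    case False
    then obtain z where z: "z \<in> Z" "z \<noteq> 0" using submodule_0[OF Z] by blast
    then obtain a where a: "a \<in> k" "z = h a" using sub by blast
    then have a0: "a \<noteq> 0" using z(2) h(1) by auto
    have "h (inverse a) * z \<in> Z"
      using k a(1) z(1) by (intro submodule_scale[OF Z]) (auto simp: is_subfield_def)
    moreover have "h (inverse a) * z = 1" using a0 unfolding a(2) h(4)[symmetric] by (simp add: h(2))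
    ultimately have "1 \<in> Z" by simp
    then have "Z = mspan (h ` k) {1}"
      using submodule_scale[OF Z _ \<open>1 \<in> Z\<close>] sub by (auto simp: mspan_one[OF hk])
    then show ?thesis by blast
  qed
qed

lemma poly_eq_sum_monoms2:
  fixes p :: "'a::comm_ring_1 poly poly"
  shows "p = (\<Sum>N\<le>degree p. \<Sum>m\<le>degree (coeff p N). monom (monom (coeff (coeff p N) m) m) N)"
proof -
  have monom_sum: "monom (sum f S) N = (\<Sum>m\<in>S. monom (f m) N)" for f :: "nat \<Rightarrow> 'a poly" and S N
    by (induction S rule: infinite_finite_induct) (auto simp flip: add_monom)
  have "p = (\<Sum>N\<le>degree p. monom (coeff p N) N)" by (simp add: poly_as_sum_of_monoms)
  also have "\<dots> = (\<Sum>N\<le>degree p. monom (\<Sum>m\<le>degree (coeff p N). monom (coeff (coeff p N) m) m) N)"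
    by (simp add: poly_as_sum_of_monoms)
  finally show ?thesis by (simp add: monom_sum)
qed

context
  fixes k A L M SA SL SM :: "'a::field set"
  assumes k: "is_subfield k"
    and A_def: "A = is_subring hull (k \<union> SA)" and L_def: "L = mspan A SL" and M_def: "M = mspan A SM"
    and fin: "finite SA" "finite SL" "finite SM"
begin

definition bigraded :: "nat \<Rightarrow> nat \<Rightarrow> 'a set" where
  "bigraded m N = smul A (spow A L m) (spow A M N)"

text \<open>The Rees algebra of L and M in two variables: the outer degree N counts factors from M,
  the inner degree m those from L. Polynomials keep the degrees apart, although all products live in
  one field.\<close>

definition bigraded_algebra :: "'a poly poly set" where
  "bigraded_algebra = {p. \<forall>N m. coeff (coeff p N) m \<in> bigraded m N}"

private lemma A: "is_subring A" unfolding A_def by simp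

private lemma kA: "k \<subseteq> A" unfolding A_def by (auto intro: hull_inc)

private lemma submodule_bigraded [simp]: "is_submodule A (bigraded m N)"
  by (simp add: bigraded_def)

lemma bigraded_0_0: "bigraded 0 0 = A"
  by (simp add: bigraded_def smul_unit_left submodule_subring A subringD[OF A])

lemma generators_bigraded:
  shows bigraded_1_0: "bigraded 1 0 = L" and bigraded_0_1: "bigraded 0 1 = M"
proof -
  have "is_submodule A L" "is_submodule A M" by (simp_all add: L_def M_def)
  then show "bigraded 1 0 = L" "bigraded 0 1 = M"
    by (simp_all add: bigraded_def smul_unit_left smul_unit_right subringD[OF A])
qed

lemma bigraded_mult: "x \<in> bigraded m N \<Longrightarrow> y \<in> bigraded m' N' \<Longrightarrow> x * y \<in> bigraded (m + m') (N + N')"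
proof -
  assume "x \<in> bigraded m N" "y \<in> bigraded m' N'"
  then have "x * y \<in> smul A (bigraded m N) (bigraded m' N')" by (rule smulI)
  also have "\<dots> = bigraded (m + m') (N + N')"
    unfolding bigraded_def spow_add[OF A] by (simp only: smul_ac)
  finally show ?thesis .
qed

lemma spow_subset_bigraded: "z \<in> spow A M N \<Longrightarrow> z \<in> bigraded 0 N"
  by (simp add: bigraded_def smul_unit_left A subringD[OF A])

lemma coeff_mult_bigraded:
  fixes p q :: "'a poly poly"
  assumes Z: "is_submodule A Z"
    and mem: "\<And>N1 N2 m1 m2. N1 + N2 = N \<Longrightarrow> m1 + m2 = m \<Longrightarrow>
      coeff (coeff p N1) m1 * coeff (coeff q N2) m2 \<in> Z"
  shows "coeff (coeff (p * q) N) m \<in> Z"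
  unfolding coeff_mult coeff_sum by (intro submodule_sum[OF Z] mem) auto

lemma subring_bigraded_algebra: "is_subring bigraded_algebra"
  unfolding is_subring_def
proof (intro conjI ballI)
  have "coeff (coeff (1 :: 'a poly poly) N) m \<in> bigraded m N" for N m
    using submodule_0[OF submodule_bigraded, of m N] bigraded_0_0 subring_1[OF A]
    by (auto simp: coeff_1)
  then show "1 \<in> bigraded_algebra" by (simp add: bigraded_algebra_def)
  fix p q assume pq: "p \<in> bigraded_algebra" "q \<in> bigraded_algebra"
  then show "p - q \<in> bigraded_algebra"
    by (auto simp: bigraded_algebra_def intro: submodule_diff[OF A submodule_bigraded])
  show "p * q \<in> bigraded_algebra"
    unfolding bigraded_algebra_def
  proof (intro CollectI allI coeff_mult_bigraded[OF submodule_bigraded])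
    fix N m N1 N2 m1 m2 :: nat assume "N1 + N2 = N" "m1 + m2 = m"
    then show "coeff (coeff p N1) m1 * coeff (coeff q N2) m2 \<in> bigraded m N"
      using pq bigraded_mult unfolding bigraded_algebra_def by blast
  qed
qed

lemma monom_in_bigraded_algebra:
  assumes "x \<in> bigraded m N"
  shows "monom (monom x m) N \<in> bigraded_algebra"
  using assms submodule_0[OF submodule_bigraded] by (auto simp: bigraded_algebra_def)

text \<open>Over the constants k it is generated by SA in bidegree (0, 0), SL in (1, 0) and SM in
  (0, 1). The x whose monomial of a given bidegree lies in the generated ring H form an A-module,
  which reduces the check to products of generators.\<close>

lemma noeth_bigraded_algebra: "noeth bigraded_algebra"
proof -
  let ?mm = "\<lambda>x m N. monom (monom x m) N :: 'a poly poly"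
  define c where "c a = ?mm a 0 0" for a
  let ?G = "c ` SA \<union> (\<lambda>l. ?mm l 1 0) ` SL \<union> (\<lambda>g. ?mm g 0 1) ` SM"
  define H where "H = is_subring hull (c ` k \<union> ?G)"
  have H: "is_subring H" by (simp add: H_def)
  have mult: "?mm x m N * ?mm y m' N' = ?mm (x * y) (m + m') (N + N')" for x y m m' N N'
    by (simp add: mult_monom)
  have inc: "c ` k \<union> ?G \<subseteq> H" unfolding H_def by (rule hull_subset)
  have "is_subring {a. c a \<in> H}"
    unfolding is_subring_def c_def
  proof (intro conjI ballI, goal_cases)
    case 1
    show ?case using subring_1[OF H] by (simp add: monom_0 one_pCons[symmetric])
  next
    case (2 x y)
    then show ?case using subring_diff[OF H, of "?mm x 0 0" "?mm y 0 0"] by (simp add: diff_monom)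
  next
    case (3 x y)
    then show ?case using subring_mult[OF H, of "?mm x 0 0" "?mm y 0 0"] by (simp add: mult)
  qed
  then have cA: "c a \<in> H" if "a \<in> A" for a
    using that inc subring_hull_least[of "{a. c a \<in> H}" "k \<union> SA"] unfolding A_def by blast
  have sub: "is_submodule A {x. ?mm x m N \<in> H}" for m N
  proof (rule submoduleI)
    show "0 \<in> {x. ?mm x m N \<in> H}" using subring_0[OF H] by simp
  next
    fix x y assume "x \<in> {x. ?mm x m N \<in> H}" "y \<in> {x. ?mm x m N \<in> H}"
    then show "x + y \<in> {x. ?mm x m N \<in> H}"
      using subring_add[OF H, of "?mm x m N" "?mm y m N"] by (simp add: add_monom)
  next
    fix a x assume "a \<in> A" "x \<in> {x. ?mm x m N \<in> H}"
    then show "a * x \<in> {x. ?mm x m N \<in> H}"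
      using subring_mult[OF H cA, of a "?mm x m N"] by (simp add: c_def mult)
  qed
  have L1: "L \<subseteq> {x. ?mm x 1 0 \<in> H}" unfolding L_def using inc by (intro mspan_least sub) auto
  have M1: "M \<subseteq> {x. ?mm x 0 1 \<in> H}" unfolding M_def using inc by (intro mspan_least sub) auto
  have Lm: "spow A L m \<subseteq> {x. ?mm x m 0 \<in> H}" for m
  proof (induction m)
    case 0
    then show ?case using cA by (auto simp: c_def)
  next
    case (Suc m)
    show ?case
      unfolding spow.simps
    proof (rule smul_least[OF sub])
      fix x y assume "x \<in> spow A L m" "y \<in> L"
      then have "?mm x m 0 \<in> H" "?mm y 1 0 \<in> H" using Suc L1 by auto
      from subring_mult[OF H this] show "x * y \<in> {x. ?mm x (Suc m) 0 \<in> H}" by (simp add: mult)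
    qed
  qed
  have Mm: "spow A M m \<subseteq> {x. ?mm x 0 m \<in> H}" for m
  proof (induction m)
    case 0
    then show ?case using cA by (auto simp: c_def)
  next
    case (Suc m)
    show ?case
      unfolding spow.simps
    proof (rule smul_least[OF sub])
      fix x y assume "x \<in> spow A M m" "y \<in> M"
      then have "?mm x 0 m \<in> H" "?mm y 0 1 \<in> H" using Suc M1 by auto
      from subring_mult[OF H this] show "x * y \<in> {x. ?mm x 0 (Suc m) \<in> H}" by (simp add: mult)
    qed
  qed
  have big: "bigraded m N \<subseteq> {x. ?mm x m N \<in> H}" for m N
    unfolding bigraded_def
  proof (rule smul_least[OF sub])
    fix x y assume "x \<in> spow A L m" "y \<in> spow A M N"
    then have "?mm x m 0 \<in> H" "?mm y 0 N \<in> H" using Lm Mm by auto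
    from subring_mult[OF H this] show "x * y \<in> {x. ?mm x m N \<in> H}" by (simp add: mult)
  qed
  have "bigraded_algebra \<subseteq> H"
  proof
    fix p assume p: "p \<in> bigraded_algebra"
    have "(\<Sum>N\<le>degree p. \<Sum>m\<le>degree (coeff p N). ?mm (coeff (coeff p N) m) m N) \<in> H"
      using p by (intro subring_sum[OF H] subsetD[OF big, THEN CollectD]) (simp add: bigraded_algebra_def)
    then show "p \<in> H" using poly_eq_sum_monoms2[of p] by simp
  qed
  moreover have "H \<subseteq> bigraded_algebra"
    unfolding H_def
  proof (rule subring_hull_least[OF subring_bigraded_algebra])
    have "c a \<in> bigraded_algebra" if "a \<in> A" for a
      unfolding c_def using that by (intro monom_in_bigraded_algebra) (simp add: bigraded_0_0)
    moreover have "SA \<subseteq> A" unfolding A_def by (auto intro: hull_inc)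
    moreover have "?mm l 1 0 \<in> bigraded_algebra" if "l \<in> SL" for l
      using that hull_inc[of l SL "is_submodule A"]
      by (intro monom_in_bigraded_algebra) (simp only: bigraded_1_0, simp add: L_def)
    moreover have "?mm g 0 1 \<in> bigraded_algebra" if "g \<in> SM" for g
      using that hull_inc[of g SM "is_submodule A"]
      by (intro monom_in_bigraded_algebra) (simp only: bigraded_0_1, simp add: M_def)
    ultimately show "c ` k \<union> ?G \<subseteq> bigraded_algebra" using kA by blast
  qed
  ultimately have eq: "bigraded_algebra = H" by (rule equalityI)
  have "noeth (c ` k)"
  proof (rule noeth_subfield_image[OF k])
    show "c 0 = 0" "c 1 = 1" by (simp_all add: c_def monom_0 one_pCons[symmetric])
    show "c (x - y) = c x - c y" "c (x * y) = c x * c y" for x y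
      by (simp_all add: c_def diff_monom mult_monom)
  qed
  moreover have "fin_gen_algebra (c ` k) bigraded_algebra"
    unfolding fin_gen_algebra_def eq H_def using fin by (intro exI[of _ ?G]) simp
  ultimately show ?thesis by (rule noeth_fin_gen)
qed

text \<open>
  The members of the bigraded algebra which a power of \<open>M\<close> multiplies into \<open>g\<close> times the algebra form a
  finitely generated ideal, so one power of \<open>M\<close> works for all of them; hence in large degrees they are
  divisible by \<open>g\<close>. Dividing \<open>g\<^sup>p y\<close> repeatedly by \<open>g\<close> then settles the claim.
\<close>
lemma saturation_exponent:
  assumes g: "g \<in> M" "g \<noteq> 0"
  shows "\<exists>N0. \<forall>m N y p. N0 \<le> N \<longrightarrow> (\<forall>z\<in>spow A M p. y * z \<in> bigraded m (N + p)) \<longrightarrow> y \<in> bigraded m N"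
proof -
  let ?E = bigraded and ?T = bigraded_algebra
  have gE: "is_submodule A ((*) g ` ?E m N)" for m N by (intro submodule_scale_image) simp
  \<comment> \<open>A larger exponent works as well, so finitely many exponents can be replaced by
    their maximum.\<close>
  have raise: "\<forall>z\<in>spow A M (e + d). x * z \<in> (*) g ` ?E m (N + d)"
    if x: "\<forall>z\<in>spow A M e. x * z \<in> (*) g ` ?E m N" for x e d m N
  proof -
    have "spow A M (e + d) \<subseteq> {z. \<forall>y\<in>{x}. z * y \<in> (*) g ` ?E m (N + d)}"
      unfolding spow_add[OF A]
    proof (rule smul_least[OF submodule_transporter[OF gE]])
      fix z w assume "z \<in> spow A M e" and w: "w \<in> spow A M d"
      then obtain u where u: "u \<in> ?E m N" "x * z = g * u" using x by blast
      have "u * w \<in> ?E m (N + d)" using bigraded_mult[OF u(1) spow_subset_bigraded[OF w]] by simp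
      moreover have "z * w * x = g * (u * w)" using u(2) by (metis mult.assoc mult.commute)
      ultimately show "z * w \<in> {z. \<forall>y\<in>{x}. z * y \<in> (*) g ` ?E m (N + d)}" by blast
    qed
    then show ?thesis by (auto simp: mult.commute)
  qed
  \<comment> \<open>The power of M is \<open>Suc e\<close> while the target has degree
    \<open>N + e\<close>: dividing by g lowers the degree in M by one.\<close>
  define Zs where "Zs m N = {x \<in> ?E m N. \<exists>e. \<forall>z\<in>spow A M (Suc e). x * z \<in> (*) g ` ?E m (N + e)}" for m N
  have ZsI: "x \<in> Zs m N" if "x \<in> ?E m N" "\<forall>z\<in>spow A M (Suc e). x * z \<in> (*) g ` ?E m (N + e)" for x m N e
    using that unfolding Zs_def by blast
  have Zs_add: "x + y \<in> Zs m N" if xy: "x \<in> Zs m N" "y \<in> Zs m N" for x y m N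
  proof -
    obtain e where e: "\<forall>z\<in>spow A M (Suc e). x * z \<in> (*) g ` ?E m (N + e)"
      using xy(1) unfolding Zs_def by blast
    obtain f where f: "\<forall>z\<in>spow A M (Suc f). y * z \<in> (*) g ` ?E m (N + f)"
      using xy(2) unfolding Zs_def by blast
    have "\<forall>z\<in>spow A M (Suc (e + f)). x * z \<in> (*) g ` ?E m (N + (e + f))"
      using raise[OF e, of f] by (simp add: add.assoc del: spow.simps)
    moreover have "\<forall>z\<in>spow A M (Suc (e + f)). y * z \<in> (*) g ` ?E m (N + (e + f))"
      using raise[OF f, of e] by (simp add: add.assoc add.commute[of f] del: spow.simps)
    ultimately have "\<forall>z\<in>spow A M (Suc (e + f)). (x + y) * z \<in> (*) g ` ?E m (N + (e + f))"
      unfolding distrib_right using submodule_add[OF gE] by blast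
    then show ?thesis
      using xy submodule_add[OF submodule_bigraded] by (intro ZsI) (auto simp: Zs_def simp del: spow.simps)
  qed
  have Zs_mult: "t * x \<in> Zs (m' + m) (N' + N)" if t: "t \<in> ?E m' N'" and x: "x \<in> Zs m N" for t x m m' N N'
  proof -
    obtain e where e: "\<forall>z\<in>spow A M (Suc e). x * z \<in> (*) g ` ?E m (N + e)"
      using x unfolding Zs_def by blast
    have "t * x * z \<in> (*) g ` ?E (m' + m) (N' + N + e)" if z: "z \<in> spow A M (Suc e)" for z
    proof -
      obtain u where u: "u \<in> ?E m (N + e)" "x * z = g * u" using e z by blast
      have "t * u \<in> ?E (m' + m) (N' + N + e)" using bigraded_mult[OF t u(1)] by (simp add: add.assoc)
      moreover have "t * x * z = g * (t * u)" using u(2) by (metis mult.assoc mult.commute)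
      ultimately show ?thesis by blast
    qed
    then show ?thesis using bigraded_mult[OF t] x by (intro ZsI) (auto simp: Zs_def simp del: spow.simps)
  qed
  have Zs_0: "0 \<in> Zs m N" for m N
    using submodule_0[OF submodule_bigraded] submodule_0[OF gE] by (intro ZsI) auto
  have Zs_mod: "is_submodule A (Zs m N)" for m N
    using Zs_0 Zs_add Zs_mult[of _ 0 0] by (intro submoduleI) (auto simp: bigraded_0_0)
  define Z where "Z = {p. \<forall>N m. coeff (coeff p N) m \<in> Zs m N}"
  have ZT: "Z \<subseteq> ?T" by (auto simp: Z_def Zs_def bigraded_algebra_def)
  have "is_submodule ?T Z"
  proof (rule submoduleI)
    show "0 \<in> Z" by (simp add: Z_def Zs_0)
    show "p + q \<in> Z" if "p \<in> Z" "q \<in> Z" for p q using that Zs_add by (auto simp: Z_def)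
    fix t p assume tp: "t \<in> ?T" "p \<in> Z"
    show "t * p \<in> Z"
      unfolding Z_def
    proof (intro CollectI allI coeff_mult_bigraded[OF Zs_mod])
      fix N m N1 N2 m1 m2 :: nat assume "N1 + N2 = N" "m1 + m2 = m"
      then show "coeff (coeff t N1) m1 * coeff (coeff p N2) m2 \<in> Zs m N"
        using tp Zs_mult unfolding Z_def bigraded_algebra_def by blast
    qed
  qed
  then obtain G where G: "finite G" "Z = mspan ?T G"
    using noeth_bigraded_algebra ZT unfolding noeth_def by meson
  have GZ: "G \<subseteq> Z" using G(2) by (auto intro: hull_inc)
  define D where "D = Max (insert 0 (degree ` G))"
  have D: "degree p \<le> D" if "p \<in> G" for p unfolding D_def using G(1) that by simp
  let ?c = "\<lambda>(p, N, m). coeff (coeff p N) m"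
  have "\<exists>e. \<forall>z\<in>spow A M (Suc e). coeff (coeff p N) m * z \<in> (*) g ` ?E m (N + e)"
    if "p \<in> G" for p N m
    using GZ that unfolding Z_def Zs_def by blast
  then obtain ex where ex: "\<And>p N m. p \<in> G \<Longrightarrow>
      \<forall>z\<in>spow A M (Suc (ex p N m)). coeff (coeff p N) m * z \<in> (*) g ` ?E m (N + ex p N m)"
    by metis
  define B where "B = (SIGMA p:G. SIGMA N:{..degree p}. {..degree (coeff p N)})"
  have "finite B" unfolding B_def using G(1) by auto
  define e where "e = Max (insert 0 ((\<lambda>(p, N, m). ex p N m) ` B))"
  have ee: "coeff (coeff p N) m * z \<in> (*) g ` ?E m (N + e)"
    if p: "p \<in> G" and z: "z \<in> spow A M (Suc e)" for p N m z
  proof (cases "(p, N, m) \<in> B")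
    case True
    then have le: "ex p N m \<le> e" unfolding e_def using \<open>finite B\<close> by (intro Max_ge) force+
    from raise[OF ex[OF p, of N m], of "e - ex p N m"] show ?thesis using le z by (simp del: spow.simps)
  next
    case False
    then have "coeff (coeff p N) m = 0"
      using p unfolding B_def by (auto simp: coeff_eq_0 not_le)
    then show ?thesis using submodule_0[OF gE] by simp
  qed
  \<comment> \<open>Generators have degree at most D in M and need at most \<open>Suc e\<close>
    further factors from M to become divisible by g; degrees above C leave room for both.\<close>
  define C where "C = D + e"
  \<comment> \<open>This is what the generators of Z satisfy, in a form that passes to the ideal
    they generate: the M-part of a multiplier t is absorbed into z, and its L-part is multiplied
    onto the quotient by g.\<close>
  define X where "X = {p. \<forall>N m p' n. N + p' = Suc n \<longrightarrow> C \<le> n \<longrightarrow>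
      (\<forall>z\<in>spow A M p'. coeff (coeff p N) m * z \<in> (*) g ` ?E m n)}"
  have XI: "p \<in> X" if "\<And>N m p' n z. N + p' = Suc n \<Longrightarrow> C \<le> n \<Longrightarrow> z \<in> spow A M p' \<Longrightarrow>
      coeff (coeff p N) m * z \<in> (*) g ` ?E m n" for p
    using that unfolding X_def by blast
  have XD: "coeff (coeff p N) m * z \<in> (*) g ` ?E m n"
    if "p \<in> X" "N + p' = Suc n" "C \<le> n" "z \<in> spow A M p'" for p N m p' n z
    using that unfolding X_def by blast
  have "is_submodule ?T X"
  proof (rule submoduleI)
    show "0 \<in> X" using submodule_0[OF gE] by (intro XI) simp
    show "p + q \<in> X" if "p \<in> X" "q \<in> X" for p q
      using XD[OF that(1)] XD[OF that(2)] submodule_add[OF gE]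
      by (intro XI) (simp add: distrib_right)
    fix t p assume t: "t \<in> ?T" and p: "p \<in> X"
    show "t * p \<in> X"
    proof (rule XI)
      fix N m p' n z assume n: "N + p' = Suc n" "C \<le> n" and z: "z \<in> spow A M p'"
      have "coeff (coeff (t * p) N) m \<in> {u. \<forall>y\<in>{z}. u * y \<in> (*) g ` ?E m n}"
      proof (rule coeff_mult_bigraded[OF submodule_transporter[OF gE]])
        fix N1 N2 m1 m2 assume N: "N1 + N2 = N" and m: "m1 + m2 = m"
        let ?x = "coeff (coeff p N2) m2"
        have "smul A (spow A L m1) (spow A M N1) \<subseteq> {u. \<forall>y\<in>{?x * z}. u * y \<in> (*) g ` ?E m n}"
        proof (rule smul_least[OF submodule_transporter[OF gE]])
          fix l w assume l: "l \<in> spow A L m1" and w: "w \<in> spow A M N1"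
          have "w * z \<in> spow A M (N1 + p')" using w z by (rule spow_in_add[OF A])
          then obtain u where u: "u \<in> ?E m2 n" "?x * (w * z) = g * u"
            using XD[OF p, of N2 "N1 + p'" n] n N by auto
          have "l \<in> ?E m1 0" using l by (simp add: bigraded_def smul_unit_right A subringD[OF A])
          then have "l * u \<in> ?E m n" using bigraded_mult[OF _ u(1)] m by fastforce
          moreover have "l * w * (?x * z) = g * (l * u)" using u(2) by (metis mult.assoc mult.commute)
          ultimately show "l * w \<in> {u. \<forall>y\<in>{?x * z}. u * y \<in> (*) g ` ?E m n}" by blast
        qed
        moreover have "coeff (coeff t N1) m1 \<in> smul A (spow A L m1) (spow A M N1)"
          using t unfolding bigraded_algebra_def bigraded_def by blast
        ultimately have "coeff (coeff t N1) m1 * (?x * z) \<in> (*) g ` ?E m n" by blast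
        then show "coeff (coeff t N1) m1 * ?x \<in> {u. \<forall>y\<in>{z}. u * y \<in> (*) g ` ?E m n}"
          by (simp add: mult.assoc)
      qed
      then show "coeff (coeff (t * p) N) m * z \<in> (*) g ` ?E m n" by blast
    qed
  qed
  moreover have "G \<subseteq> X"
  proof
    fix p assume p: "p \<in> G"
    show "p \<in> X"
    proof (rule XI)
      fix N m p' n z assume n: "N + p' = Suc n" "C \<le> n" and z: "z \<in> spow A M p'"
      show "coeff (coeff p N) m * z \<in> (*) g ` ?E m n"
      proof (cases "N \<le> degree p")
        case True
        then have "N \<le> D" using D[OF p] by simp
        then have *: "p' = Suc e + (n - (N + e))" "N + e + (n - (N + e)) = n"
          using n by (auto simp: C_def)
        have "\<forall>z\<in>spow A M (Suc e). coeff (coeff p N) m * z \<in> (*) g ` ?E m (N + e)"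
          using ee[OF p] by blast
        from raise[OF this, of "n - (N + e)"] show ?thesis using z * by (simp del: spow.simps)
      next
        case False
        then have "coeff p N = 0" by (simp add: coeff_eq_0)
        then show ?thesis using submodule_0[OF gE] by simp
      qed
    qed
  qed
  ultimately have "Z \<subseteq> X" unfolding G(2) by (rule mspan_least)
  \<comment> \<open>The case p' = 0: in large degree an element of \<open>Zs\<close> is divisible by
    g without the help of M.\<close>
  have key: "x \<in> (*) g ` ?E m n" if n: "C \<le> n" and x: "x \<in> Zs m (Suc n)" for x m n
  proof -
    have "monom (monom x m) (Suc n) \<in> Z" using x Zs_0 by (auto simp: Z_def)
    then have "monom (monom x m) (Suc n) \<in> X" using \<open>Z \<subseteq> X\<close> by blast
    from XD[OF this, of "Suc n" 0 n 1 m] n show ?thesis using subring_1[OF A] by simp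
  qed
  have "y \<in> ?E m N" if N: "C \<le> N" and y: "\<forall>z\<in>spow A M p. y * z \<in> ?E m (N + p)" for m N y p
  proof -
    have down: "g ^ q * y \<in> ?E m (N + q) \<Longrightarrow> y \<in> ?E m N" for q
    proof (induction q)
      case (Suc q)
      \<comment> \<open>One factor g is split off; the remaining \<open>g ^ q * (y * z)\<close> is
        controlled by the hypothesis on y. Hence \<open>g ^ Suc q * y\<close> belongs to
        \<open>Zs\<close>, and one g can be cancelled.\<close>
      have "g ^ Suc q * y * z \<in> (*) g ` ?E m (N + Suc q + p)" if z: "z \<in> spow A M (Suc p)" for z
      proof -
        have "spow A M (Suc p) \<subseteq> {z. \<forall>y\<in>{y}. z * y \<in> ?E m (N + Suc p)}"
          unfolding spow.simps
        proof (rule smul_least[OF submodule_transporter[OF submodule_bigraded]])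
          fix v w assume "v \<in> spow A M p" "w \<in> M"
          then have "y * v \<in> ?E m (N + p)" "w \<in> ?E 0 1"
            using y by (simp_all only: bigraded_0_1)
          from bigraded_mult[OF this] show "v * w \<in> {z. \<forall>y\<in>{y}. z * y \<in> ?E m (N + Suc p)}"
            by (simp add: mult_ac)
        qed
        then have "y * z \<in> ?E m (N + Suc p)" using z by (auto simp: mult.commute)
        then have "g ^ q * (y * z) \<in> ?E (0 + m) (q + (N + Suc p))"
          using power_in_spow[OF A g(1)] by (intro bigraded_mult spow_subset_bigraded)
        then have "g ^ q * (y * z) \<in> ?E m (N + Suc q + p)" by (simp add: add_ac)
        then show ?thesis by (auto simp: mult.assoc intro!: imageI)
      qed
      with Suc.prems have "g ^ Suc q * y \<in> Zs m (Suc (N + q))"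
        by (intro ZsI[where e = p]) (simp_all del: spow.simps power_Suc)
      then have "g ^ Suc q * y \<in> (*) g ` ?E m (N + q)" using N by (intro key) auto
      then have "g ^ q * y \<in> ?E m (N + q)" using g(2) by (auto simp: mult.assoc)
      then show ?case by (rule Suc.IH)
    qed simp
    have "y * g ^ p \<in> ?E m (N + p)" using y power_in_spow[OF A g(1)] by blast
    then have "g ^ p * y \<in> ?E m (N + p)" by (simp only: mult.commute)
    then show ?thesis by (rule down)
  qed
  then show ?thesis by blast
qed

end

section \<open>Base \<open>b\<close> expansions\<close>

primrec digit_prod :: "'a::comm_ring_1 set \<Rightarrow> nat \<Rightarrow> (nat \<Rightarrow> 'a set) \<Rightarrow> nat \<Rightarrow> nat \<Rightarrow> 'a set" where
  "digit_prod A b L 0 i = A"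
| "digit_prod A b L (Suc s) i = smul A (digit_prod A b L s i) (spow A (L s) (i div b ^ s mod b))"

text \<open>Carrying is stopped at the digit with index \<open>s\<close>, which is unbounded.\<close>
definition trunc_prod :: "'a::comm_ring_1 set \<Rightarrow> nat \<Rightarrow> (nat \<Rightarrow> 'a set) \<Rightarrow> nat \<Rightarrow> nat \<Rightarrow> 'a set" where
  "trunc_prod A b L s i = smul A (digit_prod A b L s i) (spow A (L s) (i div b ^ s))"

abbreviation digit_prods :: "'a::comm_ring_1 set \<Rightarrow> nat \<Rightarrow> (nat \<Rightarrow> 'a set) \<Rightarrow> nat \<Rightarrow> 'a set" where
  "digit_prods A b L i \<equiv> digit_prod A b L i i"

lemma less_power: "2 \<le> b \<Longrightarrow> n < b ^ n" for b :: nat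
  by (rule power_gt_expt) simp

context
  fixes A :: "'a::comm_ring_1 set" and b :: nat
  assumes A: "is_subring A" and b: "2 \<le> b"
begin

lemma submodule_digit_prod [simp]: "is_submodule A (digit_prod A b L s i)"
  by (cases s) (simp_all add: submodule_subring A)

lemma submodule_trunc_prod [simp]: "is_submodule A (trunc_prod A b L s i)"
  by (simp add: trunc_prod_def)

private lemma unit_right [simp]: "is_submodule A X \<Longrightarrow> smul A X A = X"
  by (simp add: smul_unit_right subringD[OF A])

private lemma unit_left [simp]: "is_submodule A X \<Longrightarrow> smul A A X = X"
  by (simp add: smul_unit_left subringD[OF A])

private lemma AA: "is_submodule A A"
  by (rule submodule_subring[OF A])

lemma digit_prod_zero [simp]: "digit_prod A b L s 0 = A"
  by (induction s) (simp_all add: AA)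

text \<open>The definition peels off the top digit, but carrying starts at the lowest one. This form
  lets induction on s replace i by \<open>i div b\<close> and shift the sequence L.\<close>

lemma digit_prod_head:
  "digit_prod A b L (Suc s) i =
     smul A (spow A (L 0) (i mod b)) (digit_prod A b (\<lambda>\<alpha>. L (Suc \<alpha>)) s (i div b))"
proof (induction s)
  case 0
  then show ?case by (simp add: A AA)
next
  case (Suc s)
  have "i div b ^ Suc s = i div b div b ^ s" by (simp add: div_mult2_eq)
  then show ?case
    unfolding digit_prod.simps(2)[of A b L "Suc s"] Suc by (simp add: smul_ac)
qed

lemma digit_prod_split:
  "digit_prod A b L (n + s) i =
     smul A (digit_prod A b L n i) (digit_prod A b (\<lambda>\<alpha>. L (n + \<alpha>)) s (i div b ^ n))"
  by (induction s) (simp_all add: smul_assoc power_add div_mult2_eq)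

lemma digit_prod_mod: "digit_prod A b L n (i mod b ^ n) = digit_prod A b L n i"
proof -
  have dig: "i mod b ^ n div b ^ \<alpha> mod b = i div b ^ \<alpha> mod b" if "\<alpha> < n" for \<alpha>
  proof -
    define d where "d = n - Suc \<alpha>"
    have n: "n = \<alpha> + Suc d" using that by (simp add: d_def)
    have b0: "b ^ \<alpha> \<noteq> 0" using b by simp
    have "i mod b ^ n = b ^ \<alpha> * (i div b ^ \<alpha> mod b ^ Suc d) + i mod b ^ \<alpha>"
      unfolding n power_add by (rule mod_mult2_eq)
    then have "i mod b ^ n div b ^ \<alpha> = i div b ^ \<alpha> mod b ^ Suc d" using b0 by simp
    then show ?thesis by (simp add: mod_mod_cancel)
  qed
  have "digit_prod A b L m (i mod b ^ n) = digit_prod A b L m i" if "m \<le> n" for m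
    using that by (induction m) (simp_all add: dig)
  then show ?thesis by simp
qed

lemma digit_prod_stable:
  assumes "i < b ^ s" "s \<le> t"
  shows "digit_prod A b L t i = digit_prod A b L s i"
  using digit_prod_split[of L s "t - s" i] assms by simp

lemma digit_prods_eq: "i < b ^ s \<Longrightarrow> digit_prods A b L i = digit_prod A b L s i"
  using digit_prod_stable[of i s "max s i" L] digit_prod_stable[of i i "max s i" L] less_power[OF b, of i]
  by simp

lemma digit_prods_eq_trunc:
  assumes "i < b ^ Suc s"
  shows "digit_prods A b L i = trunc_prod A b L s i"
proof -
  have "i div b ^ s < b" using assms b by (simp add: less_mult_imp_div_less mult.commute)
  then show ?thesis using digit_prods_eq[OF assms] by (simp add: trunc_prod_def)
qed

lemma trunc_prod_head:
  "trunc_prod A b L (Suc s) i =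
     smul A (spow A (L 0) (i mod b)) (trunc_prod A b (\<lambda>\<alpha>. L (Suc \<alpha>)) s (i div b))"
  unfolding trunc_prod_def digit_prod_head by (simp add: smul_assoc div_mult2_eq)

lemma trunc_prod_zero [simp]: "trunc_prod A b L s 0 = A"
  by (simp add: trunc_prod_def AA)

lemma trunc_prod_one:
  assumes "is_submodule A (L 0)"
  shows "trunc_prod A b L s 1 = L 0"
proof (cases s)
  case 0
  then show ?thesis using assms by (simp add: trunc_prod_def)
next
  case (Suc t)
  then show ?thesis using assms b by (simp add: trunc_prod_head)
qed

text \<open>Adding the lowest digits produces at most one carry. The carry turns b factors
  \<open>L 0\<close> into \<open>L 1\<close>, which is the part of degree 1 for the shifted
  sequence, so it is absorbed by a second use of the induction hypothesis.\<close>

lemma trunc_prod_mult: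
  assumes L: "\<And>\<alpha>. is_submodule A (L \<alpha>)" and carry: "\<And>\<alpha>. spow A (L \<alpha>) b \<subseteq> L (Suc \<alpha>)"
  shows "smul A (trunc_prod A b L s i) (trunc_prod A b L s j) \<subseteq> trunc_prod A b L s (i + j)"
  using assms
proof (induction s arbitrary: L i j)
  case 0
  then show ?case by (simp add: trunc_prod_def A spow_add[OF A])
next
  case (Suc s)
  let ?L = "\<lambda>\<alpha>. L (Suc \<alpha>)" and ?u = "i mod b + j mod b"
  let ?G = "trunc_prod A b ?L s"
  note IH = Suc.IH[of ?L, OF Suc.prems]
  have "smul A (trunc_prod A b L (Suc s) i) (trunc_prod A b L (Suc s) j)
      = smul A (spow A (L 0) ?u) (smul A (?G (i div b)) (?G (j div b)))"
    unfolding trunc_prod_head spow_add[OF A] by (simp only: smul_ac)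
  also have "\<dots> \<subseteq> smul A (spow A (L 0) ?u) (?G (i div b + j div b))"
    by (intro smul_mono IH order_refl)
  also have "\<dots> \<subseteq> trunc_prod A b L (Suc s) (i + j)"
  proof (cases "?u < b")
    case True
    then have "(i + j) mod b = ?u" "(i + j) div b = i div b + j div b"
      unfolding mod_add_eq[of i b j, symmetric] div_add1_eq[of i j b] by simp_all
    then show ?thesis unfolding trunc_prod_head by simp
  next
    case False
    have b0: "0 < b" using b by simp
    define m where "m = ?u - b"
    have "i mod b < b" "j mod b < b" using b0 by simp_all
    then have m: "?u = b + m" "m < b" using False unfolding m_def by linarith+
    have mod: "(i + j) mod b = m"
      unfolding mod_add_eq[of i b j, symmetric] using m by simp
    have div: "(i + j) div b = 1 + (i div b + j div b)"
      unfolding div_add1_eq[of i j b] using m b0 by simp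
    have "smul A (spow A (L 0) ?u) (?G (i div b + j div b)) =
        smul A (spow A (L 0) m) (smul A (spow A (L 0) b) (?G (i div b + j div b)))"
      unfolding m(1) spow_add[OF A] by (simp only: smul_ac)
    also have "\<dots> \<subseteq> smul A (spow A (L 0) m) (smul A (?G 1) (?G (i div b + j div b)))"
      unfolding trunc_prod_one[of ?L, OF Suc.prems(1)] by (intro smul_mono order_refl Suc.prems)
    also have "\<dots> \<subseteq> smul A (spow A (L 0) m) (?G (1 + (i div b + j div b)))"
      by (intro smul_mono IH order_refl)
    finally show ?thesis unfolding trunc_prod_head mod div .
  qed
  finally show ?case .
qed

lemma digit_prods_mult:
  assumes L: "\<And>\<alpha>. is_submodule A (L \<alpha>)" and carry: "\<And>\<alpha>. spow A (L \<alpha>) b \<subseteq> L (Suc \<alpha>)"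
  shows "smul A (digit_prods A b L i) (digit_prods A b L j) \<subseteq> digit_prods A b L (i + j)"
proof -
  have "i + j < b ^ (i + j)" by (rule less_power[OF b])
  also have "\<dots> \<le> b ^ Suc (i + j)" using b by (intro power_increasing) auto
  finally have ij: "i + j < b ^ Suc (i + j)" .
  then have "i < b ^ Suc (i + j)" "j < b ^ Suc (i + j)" by linarith+
  then show ?thesis
    using trunc_prod_mult[of L, OF assms, of "i + j" i j] ij
    by (simp only: digit_prods_eq_trunc)
qed

lemma spow_graded_subset:
  assumes "A \<subseteq> W 0" "\<And>p q. smul A (W p) (W q) \<subseteq> W (p + q)" "X \<subseteq> W 1"
  shows "spow A X n \<subseteq> W n"
proof (induction n)
  case (Suc n)
  have "smul A (spow A X n) X \<subseteq> smul A (W n) (W 1)" by (intro smul_mono Suc assms)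
  then show ?case using assms(2)[of n 1] by auto
qed (simp add: assms)

text \<open>The induction shifts L and passes to the degrees of W divisible by b, where the
  hypotheses hold again.\<close>

lemma trunc_prod_least:
  assumes W: "\<And>q. is_submodule A (W q)" "A \<subseteq> W 0" "\<And>p q. smul A (W p) (W q) \<subseteq> W (p + q)"
    and L: "\<And>\<alpha>. L \<alpha> \<subseteq> W (b ^ \<alpha>)"
  shows "trunc_prod A b L s i \<subseteq> W i"
  using assms
proof (induction s arbitrary: L W i)
  case 0
  have "spow A (L 0) i \<subseteq> W i"
    using 0(4)[of 0] by (intro spow_graded_subset[of W "L 0"] 0) simp_all
  then show ?case by (simp add: trunc_prod_def A)
next
  case (Suc s)
  have pow: "spow A (L 0) n \<subseteq> W n" for n
    using Suc.prems(4)[of 0] by (intro spow_graded_subset[of W "L 0"] Suc.prems) simp_all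
  have "trunc_prod A b (\<lambda>\<alpha>. L (Suc \<alpha>)) s (i div b) \<subseteq> W (b * (i div b))"
    using Suc.prems(2) Suc.prems(3)[of "b * _" "b * _"] Suc.prems(4)[of "Suc _"]
    by (intro Suc.IH[where W = "\<lambda>q. W (b * q)"] Suc.prems(1)) (simp_all add: distrib_left)
  then have "smul A (spow A (L 0) (i mod b)) (trunc_prod A b (\<lambda>\<alpha>. L (Suc \<alpha>)) s (i div b))
      \<subseteq> smul A (W (i mod b)) (W (b * (i div b)))"
    by (intro smul_mono pow)
  also have "\<dots> \<subseteq> W i" using Suc.prems(3)[of "i mod b" "b * (i div b)"] by simp
  finally show ?case unfolding trunc_prod_head .
qed

lemma digit_prods_power:
  assumes "\<And>\<alpha>. is_submodule A (L \<alpha>)"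
  shows "digit_prods A b L (b ^ t) = L t"
proof -
  have "b ^ t < b ^ Suc t" using b by simp
  then have "digit_prods A b L (b ^ t) = trunc_prod A b L t (b ^ t)" by (rule digit_prods_eq_trunc)
  moreover have "digit_prod A b L t (b ^ t) = A" using digit_prod_mod[of L t "b ^ t"] by simp
  moreover have "b ^ t div b ^ t = 1" using b by simp
  ultimately show ?thesis using assms by (simp add: trunc_prod_def)
qed

text \<open>Splitting off the n lowest digits reduces finite type to the finitely many degrees below
  \<open>b ^ n\<close> and the part of R in degrees divisible by \<open>b ^ n\<close>.\<close>

lemma digit_prods_split:
  "digit_prods A b L i =
     smul A (digit_prods A b L (i mod b ^ n)) (digit_prods A b (\<lambda>\<alpha>. L (n + \<alpha>)) (i div b ^ n))"
proof -
  have "i div b ^ n \<le> i" by simp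
  then have "i div b ^ n < b ^ i" using less_power[OF b, of i] by linarith
  moreover have "i < b ^ (n + i)"
    using less_power[OF b, of i] power_increasing[of i "n + i" b] b by linarith
  moreover have "i mod b ^ n < b ^ n" using b by simp
  ultimately show ?thesis
    using digit_prod_split[of L n i i] by (simp add: digit_prods_eq digit_prod_mod)
qed

lemma digit_prods_multiple:
  "digit_prods A b L (q * b ^ n) = digit_prods A b (\<lambda>\<alpha>. L (n + \<alpha>)) q"
  using digit_prods_split[of L "q * b ^ n" n] b by simp

end

section \<open>Finite type versus stability of the graded algebra\<close>

definition graded_algebra :: "(nat \<Rightarrow> 'a::field set) \<Rightarrow> 'a poly set" where
  "graded_algebra R = {p. \<forall>i. coeff p i \<in> R i}"

lemma subring_graded_algebra:
  assumes A: "is_subring A" and R: "\<And>i. is_submodule A (R i)" "A \<subseteq> R 0"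
    and mult: "\<And>i j. smul A (R i) (R j) \<subseteq> R (i + j)"
  shows "is_subring (graded_algebra R)"
  unfolding is_subring_def
proof (intro conjI ballI)
  have "coeff 1 i \<in> R i" for i
    using submodule_0[OF R(1), of i] subring_1[OF A] R(2) by (auto simp: coeff_1)
  then show "1 \<in> graded_algebra R" by (simp add: graded_algebra_def)
  fix p q assume pq: "p \<in> graded_algebra R" "q \<in> graded_algebra R"
  then show "p - q \<in> graded_algebra R"
    by (auto simp: graded_algebra_def intro: submodule_diff[OF A R(1)])
  have "coeff p j * coeff q (i - j) \<in> R i" if "j \<le> i" for i j
  proof -
    have "coeff p j * coeff q (i - j) \<in> smul A (R j) (R (i - j))"
      using pq by (intro smulI) (auto simp: graded_algebra_def)
    then show ?thesis using mult[of j "i - j"] that by auto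
  qed
  then have "coeff (p * q) i \<in> R i" for i
    unfolding coeff_mult by (intro submodule_sum[OF R(1)]) auto
  then show "p * q \<in> graded_algebra R" by (simp add: graded_algebra_def)
qed

lemma monom_graded_algebra: "(\<And>i. 0 \<in> R i) \<Longrightarrow> monom x i \<in> graded_algebra R \<longleftrightarrow> x \<in> R i"
  by (auto simp: graded_algebra_def)

text \<open>The generators have bounded degree, hence lie in the algebra with carrying stopped at \<open>s\<close>.\<close>
lemma finite_type_imp_stable:
  fixes A :: "'a::field set"
  assumes A: "is_subring A" "k \<subseteq> A" and b: "2 \<le> b"
    and L: "\<And>\<alpha>. is_submodule A (L \<alpha>)" and carry: "\<And>\<alpha>. spow A (L \<alpha>) b \<subseteq> L (Suc \<alpha>)"
    and fg: "fin_gen_algebra ((\<lambda>c. [:c:]) ` k) (graded_algebra (digit_prods A b L))"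
  shows "\<exists>s0. \<forall>s\<ge>s0. L (Suc s) \<subseteq> spow A (L s) b"
proof -
  let ?R = "digit_prods A b L"
  obtain S where S: "finite S" "graded_algebra ?R = is_subring hull ((\<lambda>c. [:c:]) ` k \<union> S)"
    using fg unfolding fin_gen_algebra_def by blast
  have SR: "S \<subseteq> graded_algebra ?R" unfolding S(2) by (auto intro: hull_inc)
  define s0 where "s0 = Max (insert 0 (degree ` S))"
  have s0: "degree p \<le> s0" if "p \<in> S" for p unfolding s0_def using S(1) that by simp
  have "x \<in> spow A (L s) b" if "s0 \<le> s" and x: "x \<in> L (Suc s)" for s x
  proof -
    let ?G = "trunc_prod A b L s"
    have G0: "0 \<in> ?G i" for i by (rule submodule_0[OF submodule_trunc_prod[OF A(1) b]])
    have "is_subring (graded_algebra ?G)"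
      by (rule subring_graded_algebra[OF A(1)])
        (simp_all add: submodule_trunc_prod[OF A(1) b] trunc_prod_zero[OF A(1) b]
          trunc_prod_mult[OF A(1) b, of L] L carry)
    moreover have "(\<lambda>c. [:c:]) ` k \<union> S \<subseteq> graded_algebra ?G"
    proof (intro Un_least)
      show "(\<lambda>c. [:c:]) ` k \<subseteq> graded_algebra ?G"
        using A b G0 by (auto simp: graded_algebra_def coeff_pCons split: nat.split)
      show "S \<subseteq> graded_algebra ?G"
        unfolding graded_algebra_def
      proof (intro subsetI CollectI allI)
        fix p i assume p: "p \<in> S"
        show "coeff p i \<in> ?G i"
        proof (cases "i \<le> degree p")
          case True
          \<comment> \<open>Degrees of generators are below \<open>b ^ Suc s\<close>, hence have no
            digit with index above s, and stopping the carry at s changes nothing.\<close>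
          then have "i \<le> s" using s0[OF p] \<open>s0 \<le> s\<close> by linarith
          also have "s < b ^ s" by (rule less_power[OF b])
          also have "\<dots> \<le> b ^ Suc s" using b by (intro power_increasing) auto
          finally have "?R i = ?G i" by (rule digit_prods_eq_trunc[OF A(1) b])
          then show ?thesis using SR p unfolding graded_algebra_def by blast
        next
          case False
          then show ?thesis using G0 by (simp add: coeff_eq_0)
        qed
      qed
    qed
    ultimately have "graded_algebra ?R \<subseteq> graded_algebra ?G" unfolding S(2) by (rule subring_hull_least)
    \<comment> \<open>Degree \<open>b ^ Suc s\<close> tells the two algebras apart: the full product
      is \<open>L (Suc s)\<close>, the truncated one is the b-th power of
      \<open>L s\<close>.\<close>
    moreover have "monom x (b ^ Suc s) \<in> graded_algebra ?R"
      using x submodule_0[OF submodule_digit_prod[OF A(1) b]]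
      by (subst monom_graded_algebra) (simp_all only: digit_prods_power[OF A(1) b, of L] L)
    ultimately have "x \<in> ?G (b ^ Suc s)" using G0 by (auto simp: monom_graded_algebra)
    moreover have "digit_prod A b L s (b ^ Suc s) = A"
      using digit_prod_mod[OF A(1) b, of L s "b ^ Suc s"] A(1) b by simp
    moreover have "b ^ Suc s div b ^ s = b" using b by simp
    ultimately show ?thesis
      using A(1) by (simp add: trunc_prod_def smul_unit_left subringD)
  qed
  then show ?thesis by blast
qed

text \<open>
  \<open>W q\<close> is the saturation of \<open>L\<^sub>n\<^sup>q\<close> with respect to \<open>M\<close>. By uniformity of the exponent, the members of
  \<open>R\<close> in degrees divisible by \<open>b\<^sup>n\<close> have a common denominator over the Rees algebra of \<open>L\<^sub>n\<close>, so that they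
  form a finite module over it.
\<close>
lemma stable_imp_finite_type:
  fixes A :: "'a::field set"
  assumes k: "is_subfield k" and A: "affine_algebra k A" and b: "2 \<le> b"
    and L: "\<And>\<alpha>. fractional_ideal A (L \<alpha>)" and carry: "\<And>\<alpha>. spow A (L \<alpha>) b \<subseteq> L (Suc \<alpha>)"
    and M: "fractional_ideal A M" "g \<in> M" "g \<noteq> 0"
    and sat: "\<And>j x. x \<in> L (n + j) \<Longrightarrow>
      \<exists>p. \<forall>z\<in>spow A M p. x * z \<in> smul A (spow A M p) (spow A (L n) (b ^ j))"
  shows "fin_gen_algebra ((\<lambda>c. [:c:]) ` k) (graded_algebra (digit_prods A b L))"
proof -
  have AR: "is_subring A" using A by (rule affine_algebra_subring)
  have one: "1 \<in> A" by (rule subring_1[OF AR])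
  have AN: "noeth A" using k A by (rule noeth_affine_algebra)
  have Lmod: "is_submodule A (L \<alpha>)" for \<alpha> using L[of \<alpha>] by (simp add: fractional_ideal_def)
  let ?R = "digit_prods A b L" and ?L = "L n"
  \<comment> \<open>The part of R in degrees divisible by \<open>b ^ n\<close>, regraded so that
    \<open>L n\<close> has degree 1.\<close>
  define R' where "R' q = ?R (q * b ^ n)" for q
  have R'_eq: "R' q = digit_prods A b (\<lambda>\<alpha>. L (n + \<alpha>)) q" for q
    unfolding R'_def by (rule digit_prods_multiple[OF AR b])
  have Rmod [simp]: "is_submodule A (?R i)" for i by (rule submodule_digit_prod[OF AR b])
  have R'mod [simp]: "is_submodule A (R' i)" for i by (simp add: R'_def)
  have Rmult: "smul A (?R i) (?R j) \<subseteq> ?R (i + j)" for i j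
    by (rule digit_prods_mult[OF AR b]) (rule Lmod carry)+
  have Rpow: "?R (b ^ t) = L t" for t
    by (rule digit_prods_power[OF AR b]) (rule Lmod)
  obtain SA where SA: "finite SA" "A = is_subring hull (k \<union> SA)"
    using A unfolding affine_algebra_def fin_gen_algebra_def by blast
  obtain SL where SL: "finite SL" "?L = mspan A SL" by (rule fractional_ideal_fin_gen[OF AN L])
  obtain SM where SM: "finite SM" "M = mspan A SM" by (rule fractional_ideal_fin_gen[OF AN M(1)])
  let ?E = "\<lambda>m N. smul A (spow A ?L m) (spow A M N)"
  obtain N0 where N0: "\<And>m N y p. N0 \<le> N \<Longrightarrow> (\<And>z. z \<in> spow A M p \<Longrightarrow> y * z \<in> ?E m (N + p)) \<Longrightarrow> y \<in> ?E m N"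
    using saturation_exponent[OF k SA(2) SL(2) SM(2) SA(1) SL(1) SM(1) M(2,3)]
    unfolding bigraded_def[OF k SA(2) SL(2) SM(2) SA(1) SL(1) SM(1)] by blast
  define W where "W q = {x. \<exists>p. \<forall>z\<in>spow A M p. x * z \<in> ?E q p}" for q
  have Wprod: "x * y \<in> W (q + q')" if "x \<in> W q" "y \<in> W q'" for x y q q'
  proof -
    obtain p where p: "\<forall>z\<in>spow A M p. x * z \<in> ?E q p" using \<open>x \<in> W q\<close> unfolding W_def by blast
    obtain p' where p': "\<forall>z\<in>spow A M p'. y * z \<in> ?E q' p'" using \<open>y \<in> W q'\<close> unfolding W_def by blast
    have "spow A M (p + p') \<subseteq> {z. \<forall>u\<in>{x * y}. z * u \<in> ?E (q + q') (p + p')}"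
      unfolding spow_add[OF AR, of M]
    proof (rule smul_least[OF submodule_transporter])
      fix z z' assume "z \<in> spow A M p" "z' \<in> spow A M p'"
      then have "(x * z) * (y * z') \<in> smul A (?E q p) (?E q' p')" using p p' by - (rule smulI, auto)
      then show "z * z' \<in> {z. \<forall>u\<in>{x * y}. z * u \<in>
          smul A (spow A ?L (q + q')) (smul A (spow A M p) (spow A M p'))}"
        unfolding spow_add[OF AR, of ?L] by (simp add: smul_ac mult_ac)
    qed simp
    then have "\<forall>z\<in>spow A M (p + p'). x * y * z \<in> ?E (q + q') (p + p')"
      by (auto simp: mult.commute)
    then show ?thesis unfolding W_def by blast
  qed
  have EA: "A \<subseteq> W 0"
    unfolding W_def
    by (auto intro!: exI[of _ 0] subring_mult[OF AR] simp: smul_unit_left[OF one submodule_subring] AR)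
  have W0: "0 \<in> W q" for q unfolding W_def using submodule_0[OF submodule_smul] by auto
  have Wadd: "x + y \<in> W q" if xy: "x \<in> W q" "y \<in> W q" for x y q
  proof -
    have up: "\<exists>p. \<forall>d. \<forall>z\<in>spow A M (p + d). x * z \<in> ?E q (p + d)" if "x \<in> W q" for x
    proof -
      obtain p where p: "\<forall>z\<in>spow A M p. x * z \<in> ?E q p" using \<open>x \<in> W q\<close> unfolding W_def by blast
      have "\<forall>z\<in>spow A M (p + d). x * z \<in> ?E q (p + d)" for d
      proof -
        have "spow A M (p + d) \<subseteq> {z. \<forall>u\<in>{x}. z * u \<in> ?E q (p + d)}"
          unfolding spow_add[OF AR]
        proof (rule smul_least[OF submodule_transporter])
          fix z z' assume "z \<in> spow A M p" "z' \<in> spow A M d"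
          then have "(x * z) * z' \<in> smul A (?E q p) (spow A M d)" using p by - (rule smulI, auto)
          then show "z * z' \<in> {z. \<forall>u\<in>{x}. z * u \<in> smul A (spow A ?L q) (smul A (spow A M p) (spow A M d))}"
            by (simp add: smul_ac mult_ac)
        qed simp
        then show ?thesis by (auto simp: mult.commute)
      qed
      then show ?thesis by blast
    qed
    obtain p where p: "\<And>d z. z \<in> spow A M (p + d) \<Longrightarrow> x * z \<in> ?E q (p + d)" using up[OF xy(1)] by blast
    obtain p' where p': "\<And>d z. z \<in> spow A M (p' + d) \<Longrightarrow> y * z \<in> ?E q (p' + d)" using up[OF xy(2)] by blast
    have "(x + y) * z \<in> ?E q (p + p')" if "z \<in> spow A M (p + p')" for z
      using p[of z p'] p'[of z p] that submodule_add[OF submodule_smul]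
      by (simp add: distrib_right add.commute)
    then show ?thesis unfolding W_def by blast
  qed
  have Wmod: "is_submodule A (W q)" for q
    using W0 Wadd Wprod[of _ 0 _ q] EA by (intro submoduleI) auto
  have R'W: "R' q \<subseteq> W q" for q
  proof -
    have "q < b ^ Suc q" using less_power[OF b, of q] power_increasing[of q "Suc q" b] b by linarith
    then have "R' q = trunc_prod A b (\<lambda>\<alpha>. L (n + \<alpha>)) q q"
      unfolding R'_eq by (rule digit_prods_eq_trunc[OF AR b])
    also have "\<dots> \<subseteq> W q"
    proof (rule trunc_prod_least[OF AR b, where W = W])
      show "smul A (W p) (W q) \<subseteq> W (p + q)" for p q by (rule smul_least[OF Wmod Wprod])
      show "L (n + \<alpha>) \<subseteq> W (b ^ \<alpha>)" for \<alpha>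
        using sat unfolding W_def by (auto simp: smul_commute)
    qed (use Wmod EA in auto)
    finally show ?thesis .
  qed
  obtain d where d: "d \<noteq> 0" "\<And>x. x \<in> spow A M N0 \<Longrightarrow> d * x \<in> A"
    using fractional_ideal_spow[OF AR M(1), of N0] unfolding fractional_ideal_def by blast
  \<comment> \<open>\<open>g ^ N0\<close> lifts a member of \<open>R' q\<close> to degree N0 in M,
    where saturation places it in \<open>?E q N0\<close>; d then clears the denominators of
    \<open>spow A M N0\<close>. Neither factor depends on q.\<close>
  define h where "h = d * g ^ N0"
  have h0: "h \<noteq> 0" using d(1) M(3) by (simp add: h_def)
  have hR': "h * x \<in> spow A ?L q" if x: "x \<in> R' q" for x q
  proof -
    obtain p where p: "\<forall>z\<in>spow A M p. x * z \<in> ?E q p" using x R'W unfolding W_def by blast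
    have "g ^ N0 * x \<in> ?E q N0"
    proof (rule N0[of N0 p])
      fix z assume "z \<in> spow A M p"
      then have "g ^ N0 * (x * z) \<in> smul A (spow A M N0) (?E q p)"
        using p power_in_spow[OF AR M(2)] by - (rule smulI, auto)
      then show "g ^ N0 * x * z \<in> ?E q (N0 + p)"
        unfolding spow_add[OF AR] by (simp add: smul_ac mult_ac)
    qed simp
    moreover have "?E q N0 \<subseteq> {u. \<forall>y\<in>{d}. u * y \<in> spow A ?L q}"
    proof (rule smul_least[OF submodule_transporter[OF submodule_spow[OF AR]]])
      fix u v assume "u \<in> spow A ?L q" "v \<in> spow A M N0"
      then have "(d * v) * u \<in> spow A ?L q" using d(2) by (intro submodule_scale[OF submodule_spow[OF AR]])
      then show "u * v \<in> {u. \<forall>y\<in>{d}. u * y \<in> spow A ?L q}" by (simp add: mult_ac)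
    qed
    ultimately show ?thesis by (auto simp: h_def mult_ac)
  qed
  have LR': "u * x \<in> R' (m + q)" if u: "u \<in> spow A ?L m" and x: "x \<in> R' q" for u x m q
  proof -
    have "spow A ?L m \<subseteq> R' m" for m
    proof (induction m)
      case 0
      then show ?case by (simp add: R'_eq)
    next
      case (Suc m)
      have "?L = R' 1" using Rpow[of n] by (simp add: R'_def)
      then have "smul A (spow A ?L m) ?L \<subseteq> smul A (R' m) (R' 1)" using Suc by (intro smul_mono) auto
      also have "\<dots> \<subseteq> R' (Suc m)" using Rmult[of "m * b ^ n" "b ^ n"] by (simp add: R'_def add.commute)
      finally show ?case by simp
    qed
    then have "u * x \<in> smul A (R' m) (R' q)" using u x by - (rule smulI, auto)
    then show ?thesis using Rmult[of "m * b ^ n" "q * b ^ n"] by (auto simp: R'_def distrib_right)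
  qed
  have "\<exists>C. finite C \<and> (\<forall>(m, c)\<in>C. c \<in> R' m) \<and>
      (\<forall>q. R' q \<subseteq> mspan A {c * w | m c w. (m, c) \<in> C \<and> m \<le> q \<and> w \<in> spow A ?L (q - m)})"
  proof -
    \<comment> \<open>With M = {0} all positive outer degrees vanish, and the bigraded algebra
      becomes the Rees algebra of \<open>L n\<close> alone.\<close>
    have zero: "{0} = mspan A ({} :: 'a set)" by simp
    note inst = k SA(2) SL(2) zero SA(1) SL(1) finite.emptyI
    let ?T = "bigraded_algebra A ?L {0}"
    have TD: "coeff (coeff t N) m \<in> smul A (spow A ?L m) (spow A {0} N)" if "t \<in> ?T" for t N m
      using that unfolding bigraded_algebra_def[OF inst] bigraded_def[OF inst] by blast
    have T0: "coeff (coeff t N) m = (0::'a)" if "t \<in> ?T" "N \<noteq> 0" for t N m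
      using TD[OF that(1), of N m] that(2) by (cases N) auto
    have T1: "coeff (coeff t 0) m \<in> spow A ?L m" if "t \<in> ?T" for t m
      using TD[OF that, of 0 m] by (simp add: smul_unit_right one AR)
    \<comment> \<open>h times the module R', placed in outer degree 0; by the choice of h this is an
      ideal of the noetherian algebra.\<close>
    define Z where "Z = {p::'a poly poly. \<forall>N m. coeff (coeff p N) m \<in> (if N = 0 then (*) h ` R' m else {0})}"
    have hR'mod: "is_submodule A (if N = 0 then (*) h ` R' m else {0})" for N m :: nat
      using submodule_scale_image[OF R'mod] submodule_mspan[of A "{}"] by simp
    have ZD: "coeff (coeff p N) m \<in> (if N = 0 then (*) h ` R' m else {0})" if "p \<in> Z" for p N m
      using that unfolding Z_def by blast
    have "Z \<subseteq> ?T"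
    proof
      fix p assume p: "p \<in> Z"
      have "coeff (coeff p N) m \<in> smul A (spow A ?L m) (spow A {0} N)" for N m
      proof (cases "N = 0")
        case True
        have "coeff (coeff p N) m \<in> (*) h ` R' m" using ZD[OF p, of N m] True by simp
        then show ?thesis using hR' True by (auto simp: smul_unit_right one AR)
      next
        case False
        then have "coeff (coeff p N) m = 0" using ZD[OF p, of N m] by simp
        then show ?thesis using submodule_0[OF submodule_smul] by simp
      qed
      then show "p \<in> ?T" unfolding bigraded_algebra_def[OF inst] bigraded_def[OF inst] by blast
    qed
    moreover have "is_submodule ?T Z"
    proof (rule submoduleI)
      show "0 \<in> Z" unfolding Z_def using submodule_0[OF hR'mod] by simp
      show "p + q \<in> Z" if "p \<in> Z" "q \<in> Z" for p q
        using that submodule_add[OF hR'mod] unfolding Z_def by (simp del: if_split_mem1 split del: if_split)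
      fix t p assume t: "t \<in> ?T" and p: "p \<in> Z"
      show "t * p \<in> Z"
        unfolding Z_def
      proof (intro CollectI allI coeff_mult_bigraded[OF inst hR'mod])
        fix N m N1 N2 m1 m2 :: nat assume N: "N1 + N2 = N" and m: "m1 + m2 = m"
        have p2: "coeff (coeff p N2) m2 \<in> (if N2 = 0 then (*) h ` R' m2 else {0})"
          by (rule ZD[OF p])
        show "coeff (coeff t N1) m1 * coeff (coeff p N2) m2 \<in> (if N = 0 then (*) h ` R' m else {0})"
        proof (cases "N = 0")
          case True
          then have N12: "N1 = 0" "N2 = 0" using N by auto
          obtain x where x: "x \<in> R' m2" "coeff (coeff p 0) m2 = h * x" using p2 N12 by auto
          have "coeff (coeff t 0) m1 * x \<in> R' m" using LR'[OF T1[OF t, of m1] x(1)] m by simp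
          then show ?thesis using True N12 x(2) by (auto simp: mult_ac intro!: image_eqI)
        next
          case False
          then have "N1 \<noteq> 0 \<or> N2 \<noteq> 0" using N by auto
          then show ?thesis using T0[OF t] p2 False by auto
        qed
      qed
    qed
    ultimately obtain G where G: "finite G" "Z = mspan ?T G"
      using noeth_bigraded_algebra[OF inst] unfolding noeth_def by meson
    have GZ: "G \<subseteq> Z" using G(2) by (auto intro: hull_inc)
    \<comment> \<open>The homogeneous components of the ideal generators, divided by h again,
      generate R' over the Rees algebra.\<close>
    define C where "C = (\<Union>p\<in>G. (\<lambda>m. (m, inverse h * coeff (coeff p 0) m)) ` {..degree (coeff p 0)})"
    have Cmem: "c \<in> R' m" if "(m, c) \<in> C" for m c
    proof -
      obtain p where p: "p \<in> G" "c = inverse h * coeff (coeff p 0) m" using \<open>(m, c) \<in> C\<close> unfolding C_def by auto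
      have "coeff (coeff p 0) m \<in> (*) h ` R' m" using ZD[of p 0 m] GZ p(1) by auto
      then show ?thesis using p(2) h0 by (auto simp flip: mult.assoc)
    qed
    define Y where "Y q = mspan A {c * w | m c w. (m, c) \<in> C \<and> m \<le> q \<and> w \<in> spow A ?L (q - m)}" for q
    have Ymod: "is_submodule A (Y q)" for q by (simp add: Y_def)
    define X where "X = {p::'a poly poly. \<forall>m. inverse h * coeff (coeff p 0) m \<in> Y m}"
    have "is_submodule ?T X"
    proof (rule submoduleI)
      show "0 \<in> X" unfolding X_def using submodule_0[OF Ymod] by simp
      show "p + q \<in> X" if "p \<in> X" "q \<in> X" for p q
        using that submodule_add[OF Ymod] unfolding X_def by (simp add: distrib_left)
      fix t p assume t: "t \<in> ?T" and p: "p \<in> X"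
      have "coeff (coeff (t * p) 0) m \<in> {u. \<forall>y\<in>{inverse h}. u * y \<in> Y m}" for m
      proof (rule coeff_mult_bigraded[OF inst submodule_transporter[OF Ymod]])
        fix N1 N2 m1 m2 :: nat assume N: "N1 + N2 = 0" and m: "m1 + m2 = m"
        have "inverse h * coeff (coeff p 0) m2 \<in> Y m2" using p unfolding X_def by blast
        then have "inverse h * coeff (coeff p 0) m2 * coeff (coeff t 0) m1 \<in> Y m"
          unfolding Y_def[of m2]
        proof (rule mspan_transport[OF _ Ymod])
          fix x assume "x \<in> {c * w | m c w. (m, c) \<in> C \<and> m \<le> m2 \<and> w \<in> spow A ?L (m2 - m)}"
          then obtain m' c w where x: "x = c * w" "(m', c) \<in> C" "m' \<le> m2" "w \<in> spow A ?L (m2 - m')" by blast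
          have "w * coeff (coeff t 0) m1 \<in> spow A ?L (m2 - m' + m1)"
            by (rule spow_in_add[OF AR x(4) T1[OF t]])
          moreover have "m2 - m' + m1 = m - m'" using x(3) m by simp
          moreover have "m' \<le> m" using x(3) m by simp
          ultimately have "c * (w * coeff (coeff t 0) m1) \<in> Y m"
            unfolding Y_def using x(2) by (intro hull_inc) auto
          then show "x * coeff (coeff t 0) m1 \<in> Y m" unfolding x(1) by (simp add: mult.assoc)
        qed
        then show "coeff (coeff t N1) m1 * coeff (coeff p N2) m2 \<in> {u. \<forall>y\<in>{inverse h}. u * y \<in> Y m}"
          using N by (simp add: mult_ac)
      qed
      then show "t * p \<in> X" unfolding X_def by (auto simp: mult.commute)
    qed
    moreover have "G \<subseteq> X"
    proof
      fix p assume p: "p \<in> G"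
      have "inverse h * coeff (coeff p 0) m \<in> Y m" for m
      proof (cases "m \<le> degree (coeff p 0)")
        case True
        then have mem: "(m, inverse h * coeff (coeff p 0) m) \<in> C" unfolding C_def using p by blast
        have "inverse h * coeff (coeff p 0) m * 1 \<in> Y m"
          unfolding Y_def
          by (rule hull_inc, intro CollectI exI[of _ m] exI[of _ "inverse h * coeff (coeff p 0) m"] exI[of _ 1])
             (use mem one in simp)
        then show ?thesis by simp
      next
        case False
        then show ?thesis using submodule_0[OF Ymod] by (simp add: coeff_eq_0)
      qed
      then show "p \<in> X" unfolding X_def by blast
    qed
    ultimately have ZX: "Z \<subseteq> X" unfolding G(2) by (rule mspan_least)
    have "x \<in> Y q" if x: "x \<in> R' q" for x q
    proof -
      have "coeff (coeff (monom (monom (h * x) q) 0) N) m \<in> (if N = 0 then (*) h ` R' m else {0})" for N m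
        using imageI[OF x, of "(*) h"] submodule_0[OF hR'mod, of N m] by (cases "N = 0"; cases "m = q") simp_all
      then have "monom (monom (h * x) q) 0 \<in> Z" unfolding Z_def by blast
      then have "monom (monom (h * x) q) 0 \<in> X" using ZX by blast
      then have "inverse h * (h * x) \<in> Y q" unfolding X_def by (auto dest!: spec[of _ q])
      then show ?thesis using h0 by (simp flip: mult.assoc)
    qed
    moreover have "finite C" unfolding C_def using G(1) by auto
    ultimately show ?thesis using Cmem unfolding Y_def by blast
  qed
  then obtain C where C: "finite C" "\<And>m c. (m, c) \<in> C \<Longrightarrow> c \<in> R' m"
    "\<And>q. R' q \<subseteq> mspan A {c * w | m c w. (m, c) \<in> C \<and> m \<le> q \<and> w \<in> spow A ?L (q - m)}"
    by blast
  have "fractional_ideal A (digit_prod A b L s i)" for s i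
    by (induction s) (simp_all add: fractional_ideal_ring fractional_ideal_smul fractional_ideal_spow AR L)
  then have "\<exists>S. finite S \<and> ?R i = mspan A S" for i using fractional_ideal_fin_gen[OF AN] by metis
  then obtain SR where SR: "\<And>i. finite (SR i)" "\<And>i. ?R i = mspan A (SR i)" by metis
  \<comment> \<open>Generators of A, of the degrees below \<open>b ^ n\<close>, of
    \<open>L n\<close> in its degree \<open>b ^ n\<close>, and of R' as a module over the Rees
    algebra of \<open>L n\<close>.\<close>
  let ?gens = "(\<lambda>a. monom a 0) ` SA \<union> (\<Union>c<b ^ n. (\<lambda>x. monom x c) ` SR c) \<union>
    (\<lambda>l. monom l (b ^ n)) ` SL \<union> (\<lambda>(m, c). monom c (m * b ^ n)) ` C"
  define H where "H = is_subring hull ((\<lambda>c. [:c:]) ` k \<union> ?gens)"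
  have H: "is_subring H" by (simp add: H_def)
  have inc: "(\<lambda>c. [:c:]) ` k \<union> ?gens \<subseteq> H" unfolding H_def by (rule hull_subset)
  have incR: "monom x c \<in> H" if "c < b ^ n" "x \<in> SR c" for x c
  proof -
    have "monom x c \<in> (\<Union>c<b ^ n. (\<lambda>x. monom x c) ` SR c)" using that by blast
    then show ?thesis using inc by blast
  qed
  have incL: "monom l (b ^ n) \<in> H" if "l \<in> SL" for l using inc that by blast
  have incC: "monom c (m * b ^ n) \<in> H" if "(m, c) \<in> C" for m c using inc that by force
  have R0: "0 \<in> ?R i" for i by (rule submodule_0[OF Rmod])
  have "is_subring {a. monom a 0 \<in> H}"
    unfolding is_subring_def
  proof (intro conjI ballI, goal_cases)
    case 1
    show ?case using subring_1[OF H] by (simp add: monom_0 one_pCons[symmetric])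
  next
    case (2 x y)
    then show ?case using subring_diff[OF H, of "monom x 0" "monom y 0"] by (simp add: diff_monom)
  next
    case (3 x y)
    then show ?case using subring_mult[OF H, of "monom x 0" "monom y 0"] by (simp add: mult_monom)
  qed
  moreover have "k \<union> SA \<subseteq> {a. monom a 0 \<in> H}" using inc by (auto simp: monom_0)
  ultimately have AH: "monom a 0 \<in> H" if "a \<in> A" for a
    using that subring_hull_least[of "{a. monom a 0 \<in> H}" "k \<union> SA"] SA(2) by blast
  have sub: "is_submodule A {x. monom x i \<in> H}" for i
  proof (rule submoduleI)
    show "0 \<in> {x. monom x i \<in> H}" using subring_0[OF H] by simp
  next
    fix x y assume "x \<in> {x. monom x i \<in> H}" "y \<in> {x. monom x i \<in> H}"
    then show "x + y \<in> {x. monom x i \<in> H}"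
      using subring_add[OF H, of "monom x i" "monom y i"] by (simp add: add_monom)
  next
    fix a x assume "a \<in> A" "x \<in> {x. monom x i \<in> H}"
    then show "a * x \<in> {x. monom x i \<in> H}"
      using subring_mult[OF H AH, of a "monom x i"] by (simp add: mult_monom)
  qed
  have lowH: "?R c \<subseteq> {x. monom x c \<in> H}" if "c < b ^ n" for c
    unfolding SR(2) using incR that by (intro mspan_least sub) blast
  have "L n \<subseteq> {x. monom x (b ^ n) \<in> H}" unfolding SL(2) using incL by (intro mspan_least sub) blast
  then have LH: "spow A ?L e \<subseteq> {x. monom x (e * b ^ n) \<in> H}" for e
  proof (induction e)
    case 0
    then show ?case using AH by auto
  next
    case (Suc e)
    show ?case
      unfolding spow.simps
    proof (rule smul_least[OF sub])
      fix x y assume "x \<in> spow A ?L e" "y \<in> ?L"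
      then have "monom x (e * b ^ n) \<in> H" "monom y (b ^ n) \<in> H" using Suc by auto
      from subring_mult[OF H this] show "x * y \<in> {x. monom x (Suc e * b ^ n) \<in> H}"
        by (simp add: mult_monom add.commute)
    qed
  qed
  have R'H: "R' q \<subseteq> {x. monom x (q * b ^ n) \<in> H}" for q
  proof (rule order_trans[OF C(3) mspan_least[OF sub]], clarify)
    fix m c w assume mc: "(m, c) \<in> C" "m \<le> q" "w \<in> spow A ?L (q - m)"
    then have "monom c (m * b ^ n) \<in> H" "monom w ((q - m) * b ^ n) \<in> H" using incC LH by auto
    from subring_mult[OF H this] have "monom (c * w) (m * b ^ n + (q - m) * b ^ n) \<in> H"
      by (simp add: mult_monom)
    also have "m * b ^ n + (q - m) * b ^ n = q * b ^ n" using mc(2) by (simp flip: distrib_right)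
    finally show "monom (c * w) (q * b ^ n) \<in> H" .
  qed
  have RH: "?R i \<subseteq> {x. monom x i \<in> H}" for i
  proof -
    have "?R i = smul A (?R (i mod b ^ n)) (R' (i div b ^ n))"
      unfolding R'_eq by (rule digit_prods_split[OF AR b])
    also have "\<dots> \<subseteq> {x. monom x i \<in> H}"
    proof (rule smul_least[OF sub])
      fix x y assume x: "x \<in> ?R (i mod b ^ n)" and y: "y \<in> R' (i div b ^ n)"
      have "i mod b ^ n < b ^ n" using b by simp
      then have "monom x (i mod b ^ n) \<in> H" "monom y (i div b ^ n * b ^ n) \<in> H"
        using x y lowH R'H by auto
      from subring_mult[OF H this] have "monom (x * y) (i mod b ^ n + i div b ^ n * b ^ n) \<in> H"
        by (simp only: mult_monom)
      also have "i mod b ^ n + i div b ^ n * b ^ n = i" by (rule mod_div_mult_eq)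
      finally show "x * y \<in> {x. monom x i \<in> H}" by simp
    qed
    finally show ?thesis .
  qed
  have "graded_algebra ?R \<subseteq> H"
  proof
    fix p assume "p \<in> graded_algebra ?R"
    then have "(\<Sum>i\<le>degree p. monom (coeff p i) i) \<in> H"
      by (intro subring_sum[OF H] subsetD[OF RH, THEN CollectD]) (simp add: graded_algebra_def)
    then show "p \<in> H" by (simp add: poly_as_sum_of_monoms)
  qed
  moreover have "H \<subseteq> graded_algebra ?R"
    unfolding H_def
  proof (rule subring_hull_least)
    show "is_subring (graded_algebra ?R)"
      by (rule subring_graded_algebra[OF AR Rmod _ Rmult]) simp
    have mon: "monom x i \<in> graded_algebra ?R" if "x \<in> ?R i" for x i
      using that R0 by (simp add: monom_graded_algebra)
    have "SA \<subseteq> ?R 0" "k \<subseteq> ?R 0" unfolding digit_prod.simps SA(2) by (auto intro: hull_inc)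
    then have "(\<lambda>c. [:c:]) ` k \<subseteq> graded_algebra ?R" "(\<lambda>a. monom a 0) ` SA \<subseteq> graded_algebra ?R"
      unfolding monom_0[symmetric] using mon by blast+
    moreover have "SR c \<subseteq> ?R c" for c unfolding SR(2) by (rule hull_subset)
    then have "(\<Union>c<b ^ n. (\<lambda>x. monom x c) ` SR c) \<subseteq> graded_algebra ?R" using mon by blast
    moreover have "SL \<subseteq> ?R (b ^ n)" unfolding Rpow SL(2) by (rule hull_subset)
    then have "(\<lambda>l. monom l (b ^ n)) ` SL \<subseteq> graded_algebra ?R" using mon by blast
    moreover have "c \<in> ?R (m * b ^ n)" if "(m, c) \<in> C" for m c using C(2)[OF that] by (simp add: R'_def)
    then have "(\<lambda>(m, c). monom c (m * b ^ n)) ` C \<subseteq> graded_algebra ?R" using mon by force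
    ultimately show "(\<lambda>c. [:c:]) ` k \<union> ?gens \<subseteq> graded_algebra ?R" by (intro Un_least)
  qed
  ultimately have "graded_algebra ?R = H" by (rule equalityI)
  moreover have "finite ?gens" using SA(1) SL(1) SR(1) C(1) by auto
  ultimately show ?thesis
    unfolding fin_gen_algebra_def H_def by (intro exI[of _ ?gens] conjI)
qed

section \<open>Changing the affine open set\<close>

lemma affine_modelD:
  assumes "is_subring A" "P \<in> affine_model A"
  shows affine_model_local: "is_local_subring P" and affine_model_subring: "is_subring P"
    and affine_model_subset: "A \<subseteq> P"
  using assms affine_model_iff[OF assms(1)] by (auto simp: local_subring)

lemma affine_model_fraction:
  assumes "is_subring A" "P \<in> affine_model A" "x \<in> P"
  obtains a s where "a \<in> A" "s \<in> A" "s \<noteq> 0" "inverse s \<in> P" "x = a / s"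
  using assms affine_model_iff[OF assms(1)] by blast

lemma mspan_affine_model_denominator:
  assumes A: "is_subring A" and P: "P \<in> affine_model A" and X: "is_submodule A X"
    and "y \<in> mspan P X"
  shows "\<exists>t\<in>A. t \<noteq> 0 \<and> inverse t \<in> P \<and> t * y \<in> X"
  using assms(4)
proof (rule hull_induct)
  have PR: "is_subring P" by (rule affine_model_subring[OF A P])
  show "\<exists>t\<in>A. t \<noteq> 0 \<and> inverse t \<in> P \<and> t * y \<in> X" if "y \<in> X" for y
    using that subring_1[OF A] subring_1[OF PR] by (intro bexI[of _ 1]) auto
  show "is_submodule P {y. \<exists>t\<in>A. t \<noteq> 0 \<and> inverse t \<in> P \<and> t * y \<in> X}"
  proof (rule submoduleI)
    show "0 \<in> {y. \<exists>t\<in>A. t \<noteq> 0 \<and> inverse t \<in> P \<and> t * y \<in> X}"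
      using submodule_0[OF X] subring_1[OF A] subring_1[OF PR] by (auto intro!: bexI[of _ 1])
  next
    fix y z assume "y \<in> {y. \<exists>t\<in>A. t \<noteq> 0 \<and> inverse t \<in> P \<and> t * y \<in> X}"
      "z \<in> {y. \<exists>t\<in>A. t \<noteq> 0 \<and> inverse t \<in> P \<and> t * y \<in> X}"
    then obtain s t where s: "s \<in> A" "s \<noteq> 0" "inverse s \<in> P" "s * y \<in> X"
      and t: "t \<in> A" "t \<noteq> 0" "inverse t \<in> P" "t * z \<in> X" by blast
    have "t * (s * y) + s * (t * z) \<in> X"
      by (intro submodule_add[OF X] submodule_scale[OF X] s t)
    then have "(s * t) * (y + z) \<in> X" by (simp add: algebra_simps)
    moreover have "inverse (s * t) \<in> P" using subring_mult[OF PR s(3) t(3)] by simp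
    ultimately show "y + z \<in> {y. \<exists>t\<in>A. t \<noteq> 0 \<and> inverse t \<in> P \<and> t * y \<in> X}"
      using s t subring_mult[OF A s(1) t(1)] by (intro CollectI bexI[of _ "s * t"]) auto
  next
    fix a y assume a: "a \<in> P" and "y \<in> {y. \<exists>t\<in>A. t \<noteq> 0 \<and> inverse t \<in> P \<and> t * y \<in> X}"
    then obtain s where s: "s \<in> A" "s \<noteq> 0" "inverse s \<in> P" "s * y \<in> X" by blast
    obtain c t where t: "c \<in> A" "t \<in> A" "t \<noteq> 0" "inverse t \<in> P" "a = c / t"
      by (rule affine_model_fraction[OF A P a])
    have "c * (s * y) \<in> X" by (intro submodule_scale[OF X] s t)
    moreover have "c * (s * y) = (s * t) * (a * y)" using t by simp
    moreover have "inverse (s * t) \<in> P" using subring_mult[OF PR s(3) t(4)] by simp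
    ultimately show "a * y \<in> {y. \<exists>t\<in>A. t \<noteq> 0 \<and> inverse t \<in> P \<and> t * y \<in> X}"
      using s t subring_mult[OF A s(1) t(2)] by (intro CollectI bexI[of _ "s * t"]) auto
  qed
qed

lemma mspan_mono_mspan: "P \<subseteq> Q \<Longrightarrow> mspan P X = mspan P Y \<Longrightarrow> mspan Q X = mspan Q Y"
  by (metis mspan_mspan)

lemma gen_by_cong: "mspan Q X = mspan Q Y \<Longrightarrow> gen_by Q X f \<longleftrightarrow> gen_by Q Y f"
  by (simp add: gen_by_def)

lemma gen_by_mono: "P \<subseteq> Q \<Longrightarrow> gen_by P X f \<Longrightarrow> gen_by Q X f"
  using mspan_mono_mspan unfolding gen_by_def by metis

lemma gen_by_unit:
  assumes Q: "is_subring Q" and s: "gen_by Q X s" and t: "t \<in> Q" "t \<noteq> 0" "inverse t \<in> Q"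
  shows "gen_by Q X (t * s)"
proof -
  have "s \<in> mspan Q X" using s by (auto simp: gen_by_def intro: hull_inc)
  then have "t * s \<in> mspan Q X" by (rule submodule_scale[OF submodule_mspan t(1)])
  moreover have "x / (t * s) \<in> Q" if "x \<in> X" for x
    using subring_mult[OF Q t(3) gen_by_divide'[OF Q s that]] by (simp add: field_simps)
  ultimately show ?thesis using gen_by_nonzero[OF s] t(2) by (intro gen_byI[OF Q]) auto
qed

text \<open>B and B' share the local ring P, so the powers of F and F' span the same P-modules.
  Numerator and denominator over B move into a power of F' after multiplication by t and u, which
  are units of P and hence of Q.\<close>

lemma blow_local_change:
  assumes B: "is_subring B" "is_subring B'" and P: "P \<in> affine_model B" "P \<in> affine_model B'"
    and F: "mspan P F = mspan P F'" and PQ: "P \<subseteq> Q" and b: "blow B F Q"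
  shows "blow B' F' Q"
  unfolding blow_def
proof (intro conjI ballI)
  have PR: "is_subring P" by (rule affine_model_subring[OF B(1) P(1)])
  have QR: "is_subring Q" by (rule blow_subring[OF b])
  have BP: "B \<subseteq> P" "B' \<subseteq> P" using affine_model_subset B P by blast+
  show "is_local_subring Q" by (rule blow_local[OF b])
  show "B' \<subseteq> Q" using BP PQ by blast
  obtain f where "gen_by Q F f" using b by (rule blow_obtain)
  then have "gen_by Q F' f" using gen_by_cong[OF mspan_mono_mspan[OF PQ F]] by blast
  then show "\<exists>f\<in>F'. gen_by Q F' f" using gen_by_obtain[OF blow_local[OF b]] by blast
  fix z assume "z \<in> Q"
  with b obtain N a s where as: "a \<in> spow B F N" "s \<in> spow B F N" "gen_by Q (spow B F N) s" "z = a / s"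
    by (rule blow_fraction)
  let ?X = "spow B' F' N"
  have PX: "mspan P (spow B F N) = mspan P ?X"
    using B F by (simp add: mspan_spow[OF PR BP(1)] mspan_spow[OF PR BP(2)] subring_1 del: spow_mspan)
  have X: "is_submodule B' ?X" by (rule submodule_spow[OF B(2)])
  have "a \<in> mspan P ?X" "s \<in> mspan P ?X" using as PX by (auto intro: hull_inc)
  then obtain t u where t: "t \<in> B'" "t \<noteq> 0" "inverse t \<in> P" "t * a \<in> ?X"
    and u: "u \<in> B'" "u \<noteq> 0" "inverse u \<in> P" "u * s \<in> ?X"
    using mspan_affine_model_denominator[OF B(2) P(2) X] by meson
  have "u * (t * a) \<in> ?X" "t * (u * s) \<in> ?X" by (intro submodule_scale[OF X] t u)+
  moreover have "gen_by Q ?X (t * (u * s))"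
  proof -
    have "gen_by Q ?X s" using as(3) gen_by_cong[OF mspan_mono_mspan[OF PQ PX]] by blast
    then show ?thesis using t u BP PQ by (intro gen_by_unit[OF QR]) auto
  qed
  moreover have "z = (u * (t * a)) / (t * (u * s))" using as(4) t(2) u(2) by simp
  ultimately show "\<exists>N. \<exists>a\<in>spow B' F' N. \<exists>s\<in>spow B' F' N. gen_by Q (spow B' F' N) s \<and> z = a / s"
    by blast
qed

lemma affine_algebra_hull:
  assumes A: "affine_algebra k A" and T: "finite T"
  shows "affine_algebra k (is_subring hull (A \<union> T))"
proof -
  obtain S where S: "finite S" "A = is_subring hull (k \<union> S)"
    using A unfolding affine_algebra_def fin_gen_algebra_def by blast
  have "is_subring hull (A \<union> T) = is_subring hull (k \<union> (S \<union> T))"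
    unfolding S(2) by (simp add: Un_assoc hull_Un_left[symmetric])
  then have "fin_gen_algebra k (is_subring hull (A \<union> T))"
    unfolding fin_gen_algebra_def using S(1) T by (intro exI[of _ "S \<union> T"]) simp
  moreover have "A \<subseteq> is_subring hull (A \<union> T)" by (auto intro: hull_inc)
  ultimately show ?thesis using A unfolding affine_algebra_def by blast
qed

lemma affine_algebra_chart:
  assumes k: "is_subfield k" and A: "affine_algebra k A" and J: "fractional_ideal A J"
  shows "affine_algebra k (chart A J x)"
proof -
  obtain S where S: "finite S" "J = mspan A S"
    using fractional_ideal_fin_gen[OF noeth_affine_algebra[OF k A] J] .
  define B where "B = is_subring hull (A \<union> (\<lambda>g. g / x) ` S)"
  have BR: "is_subring B" by (simp add: B_def)
  have AB: "A \<subseteq> B" and SB: "\<And>g. g \<in> S \<Longrightarrow> g / x \<in> B" unfolding B_def by (auto intro: hull_inc)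
  have "g * inverse x \<in> B" if "g \<in> J" for g
    using that unfolding S(2)
    by (rule mspan_transport[OF _ subring_submodule[OF BR AB]]) (use SB in \<open>simp add: divide_inverse\<close>)
  then have "chart A J x \<subseteq> B"
    unfolding chart_def using AB BR by (intro subring_hull_least) (auto simp: divide_inverse)
  moreover have "(\<lambda>g. g / x) ` S \<subseteq> chart A J x"
    using divide_in_chart[of _ J x A] hull_subset[of S "is_submodule A"] unfolding S(2) by blast
  then have "B \<subseteq> chart A J x"
    unfolding B_def by (intro subring_hull_least subring_chart Un_least ring_subset_chart)
  ultimately have "chart A J x = B" by (rule equalityI)
  then show ?thesis unfolding B_def using affine_algebra_hull[OF A] S(1) by simp
qed

lemma affine_opensD:
  assumes "A \<in> affine_opens k V"
  shows affine_opens_algebra: "affine_algebra k A" and affine_opens_subring: "is_subring A"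
    and affine_opens_const: "k \<subseteq> A" and affine_opens_model: "affine_model A \<subseteq> V"
proof -
  show A: "affine_algebra k A" and "affine_model A \<subseteq> V"
    using assms unfolding affine_opens_def by blast+
  show "is_subring A" "k \<subseteq> A" using affine_algebra_subring[OF A] affine_algebra_const[OF A] .
qed

text \<open>The generators of A' lie in P and have a common denominator s in A that is a unit of P,
  so adjoining its inverse to A gives a ring that contains A' and still has P as a local ring.
  Restriction is given along inclusions of affine opens, hence comparing I over A and A' calls for
  such a ring.\<close>

lemma affine_model_common_open:
  assumes A: "A \<in> affine_opens k V" "A' \<in> affine_opens k V"
    and P: "P \<in> affine_model A" "P \<in> affine_model A'"
  obtains C where "C \<in> affine_opens k V" "A \<subseteq> C" "A' \<subseteq> C" "P \<in> affine_model C"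
proof -
  have AR: "is_subring A" and A'R: "is_subring A'" using A affine_opens_subring by blast+
  have PR: "is_subring P" by (rule affine_model_subring[OF AR P(1)])
  have AP: "A \<subseteq> P" by (rule affine_model_subset[OF AR P(1)])
  have A'P: "A' \<subseteq> P" by (rule affine_model_subset[OF A'R P(2)])
  obtain S where S: "finite S" "A' = is_subring hull (k \<union> S)"
    using affine_opens_algebra[OF A(2)] unfolding affine_algebra_def fin_gen_algebra_def by blast
  have SP: "S \<subseteq> P" using A'P S(2) by (auto intro: hull_inc)
  have "\<exists>s\<in>A. s \<noteq> 0 \<and> inverse s \<in> P \<and> (\<forall>x\<in>T. s * x \<in> A)" if "T \<subseteq> S" for T
    using finite_subset[OF that S(1)] that
  proof (induction T)
    case empty
    then show ?case using subring_1[OF AR] subring_1[OF PR] by (intro bexI[of _ 1]) auto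
  next
    case (insert x T)
    then obtain s where s: "s \<in> A" "s \<noteq> 0" "inverse s \<in> P" "\<forall>x\<in>T. s * x \<in> A" by blast
    have "x \<in> P" using insert.prems SP by blast
    then obtain a t where t: "a \<in> A" "t \<in> A" "t \<noteq> 0" "inverse t \<in> P" "x = a / t"
      by (rule affine_model_fraction[OF AR P(1)])
    have "s * t * y \<in> A" if y: "y \<in> insert x T" for y
    proof (cases "y = x")
      case True
      then show ?thesis using t s subring_mult[OF AR s(1) t(1)] by simp
    next
      case False
      then have "s * y \<in> A" using y s(4) by blast
      then have "t * (s * y) \<in> A" by (rule subring_mult[OF AR t(2)])
      then show ?thesis by (simp add: mult_ac)
    qed
    moreover have "inverse (s * t) \<in> P" using subring_mult[OF PR s(3) t(4)] by simp
    ultimately show ?case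
      using s t subring_mult[OF AR s(1) t(2)] by (intro bexI[of _ "s * t"]) auto
  qed
  then obtain s where s: "s \<in> A" "s \<noteq> 0" "inverse s \<in> P" "\<forall>x\<in>S. s * x \<in> A" by blast
  define C where "C = is_subring hull (A \<union> {inverse s})"
  have CR: "is_subring C" by (simp add: C_def)
  have AC: "A \<subseteq> C" and sC: "inverse s \<in> C" unfolding C_def by (auto intro: hull_inc)
  have CP: "C \<subseteq> P" unfolding C_def using AP s(3) PR by (intro subring_hull_least) auto
  have "x \<in> C" if "x \<in> S" for x
  proof -
    have "s * x \<in> C" using s(4) that AC by blast
    from subring_mult[OF CR sC this] show ?thesis using s(2) by (simp flip: mult.assoc)
  qed
  then have "k \<union> S \<subseteq> C" using affine_opens_const[OF A(1)] AC by blast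
  then have A'C: "A' \<subseteq> C" unfolding S(2) by (intro subring_hull_least CR)
  have clear: "\<exists>n. s ^ n * c \<in> A" if "c \<in> C" for c
  proof -
    have up: "s ^ (n + m) * c \<in> A" if "s ^ n * c \<in> A" for n m c
      using subring_mult[OF AR subring_power[OF AR s(1), of m] that] by (simp add: power_add mult_ac)
    have "is_subring {c. \<exists>n. s ^ n * c \<in> A}"
      unfolding is_subring_def
    proof (intro conjI ballI)
      show "1 \<in> {c. \<exists>n. s ^ n * c \<in> A}" using subring_1[OF AR] by (auto intro!: exI[of _ 0])
      fix x y assume "x \<in> {c. \<exists>n. s ^ n * c \<in> A}" "y \<in> {c. \<exists>n. s ^ n * c \<in> A}"
      then obtain n m where nm: "s ^ n * x \<in> A" "s ^ m * y \<in> A" by blast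
      have "s ^ (n + m) * x - s ^ (m + n) * y \<in> A" by (intro subring_diff[OF AR] up nm)
      then have "s ^ (n + m) * (x - y) \<in> A" by (simp add: right_diff_distrib add.commute)
      then show "x - y \<in> {c. \<exists>n. s ^ n * c \<in> A}" by blast
      have "s ^ (n + m) * (x * y) \<in> A" using subring_mult[OF AR nm] by (simp add: power_add mult_ac)
      then show "x * y \<in> {c. \<exists>n. s ^ n * c \<in> A}" by blast
    qed
    moreover have "A \<union> {inverse s} \<subseteq> {c. \<exists>n. s ^ n * c \<in> A}"
    proof -
      have "s ^ 1 * inverse s \<in> A" using s(2) subring_1[OF AR] by simp
      moreover have "s ^ 0 * a \<in> A" if "a \<in> A" for a using that by simp
      ultimately show ?thesis by blast
    qed
    ultimately have "C \<subseteq> {c. \<exists>n. s ^ n * c \<in> A}" unfolding C_def by (rule subring_hull_least)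
    then show ?thesis using that by blast
  qed
  have "affine_model C \<subseteq> affine_model A"
  proof
    fix Q assume Q: "Q \<in> affine_model C"
    have QR: "is_subring Q" and CQ: "C \<subseteq> Q"
      using affine_model_subring[OF CR Q] affine_model_subset[OF CR Q] by blast+
    have "\<exists>a\<in>A. \<exists>t\<in>A. t \<noteq> 0 \<and> inverse t \<in> Q \<and> x = a / t" if "x \<in> Q" for x
    proof -
      obtain c d where cd: "c \<in> C" "d \<in> C" "d \<noteq> 0" "inverse d \<in> Q" "x = c / d"
        using affine_model_fraction[OF CR Q \<open>x \<in> Q\<close>] .
      obtain n m where nm: "s ^ n * c \<in> A" "s ^ m * d \<in> A" using clear cd by meson
      let ?a = "s ^ m * (s ^ n * c)" and ?t = "s ^ n * (s ^ m * d)"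
      have "?a \<in> A" "?t \<in> A" using nm subring_mult[OF AR subring_power[OF AR s(1)]] by blast+
      moreover have "?t \<noteq> 0" "x = ?a / ?t" using cd s(2) by (simp_all add: mult.left_commute)
      moreover have "inverse s ^ n * (inverse s ^ m * inverse d) \<in> Q"
        using sC CQ cd(4) by (intro subring_mult[OF QR] subring_power[OF QR]) auto
      then have "inverse ?t \<in> Q" by (simp add: power_inverse)
      ultimately show ?thesis by blast
    qed
    then show "Q \<in> affine_model A"
      using affine_model_iff[OF AR] affine_model_local[OF CR Q] AC CQ by blast
  qed
  then have "C \<in> affine_opens k V"
    using affine_algebra_hull[OF affine_opens_algebra[OF A(1)], of "{inverse s}"] affine_opens_model[OF A(1)]
    unfolding affine_opens_def C_def by blast
  moreover have "P \<in> affine_model C"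
    unfolding affine_model_iff[OF CR]
  proof (intro conjI ballI)
    fix x assume "x \<in> P"
    then obtain a t where "a \<in> A" "t \<in> A" "t \<noteq> 0" "inverse t \<in> P" "x = a / t"
      by (rule affine_model_fraction[OF AR P(1)])
    then show "\<exists>a\<in>C. \<exists>t\<in>C. t \<noteq> 0 \<and> inverse t \<in> P \<and> x = a / t" using AC by blast
  qed (use affine_model_local[OF AR P(1)] CP in auto)
  ultimately show thesis using that AC A'C by blast
qed

lemma dominates_trans: "dominates P Q \<Longrightarrow> dominates Q R \<Longrightarrow> dominates P R"
  unfolding dominates_def by blast

section \<open>The Gauss tower\<close>

context
  fixes k :: "'a::field_char_0 set" and V :: "'a set set" and \<delta>s :: "('a \<Rightarrow> 'a) list"
    and I :: "'a sheaf"
  assumes k: "is_subfield k" and V: "variety k V" and \<delta>s: "\<forall>\<delta>\<in>set \<delta>s. derivation k \<delta>"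
    and I: "nonzero_ideal_sheaf k V I"
begin

private abbreviation (input) J :: "nat \<Rightarrow> 'a sheaf" where "J \<equiv> J_sheaf \<delta>s I"
private abbreviation (input) L :: "nat \<Rightarrow> 'a sheaf" where "L \<equiv> L_sheaf \<delta>s I"
private abbreviation (input) opens :: "'a set set" where "opens \<equiv> affine_opens k V"
private abbreviation (input) b :: nat where "b \<equiv> length \<delta>s + 2"

lemma L_eq: "L i A = F_mod \<delta>s A (J i A)"
  unfolding L_sheaf_def by (rule F_sheaf_eq_F_mod)

lemma sheaf_mult_eq: "sheaf_mult X Y A = smul A (X A) (Y A)"
  by (simp add: sheaf_mult_def smul_def)

lemma sheaf_pow_eq: "sheaf_pow X n A = spow A (X A) n"
  by (induction n) (simp_all add: structure_sheaf_def sheaf_mult_eq)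

lemma J_Suc: "J (Suc i) A = smul A (J i A) (L i A)"
  by (simp add: sheaf_mult_eq L_sheaf_def)

lemma ideal_sheaf_ideal: "A \<in> opens \<Longrightarrow> I A \<subseteq> A \<and> is_submodule A (I A)"
  using conjunct1[OF I[unfolded nonzero_ideal_sheaf_def]] by (rule bspec)

lemma ideal_sheaf_restrict:
  "A \<in> opens \<Longrightarrow> C \<in> opens \<Longrightarrow> A \<subseteq> C \<Longrightarrow> I C = mspan C (I A)"
  by (rule conjunct1[OF conjunct2[OF I[unfolded nonzero_ideal_sheaf_def]],
        THEN bspec, THEN bspec, THEN mp])

lemma fractional_ideal_J:
  assumes A: "A \<in> opens"
  shows "fractional_ideal A (J i A)"
proof (induction i)
  case 0
  show ?case using fractional_ideal_ideal[OF affine_opens_subring[OF A]] ideal_sheaf_ideal[OF A] by simp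
next
  case (Suc i)
  show ?case
    unfolding J_Suc L_eq
    by (rule fractional_ideal_smul[OF affine_opens_subring[OF A] Suc
          fractional_ideal_F_mod[OF \<delta>s affine_opens_algebra[OF A] Suc]])
qed

lemma fractional_ideal_L: "A \<in> opens \<Longrightarrow> fractional_ideal A (L i A)"
  unfolding L_eq by (rule fractional_ideal_F_mod[OF \<delta>s affine_opens_algebra fractional_ideal_J])

lemma submodule_J: "A \<in> opens \<Longrightarrow> is_submodule A (J i A)"
  using fractional_ideal_J unfolding fractional_ideal_def by blast

lemma submodule_L: "A \<in> opens \<Longrightarrow> is_submodule A (L i A)"
  by (simp add: L_eq)

text \<open>The case M = F(J) of \<open>F_mod_smul_spow\<close>: r + 1 factors from scaling and F(J)
  itself make up the exponent r + 2.\<close>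

lemma natural_inclusion:
  assumes A: "A \<in> opens"
  shows "spow A (L i A) b \<subseteq> L (Suc i) A"
  using F_mod_smul_spow[OF k \<delta>s affine_opens_subring[OF A] affine_opens_const[OF A] submodule_L[OF A], of "J i A" i]
  unfolding L_eq[of "Suc i"] J_Suc
  by (simp add: L_eq smul_commute[of A _ "F_mod \<delta>s A (J i A)"])

lemma R_sheaf_eq: "R_sheaf \<delta>s I i A = digit_prods A b (\<lambda>\<alpha>. L \<alpha> A) i"
proof -
  have "foldl sheaf_mult structure_sheaf
      (map (\<lambda>\<alpha>. sheaf_pow (L_sheaf \<delta>s I \<alpha>) (i div b ^ \<alpha> mod b)) [0..<s]) A =
    digit_prod A b (\<lambda>\<alpha>. L \<alpha> A) s i" for s
    by (induction s) (simp_all add: structure_sheaf_def sheaf_mult_eq sheaf_pow_eq)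
  then show ?thesis unfolding R_sheaf_def Let_def .
qed

lemma R_algebra_eq: "R_algebra \<delta>s I A = graded_algebra (digit_prods A b (\<lambda>\<alpha>. L \<alpha> A))"
  unfolding R_algebra_def graded_algebra_def R_sheaf_eq ..

lemma natural_map_iso_iff:
  "natural_map_iso k V \<delta>s (J t) \<longleftrightarrow> (\<forall>A\<in>opens. spow A (L t A) b = L (Suc t) A)"
  unfolding natural_map_iso_def sheaf_pow_eq L_sheaf_def by simp

text \<open>Compatibility with restriction is given for I. It propagates to J_i at the level of
  local rings, since products and F commute with localization and the stalk of J_(i+1) is therefore
  determined by that of J_i.\<close>

lemma stalk_J_eq:
  assumes A: "A \<in> opens" "A' \<in> opens" and P: "P \<in> affine_model A" "P \<in> affine_model A'"
  shows "mspan P (J i A) = mspan P (J i A')"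
proof (induction i)
  case 0
  obtain C where C: "C \<in> opens" "A \<subseteq> C" "A' \<subseteq> C" "P \<in> affine_model C"
    by (rule affine_model_common_open[OF A P])
  have CP: "C \<subseteq> P" by (rule affine_model_subset[OF affine_opens_subring[OF C(1)] C(4)])
  have "I C = mspan C (I A)" "I C = mspan C (I A')"
    using ideal_sheaf_restrict A C(1-3) by blast+
  then have "mspan P (mspan C (I A)) = mspan P (mspan C (I A'))" by simp
  then show ?case by (simp add: mspan_mspan[OF CP])
next
  case (Suc i)
  have "mspan P (J (Suc i) B) = smul P (mspan P (J i B)) (F_mod \<delta>s P (mspan P (J i B)))"
    if "B \<in> opens" "P \<in> affine_model B" for B
    using F_mod_affine_model[OF \<delta>s affine_opens_subring that(2) submodule_J] that
      mspan_smul[OF affine_model_subset[OF affine_opens_subring that(2)]]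
    unfolding J_Suc L_eq by metis
  from this[OF A(1) P(1)] this[OF A(2) P(2)] show ?case unfolding Suc by metis
qed

lemma stalk_L_eq:
  assumes A: "A \<in> opens" "A' \<in> opens" and P: "P \<in> affine_model A" "P \<in> affine_model A'"
  shows "mspan P (L i A) = mspan P (L i A')"
proof -
  have "mspan P (L i B) = F_mod \<delta>s P (mspan P (J i B))" if "B \<in> opens" "P \<in> affine_model B" for B
    using F_mod_affine_model[OF \<delta>s affine_opens_subring that(2) submodule_J] that unfolding L_eq by metis
  then show ?thesis using stalk_J_eq[OF A P, of i] A P by simp
qed

text \<open>Separatedness enters here: the centre on \<open>V\<close> of a local ring does not depend on the chart.\<close>
lemma common_centre:
  assumes A: "A \<in> opens" "A' \<in> opens" and Q: "is_local_subring Q" "A \<subseteq> Q" "is_local_subring Q'" "A' \<subseteq> Q'"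
    and dom: "dominates Q Q'"
  obtains P where "P \<in> affine_model A" "P \<in> affine_model A'" "P \<subseteq> Q'"
proof -
  obtain P where P: "P \<in> affine_model A" "dominates Q P"
    by (rule affine_model_localize[OF affine_opens_subring[OF A(1)] Q(1,2)])
  obtain P' where P': "P' \<in> affine_model A'" "dominates Q' P'"
    by (rule affine_model_localize[OF affine_opens_subring[OF A(2)] Q(3,4)])
  have "P \<in> V" "P' \<in> V"
    using P(1) P'(1) affine_opens_model[OF A(1)] affine_opens_model[OF A(2)] by auto
  moreover have "is_local_subring Q \<and> dominates Q P \<and> dominates Q P'"
    using Q(1) P(2) dominates_trans[OF dom P'(2)] by blast
  ultimately have "P = P'"
    by (rule conjunct2[OF V[unfolded variety_def], THEN bspec, THEN bspec, THEN spec, THEN mp])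
  then show thesis using that P P' unfolding dominates_def by blast
qed

section \<open>The Gauss tower as blowups of the J_i\<close>

definition tower :: "nat \<Rightarrow> 'a set set" where
  "tower i = {Q. \<exists>A\<in>opens. blow A (J i A) Q}"

lemma blowup_eq_blow: "blowup k X F = {Q. \<exists>A\<in>affine_opens k X. blow A (F A) Q}"
  unfolding blowup_def chart_def[symmetric] set_eq_iff UN_iff mem_Collect_eq
  by (intro allI bex_cong refl blow_iff_chart[OF affine_opens_subring, symmetric])

text \<open>
  On the chart \<open>A[X/x]\<close> the ideal \<open>X\<close> is generated by \<open>x\<close>, so that \<open>F(X)\<close> becomes \<open>x\<^bsup>r+1\<^esup>\<close> times
  \<open>\<Lambda>\<^sup>r\<Omega>\<close>: the Gauss blowup of the blowup of \<open>X\<close> is the blowup of \<open>X F(X)\<close>.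
\<close>
lemma F_mod_chart_ring:
  assumes A: "is_subring A" and J: "is_submodule A X" and x: "x \<in> X" "x \<noteq> 0"
  shows "(*) (x ^ Suc (length \<delta>s)) ` F_mod \<delta>s (chart A X x) (chart A X x) =
    mspan (chart A X x) (F_mod \<delta>s A X)"
proof -
  let ?B = "chart A X x"
  have "mspan ?B X = (*) x ` ?B"
  proof
    have "X \<subseteq> (*) x ` ?B"
    proof
      fix h assume "h \<in> X"
      then have "h / x \<in> ?B" "h = x * (h / x)" using divide_in_chart x(2) by auto
      then show "h \<in> (*) x ` ?B" by blast
    qed
    then show "mspan ?B X \<subseteq> (*) x ` ?B"
      by (intro mspan_least submodule_scale_image submodule_subring subring_chart)
    have "mspan ?B {x} \<subseteq> mspan ?B X" using x(1) by (intro hull_mono) simp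
    then show "(*) x ` ?B \<subseteq> mspan ?B X" by (simp add: mspan_single)
  qed
  then show ?thesis using F_mod_chart[OF \<delta>s A J x] F_mod_scale[OF \<delta>s, where A = ?B and g = x and J = ?B] by simp
qed

text \<open>Over the chart B of X, F(B) is the B-span of F(X) divided by x^(r+1), so its quotients
  by y / x^(r+1) are the l / y with l in that span. The generators of the other chart factor
  accordingly as (j l) / (x y) = (j / x) (l / y).\<close>

lemma iterated_chart:
  assumes A: "is_subring A" and X: "is_submodule A X" and x: "x \<in> X" "x \<noteq> 0"
    and y: "y \<in> F_mod \<delta>s A X" "y \<noteq> 0"
  shows "chart (chart A X x) (F_mod \<delta>s (chart A X x) (chart A X x)) (y / x ^ Suc (length \<delta>s)) =
    chart A (smul A X (F_mod \<delta>s A X)) (x * y)"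
proof
  let ?B = "chart A X x" and ?w = "x ^ Suc (length \<delta>s)" and ?Y = "F_mod \<delta>s A X"
  let ?F = "F_mod \<delta>s ?B ?B"
  let ?C = "chart A (smul A X ?Y) (x * y)" and ?D = "chart ?B ?F (y / ?w)"
  have w: "?w \<noteq> 0" using x(2) by simp
  have F: "(*) ?w ` ?F = mspan ?B ?Y" by (rule F_mod_chart_ring[OF A X x])
  have CR: "is_subring ?C" and DR: "is_subring ?D" by simp_all
  have BC: "?B \<subseteq> ?C"
    unfolding chart_def[of A X x]
  proof (intro subring_hull_least CR Un_least ring_subset_chart subsetI)
    fix u assume "u \<in> {g / x | g. g \<in> X}"
    then obtain g where g: "g \<in> X" "u = g / x" by blast
    have "(g * y) / (x * y) \<in> ?C" by (intro divide_in_chart smulI g y)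
    then show "u \<in> ?C" using g y(2) by simp
  qed
  have YC: "v * inverse y \<in> ?C" if "v \<in> mspan ?B ?Y" for v
    using that
  proof (rule mspan_transport[OF _ subring_submodule[OF CR BC]])
    fix l assume l: "l \<in> ?Y"
    have "(x * l) / (x * y) \<in> ?C" by (intro divide_in_chart smulI l x)
    then show "l * inverse y \<in> ?C" using x(2) by (simp flip: divide_inverse)
  qed
  show "?D \<subseteq> ?C"
    unfolding chart_def[of ?B]
  proof (intro subring_hull_least CR Un_least BC subsetI)
    fix u assume "u \<in> {g / (y / ?w) | g. g \<in> ?F}"
    then obtain g where g: "g \<in> ?F" "u = g / (y / ?w)" by blast
    have "?w * g \<in> mspan ?B ?Y" using F g(1) by blast
    then have "(?w * g) * inverse y \<in> ?C" by (rule YC)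
    then show "u \<in> ?C" using g(2) by (simp add: divide_inverse mult_ac)
  qed
  have BD: "?B \<subseteq> ?D" by (rule ring_subset_chart)
  have AD: "A \<subseteq> ?D" using ring_subset_chart BD by blast
  show "?C \<subseteq> ?D"
    unfolding chart_def[of A "smul A X ?Y"]
  proof (intro subring_hull_least DR Un_least AD)
    have "smul A X ?Y \<subseteq> {g. \<forall>z\<in>{inverse (x * y)}. g * z \<in> ?D}"
    proof (rule smul_least[OF submodule_transporter[OF subring_submodule[OF DR AD]]])
      fix j l assume j: "j \<in> X" and l: "l \<in> ?Y"
      have "l \<in> (*) ?w ` ?F" unfolding F using l by (rule hull_inc)
      then obtain u where u: "u \<in> ?F" "l = ?w * u" by blast
      have "j / x \<in> ?D" using divide_in_chart[OF j] BD by blast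
      moreover have "u / (y / ?w) \<in> ?D" by (rule divide_in_chart[OF u(1)])
      ultimately have "(j / x) * (u / (y / ?w)) \<in> ?D" by (rule subring_mult[OF DR])
      moreover have "(j / x) * (u / (y / ?w)) = (j * l) * inverse (x * y)"
        using u(2) by (simp add: divide_inverse mult_ac)
      ultimately show "j * l \<in> {g. \<forall>z\<in>{inverse (x * y)}. g * z \<in> ?D}" by simp
    qed
    then show "{g / (x * y) | g. g \<in> smul A X ?Y} \<subseteq> ?D" by (auto simp: divide_inverse)
  qed
qed

text \<open>By \<open>F_mod_ring\<close> the Gauss blowup is a blowup along F of the structure
  sheaf, and \<open>iterated_chart\<close> identifies its charts. Starting from V_(i+1), a single
  chart of J_i suffices; starting from the Gauss blowup, the affine open of V_i is arbitrary and
  must first be replaced by such a chart.\<close>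

lemma gauss_blowup_tower: "gauss_blowup k \<delta>s (tower i) = tower (Suc i)"
proof -
  let ?r1 = "Suc (length \<delta>s)"
  have "gauss_blowup k \<delta>s (tower i) = {Q. \<exists>B\<in>affine_opens k (tower i). blow B (F_mod \<delta>s B B) Q}"
    unfolding gauss_blowup_def blowup_eq_blow
    using F_mod_ring[OF \<delta>s affine_opens_subring] by auto
  also have "\<dots> = tower (Suc i)"
  proof (intro equalityI subsetI)
    fix Q assume "Q \<in> tower (Suc i)"
    then obtain A where A: "A \<in> opens" and Q: "blow A (smul A (J i A) (F_mod \<delta>s A (J i A))) Q"
      unfolding tower_def J_Suc L_eq by blast
    let ?X = "J i A" and ?Y = "F_mod \<delta>s A (J i A)"
    have AR: "is_subring A" by (rule affine_opens_subring[OF A])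
    have QR: "is_subring Q" by (rule blow_subring[OF Q])
    obtain f where "gen_by Q (smul A ?X ?Y) f" using Q by (rule blow_obtain)
    then obtain x y where xy: "x \<in> ?X" "y \<in> ?Y" "gen_by Q ?X x" "gen_by Q ?Y y"
      by (rule gen_by_smul_factor[OF blow_local[OF Q] blow_subset[OF Q]])
    have nz: "x \<noteq> 0" "y \<noteq> 0" using xy gen_by_nonzero by blast+
    let ?B = "chart A ?X x" and ?F = "F_mod \<delta>s (chart A ?X x) (chart A ?X x)" and ?f = "y / x ^ ?r1"
    have B: "?B \<in> affine_opens k (tower i)"
      using affine_algebra_chart[OF k affine_opens_algebra[OF A] fractional_ideal_J[OF A]]
        affine_model_chart_iff[OF AR xy(1) nz(1)] A
      unfolding affine_opens_def tower_def by blast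
    have "gen_by Q (smul A ?X ?Y) (x * y)"
      by (rule gen_by_smul[OF QR blow_subset[OF Q] xy(3,4)])
    then have "Q \<in> affine_model (chart A (smul A ?X ?Y) (x * y))"
      using Q xy nz by (subst affine_model_chart_iff[OF AR smulI]) auto
    then have "Q \<in> affine_model (chart ?B ?F ?f)"
      unfolding iterated_chart[OF AR submodule_J[OF A] xy(1) nz(1) xy(2) nz(2)] .
    moreover have "?f \<in> ?F"
    proof -
      have "y \<in> (*) (x ^ ?r1) ` ?F"
        unfolding F_mod_chart_ring[OF AR submodule_J[OF A] xy(1) nz(1)] using xy(2) by (rule hull_inc)
      then show ?thesis using nz(1) by auto
    qed
    moreover have "?f \<noteq> 0" using nz by simp
    ultimately have "blow ?B ?F Q" using affine_model_chart_iff[OF subring_chart] by blast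
    then show "Q \<in> {Q. \<exists>B\<in>affine_opens k (tower i). blow B (F_mod \<delta>s B B) Q}" using B by blast
  next
    fix Q assume "Q \<in> {Q. \<exists>B\<in>affine_opens k (tower i). blow B (F_mod \<delta>s B B) Q}"
    then obtain B where B: "B \<in> affine_opens k (tower i)" and Q: "blow B (F_mod \<delta>s B B) Q" by blast
    have BR: "is_subring B" by (rule affine_opens_subring[OF B])
    have QR: "is_subring Q" by (rule blow_subring[OF Q])
    \<comment> \<open>At the centre P of Q the affine open B is traded for a chart of J_i, with
      which it shares the local ring P.\<close>
    obtain P where P: "P \<in> affine_model B" "dominates Q P"
      by (rule affine_model_localize[OF BR blow_local[OF Q] blow_subset[OF Q]])
    have PQ: "P \<subseteq> Q" using P(2) by (simp add: dominates_def)
    have "P \<in> tower i" using P(1) affine_opens_model[OF B] by blast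
    then obtain A where A: "A \<in> opens" and PA: "blow A (J i A) P" unfolding tower_def by blast
    let ?X = "J i A" and ?Y = "F_mod \<delta>s A (J i A)"
    have AR: "is_subring A" by (rule affine_opens_subring[OF A])
    obtain x where x: "x \<in> ?X" "gen_by P ?X x" using PA by (rule blow_obtain)
    have x0: "x \<noteq> 0" using x(2) by (rule gen_by_nonzero)
    let ?B = "chart A ?X x" and ?F = "F_mod \<delta>s (chart A ?X x) (chart A ?X x)"
    have PB: "P \<in> affine_model ?B" using affine_model_chart_iff[OF AR x(1) x0] PA x(2) by blast
    have span: "mspan P (F_mod \<delta>s C C) = F_mod \<delta>s P P" if C: "is_subring C" "P \<in> affine_model C" for C
    proof -
      have PR: "is_subring P" by (rule affine_model_subring[OF C])
      have "mspan P C = P"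
        using mspan_least[OF submodule_subring[OF PR] affine_model_subset[OF C]]
          mspan_one[OF PR] hull_mono[of "{1}" C "is_submodule P"] subring_1[OF C(1)] by auto
      then show ?thesis using F_mod_affine_model[OF \<delta>s C submodule_subring[OF C(1)]] by simp
    qed
    have Q': "blow ?B ?F Q"
      using span[OF BR P(1)] span[OF subring_chart PB]
      by (intro blow_local_change[OF BR subring_chart P(1) PB _ PQ Q]) simp
    have F: "(*) (x ^ ?r1) ` ?F = mspan ?B ?Y" by (rule F_mod_chart_ring[OF AR submodule_J[OF A] x(1) x0])
    have BQ: "?B \<subseteq> Q" by (rule blow_subset[OF Q'])
    have AQ: "A \<subseteq> Q" using ring_subset_chart BQ by blast
    obtain f where f: "f \<in> ?F" "gen_by Q ?F f" using Q' by (rule blow_obtain)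
    have scale: "gen_by Q ((*) c ` X) (c * g)" if "gen_by Q X g" "c \<noteq> 0" for c g X
    proof -
      have "mspan Q ((*) c ` X) = (*) c ` mspan Q {g}"
        using that unfolding gen_by_def mspan_scale_image by simp
      also have "\<dots> = mspan Q {c * g}" using mspan_scale_image[of Q c "{g}"] by simp
      finally show ?thesis using that by (simp add: gen_by_def)
    qed
    \<comment> \<open>The generator f of \<open>?F\<close> is replaced by one of the form y /
      x^(r+1) with y in \<open>?Y\<close>, as \<open>iterated_chart\<close> requires.\<close>
    have "gen_by Q (mspan ?B ?Y) (x ^ ?r1 * f)" using scale[OF f(2), of "x ^ ?r1"] x0 F by simp
    then have "gen_by Q ?Y (x ^ ?r1 * f)" by (simp only: gen_by_mspan[OF BQ])
    then obtain y where y: "y \<in> ?Y" "gen_by Q ?Y y" by (rule gen_by_obtain[OF blow_local[OF Q]])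
    have y0: "y \<noteq> 0" using y(2) by (rule gen_by_nonzero)
    let ?f = "y / x ^ ?r1"
    have fF: "?f \<in> ?F"
    proof -
      have "y \<in> (*) (x ^ ?r1) ` ?F" unfolding F using y(1) by (rule hull_inc)
      then show ?thesis using x0 by auto
    qed
    have inv: "Z = (*) (inverse c) ` (*) c ` Z" if "c \<noteq> 0" for c :: 'a and Z
      using that by (simp add: image_image flip: mult.assoc)
    have "x ^ ?r1 \<noteq> 0" using x0 by simp
    then have "?F = (*) (inverse (x ^ ?r1)) ` (*) (x ^ ?r1) ` ?F" by (rule inv)
    then have Feq: "?F = (*) (inverse (x ^ ?r1)) ` mspan ?B ?Y" unfolding F .
    have "gen_by Q (mspan ?B ?Y) y" using y(2) by (simp only: gen_by_mspan[OF BQ])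
    then have "gen_by Q ?F (inverse (x ^ ?r1) * y)"
      by (subst Feq) (rule scale, use x0 in auto)
    then have "gen_by Q ?F ?f" by (simp add: divide_inverse mult.commute)
    then have "Q \<in> affine_model (chart ?B ?F ?f)"
      using affine_model_chart_iff[OF subring_chart fF] Q' gen_by_nonzero by blast
    then have "Q \<in> affine_model (chart A (smul A ?X ?Y) (x * y))"
      unfolding iterated_chart[OF AR submodule_J[OF A] x(1) x0 y(1) y0] .
    then have "blow A (smul A ?X ?Y) Q"
      using x0 y0 by (subst (asm) affine_model_chart_iff[OF AR smulI[OF x(1) y(1)]]) auto
    then show "Q \<in> tower (Suc i)" unfolding tower_def J_Suc L_eq using A by blast
  qed
  finally show ?thesis .
qed

lemma gauss_tower_eq: "gauss_tower k \<delta>s V I i = tower i"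
proof (induction i)
  case 0
  then show ?case by (simp add: blowup_eq_blow tower_def)
next
  case (Suc i)
  then show ?case by (simp add: gauss_blowup_tower)
qed

section \<open>The three implications\<close>

lemma natural_map_iso_imp_stable:
  assumes t: "\<And>A. A \<in> opens \<Longrightarrow> spow A (L t A) b = L (Suc t) A"
  shows "\<forall>i\<ge>Suc t. tower (Suc i) = tower i"
proof -
  have "blow A (J (Suc (Suc t)) A) Q \<longleftrightarrow> blow A (J (Suc t) A) Q" if A: "A \<in> opens" for A Q
  proof -
    have AR: "is_subring A" by (rule affine_opens_subring[OF A])
    let ?X = "J t A" and ?Y = "L t A"
    have J2: "J (Suc (Suc t)) A = smul A (smul A ?X ?Y) (spow A ?Y b)"
      unfolding J_Suc[of "Suc t"] J_Suc[of t] t[OF A, symmetric] ..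
    show ?thesis
      unfolding J2 J_Suc[of t]
    proof
      assume Q: "blow A (smul A ?X ?Y) Q"
      obtain f where "gen_by Q (smul A ?X ?Y) f" using Q by (rule blow_obtain)
      then obtain y where y: "y \<in> ?Y" "gen_by Q ?Y y"
        by (rule gen_by_smul_factor[OF blow_local[OF Q] blow_subset[OF Q]])
      show "blow A (smul A (smul A ?X ?Y) (spow A ?Y b)) Q"
        by (rule blow_smul[OF AR Q power_in_spow[OF AR y(1)]
          gen_by_spow[OF blow_subring[OF Q] blow_subset[OF Q] subring_1[OF AR] y(2)]])
    next
      assume Q: "blow A (smul A (smul A ?X ?Y) (spow A ?Y b)) Q"
      note QL = blow_local[OF Q] and QR = blow_subring[OF Q] and AQ = blow_subset[OF Q]
      obtain f where "gen_by Q (smul A (smul A ?X ?Y) (spow A ?Y b)) f" using Q by (rule blow_obtain)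
      then obtain g where "gen_by Q (smul A ?X ?Y) g" by (rule gen_by_smul_factor[OF QL AQ])
      then obtain x where x: "x \<in> ?X" "gen_by Q ?X x" by (rule gen_by_smul_factor[OF QL AQ])
      \<comment> \<open>X Y^(b+1) is completed to a power: multiplication by X^b, which is principal
        at Q, gives (X Y)^(b+1), and powers of an ideal have the same blowup.\<close>
      have "blow A (smul A (smul A (smul A ?X ?Y) (spow A ?Y b)) (spow A ?X b)) Q"
        by (rule blow_smul[OF AR Q power_in_spow[OF AR x(1)]
          gen_by_spow[OF QR AQ subring_1[OF AR] x(2)]])
      moreover have "smul A (smul A (smul A ?X ?Y) (spow A ?Y b)) (spow A ?X b) = spow A (smul A ?X ?Y) (Suc b)"
        unfolding spow.simps spow_smul[OF AR] by (simp only: smul_ac)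
      ultimately have "blow A (spow A (smul A ?X ?Y) (Suc b)) Q" by simp
      then show "blow A (smul A ?X ?Y) Q" by (rule blow_spow_iff[OF AR zero_less_Suc, THEN iffD1])
    qed
  qed
  then have start: "tower (Suc (Suc t)) = tower (Suc t)" unfolding tower_def by blast
  \<comment> \<open>Each stage is a function of the preceding one, so two equal consecutive stages
    make all later ones equal.\<close>
  have "tower (Suc (Suc t + d)) = tower (Suc t + d)" for d
  proof (induction d)
    case (Suc d)
    have "tower (Suc (Suc t + Suc d)) = gauss_blowup k \<delta>s (tower (Suc (Suc t + d)))"
      by (simp add: gauss_blowup_tower)
    also have "\<dots> = gauss_blowup k \<delta>s (tower (Suc t + d))" by (simp only: Suc)
    finally show ?case by (simp add: gauss_blowup_tower)
  qed (use start in simp)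
  then show ?thesis by (metis le_Suc_ex)
qed

text \<open>Stability comes with an index depending on the affine open. The maximum over a finite
  cover serves all of V, because the inclusion can be tested on local rings and every local ring of
  A occurs in the cover.\<close>

lemma finite_type_imp_natural_map_iso:
  assumes R: "R_finite_type k V \<delta>s I"
  shows "\<exists>t. \<forall>A\<in>opens. spow A (L t A) b = L (Suc t) A"
proof -
  obtain \<A> where \<A>: "finite \<A>" "\<forall>A\<in>\<A>. affine_algebra k A" "V = (\<Union>A\<in>\<A>. affine_model A)"
    using V unfolding variety_def by blast
  have \<A>_opens: "A \<in> opens" if "A \<in> \<A>" for A using \<A> that unfolding affine_opens_def by blast
  have "\<exists>s0. \<forall>s\<ge>s0. L (Suc s) A \<subseteq> spow A (L s A) b" if A: "A \<in> opens" for A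
  proof (rule finite_type_imp_stable[where k = k])
    show "fin_gen_algebra ((\<lambda>c. [:c:]) ` k) (graded_algebra (digit_prods A b (\<lambda>\<alpha>. L \<alpha> A)))"
      using R A unfolding R_finite_type_def R_algebra_eq by blast
  qed (use affine_opens_subring[OF A] affine_opens_const[OF A] submodule_L[OF A] natural_inclusion[OF A] in auto)
  then obtain s0 where s0: "\<And>A s. A \<in> opens \<Longrightarrow> s0 A \<le> s \<Longrightarrow> L (Suc s) A \<subseteq> spow A (L s A) b"
    by metis
  define t where "t = Max (insert 0 (s0 ` \<A>))"
  have t: "L (Suc t) A \<subseteq> spow A (L t A) b" if "A \<in> \<A>" for A
    using \<A>(1) that by (intro s0 \<A>_opens) (auto simp: t_def)
  have "L (Suc t) A \<subseteq> spow A (L t A) b" if A: "A \<in> opens" for A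
  proof
    have AR: "is_subring A" by (rule affine_opens_subring[OF A])
    fix x assume x: "x \<in> L (Suc t) A"
    show "x \<in> spow A (L t A) b"
    proof (rule submodule_local_global[OF AR submodule_spow[OF AR]])
      fix P assume P: "P \<in> affine_model A"
      then obtain A' where A': "A' \<in> \<A>" "P \<in> affine_model A'"
        using affine_opens_model[OF A] \<A>(3) by blast
      have A'R: "is_subring A'" by (rule affine_opens_subring[OF \<A>_opens[OF A'(1)]])
      note PR = affine_model_subring[OF AR P]
      note AP = affine_model_subset[OF AR P] affine_model_subset[OF A'R A'(2)]
      note eq = stalk_L_eq[OF A \<A>_opens[OF A'(1)] P A'(2)]
      have "x \<in> mspan P (L (Suc t) A')" unfolding eq[symmetric] using x by (rule hull_inc)
      also have "\<dots> \<subseteq> mspan P (spow A' (L t A') b)" by (intro hull_mono t A')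
      also have "\<dots> = mspan P (spow A (L t A) b)"
        unfolding mspan_spow[OF PR AP(1) subring_1[OF AR]] mspan_spow[OF PR AP(2) subring_1[OF A'R]] eq ..
      finally show "x \<in> mspan P (spow A (L t A) b)" .
    qed
  qed
  then show ?thesis using natural_inclusion by blast
qed

text \<open>The morphism V_j -> V_(j+1) gives a local ring of V_(j+1) below Qj, so J_(j+1) = J_j
  L_j, and hence L_j, is principal at Qj; let l generate L_j there. Then J_(j+1) is l J_j at Qj, and
  its F is l^(r+1) F(J_j), contained in L_j^(r+2).\<close>

lemma pullback_step:
  assumes mor: "birational_morphism (tower j) (tower (Suc j))"
    and A: "A \<in> opens" and Q: "is_local_subring Q" "A \<subseteq> Q" and Qj: "Qj \<in> tower j" "dominates Q Qj"
  shows "mspan Q (L (Suc j) A) \<subseteq> mspan Q (spow A (L j A) b)"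
proof -
  obtain Q' where Q': "Q' \<in> tower (Suc j)" "dominates Qj Q'"
    using mor Qj(1) unfolding birational_morphism_def by blast
  obtain B where B: "B \<in> opens" and QB: "blow B (J j B) Qj" using Qj(1) unfolding tower_def by blast
  obtain C where C: "C \<in> opens" and QC: "blow C (J (Suc j) C) Q'" using Q'(1) unfolding tower_def by blast
  have BR: "is_subring B" by (rule affine_opens_subring[OF B])
  have AR: "is_subring A" by (rule affine_opens_subring[OF A])
  note QjL = blow_local[OF QB] and QjR = blow_subring[OF QB] and BQ = blow_subset[OF QB]
  have QjQ: "Qj \<subseteq> Q" using Qj(2) by (simp add: dominates_def)
  have Q'Qj: "Q' \<subseteq> Qj" using Q'(2) by (simp add: dominates_def)
  \<comment> \<open>Q and Qj have the same centre on V, and so do Qj and Q'; at these centres the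
    modules over A, B and C can be compared.\<close>
  obtain P where P: "P \<in> affine_model A" "P \<in> affine_model B" "P \<subseteq> Qj"
    by (rule common_centre[OF A B Q QjL BQ Qj(2)])
  obtain P' where P': "P' \<in> affine_model B" "P' \<in> affine_model C" "P' \<subseteq> Q'"
    by (rule common_centre[OF B C QjL BQ blow_local[OF QC] blow_subset[OF QC] Q'(2)])
  let ?X = "J j B" and ?Y = "L j B" and ?r1 = "Suc (length \<delta>s)"
  obtain f where "gen_by Q' (J (Suc j) C) f" using QC by (rule blow_obtain)
  then have "gen_by Qj (J (Suc j) C) f" by (rule gen_by_mono[OF Q'Qj])
  moreover have "mspan Qj (J (Suc j) B) = mspan Qj (J (Suc j) C)"
    using P'(3) Q'Qj by (intro mspan_mono_mspan[OF _ stalk_J_eq[OF B C P'(1,2)]]) auto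
  ultimately have "gen_by Qj (smul B ?X ?Y) f" unfolding J_Suc using gen_by_cong by blast
  then obtain l where l: "l \<in> ?Y" "gen_by Qj ?Y l" by (rule gen_by_smul_factor[OF QjL BQ])
  have "L (Suc j) B \<subseteq> F_mod \<delta>s Qj (mspan Qj (smul B ?X ?Y))"
    unfolding L_eq[of "Suc j"] J_Suc by (intro F_mod_mono BQ hull_subset)
  also have "mspan Qj (smul B ?X ?Y) = (*) l ` mspan Qj ?X"
  proof -
    have "mspan Qj (smul B ?X ?Y) = smul Qj (mspan Qj {l}) (mspan Qj ?X)"
      using l(2) unfolding gen_by_def mspan_smul[OF BQ] by (metis smul_commute)
    also have "\<dots> = (*) l ` mspan Qj ?X"
      using smul_scale_image[of Qj l Qj "mspan Qj ?X"]
      by (simp only: mspan_single[OF QjR] smul_unit_left[OF subring_1[OF QjR] submodule_mspan])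
    finally show ?thesis .
  qed
  \<comment> \<open>After scaling by l, F commutes with the passage from B to Qj because Qj is a
    local ring of the blowup of J_j.\<close>
  also have "F_mod \<delta>s Qj ((*) l ` mspan Qj ?X) = (*) (l ^ ?r1) ` mspan Qj ?Y"
    unfolding F_mod_scale[OF \<delta>s] F_mod_blow[OF \<delta>s BR submodule_J[OF B] QB] L_eq ..
  also have "\<dots> \<subseteq> spow Qj (mspan Qj ?Y) b"
  proof clarify
    fix v assume "v \<in> mspan Qj ?Y"
    moreover have "l ^ ?r1 \<in> spow Qj (mspan Qj ?Y) ?r1"
      using l(1) by (intro power_in_spow[OF QjR] hull_inc)
    ultimately have "l ^ ?r1 * v \<in> smul Qj (spow Qj (mspan Qj ?Y) ?r1) (mspan Qj ?Y)" by (intro smulI)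
    then show "l ^ ?r1 * v \<in> spow Qj (mspan Qj ?Y) b" by simp
  qed
  finally have "mspan Qj (L (Suc j) B) \<subseteq> spow Qj (mspan Qj ?Y) b"
    by (intro mspan_least submodule_spow[OF QjR])
  moreover have eq: "mspan Qj (L i A) = mspan Qj (L i B)" for i
    by (rule mspan_mono_mspan[OF P(3) stalk_L_eq[OF A B P(1,2)]])
  moreover have AQj: "A \<subseteq> Qj" using affine_model_subset[OF AR P(1)] P(3) by blast
  ultimately have "mspan Qj (L (Suc j) A) \<subseteq> mspan Qj (spow A (L j A) b)"
    by (simp only: mspan_spow[OF QjR AQj subring_1[OF AR]])
  then have "mspan Q (mspan Qj (L (Suc j) A)) \<subseteq> mspan Q (mspan Qj (spow A (L j A) b))" by (rule hull_mono)
  then show ?thesis by (simp only: mspan_mspan[OF QjQ])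
qed

text \<open>Q is pushed along V_n -> V_(n+1) -> ..., so it dominates some local ring of every
  V_(n+j). Each use of \<open>pullback_step\<close> multiplies the exponent by b.\<close>

lemma stable_imp_pullback:
  assumes mor: "\<And>j. n \<le> j \<Longrightarrow> birational_morphism (tower j) (tower (Suc j))"
    and A: "A \<in> opens" and Q: "blow A (J n A) Q"
  shows "mspan Q (L (n + j) A) \<subseteq> mspan Q (spow A (L n A) (b ^ j))"
proof (induction j)
  case 0
  then show ?case using spow_1[OF affine_opens_subring[OF A] submodule_L[OF A]] by simp
next
  case (Suc j)
  have AR: "is_subring A" by (rule affine_opens_subring[OF A])
  note QR = blow_subring[OF Q] and AQ = blow_subset[OF Q]
  have "\<exists>Qj\<in>tower (n + j). dominates Q Qj" for j
  proof (induction j)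
    case 0
    have "Q \<in> tower n" using A Q unfolding tower_def by blast
    then show ?case by (auto simp: dominates_def)
  next
    case (Suc j)
    then obtain Qj where "Qj \<in> tower (n + j)" "dominates Q Qj" by blast
    moreover obtain Q' where "Q' \<in> tower (Suc (n + j))" "dominates Qj Q'"
      using mor[of "n + j"] calculation(1) unfolding birational_morphism_def by auto
    ultimately show ?case using dominates_trans by auto
  qed
  then obtain Qj where Qj: "Qj \<in> tower (n + j)" "dominates Q Qj" by blast
  have "mspan Q (L (Suc (n + j)) A) \<subseteq> mspan Q (spow A (L (n + j) A) b)"
    by (rule pullback_step[OF mor A blow_local[OF Q] AQ Qj]) simp
  also have "\<dots> = spow Q (mspan Q (L (n + j) A)) b" by (rule mspan_spow[OF QR AQ subring_1[OF AR]])
  also have "\<dots> \<subseteq> spow Q (mspan Q (spow A (L n A) (b ^ j))) b" by (rule spow_mono[OF Suc])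
  also have "\<dots> = mspan Q (spow A (spow A (L n A) (b ^ j)) b)"
    by (rule mspan_spow[OF QR AQ subring_1[OF AR], symmetric])
  finally show ?case unfolding spow_mult[OF AR] power_Suc2 add_Suc_right .
qed

text \<open>On the chart of each generator g of J_n the inclusion holds at all local rings, hence on
  the chart itself. Clearing denominators gives an exponent for g, and finitely many g have a common
  one. At this point p may still depend on x and j.\<close>

lemma stable_imp_saturated:
  assumes mor: "\<And>j. n \<le> j \<Longrightarrow> birational_morphism (tower j) (tower (Suc j))"
    and A: "A \<in> opens" and x: "x \<in> L (n + j) A"
  shows "\<exists>p. \<forall>z\<in>spow A (J n A) p. x * z \<in> smul A (spow A (J n A) p) (spow A (L n A) (b ^ j))"
proof -
  have AR: "is_subring A" by (rule affine_opens_subring[OF A])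
  let ?Y = "spow A (L n A) (b ^ j)"
  have Y: "is_submodule A ?Y" by (rule submodule_spow[OF AR])
  obtain S where S: "finite S" "J n A = mspan A S"
    using fractional_ideal_fin_gen[OF noeth_affine_algebra[OF k affine_opens_algebra[OF A]] fractional_ideal_J[OF A]] .
  have "\<exists>m. x * g ^ m \<in> smul A (spow A (J n A) m) ?Y" if g: "g \<in> S" for g
  proof (cases "g = 0")
    case True
    \<comment> \<open>There is no chart for g = 0; the exponent 1 makes the product vanish.\<close>
    then have "x * g ^ 1 \<in> smul A (spow A (J n A) 1) ?Y" using submodule_0[OF submodule_smul] by simp
    then show ?thesis by blast
  next
    case False
    have gJ: "g \<in> J n A" unfolding S(2) using g by (rule hull_inc)
    let ?B = "chart A (J n A) g"
    have "x \<in> mspan ?B ?Y"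
    proof (rule submodule_local_global[OF subring_chart submodule_mspan])
      fix P assume P: "P \<in> affine_model ?B"
      then have "blow A (J n A) P" using affine_model_chart_iff[OF AR gJ False] by blast
      then have "mspan P (L (n + j) A) \<subseteq> mspan P ?Y" by (intro stable_imp_pullback mor A)
      moreover have "x \<in> mspan P (L (n + j) A)" using x by (rule hull_inc)
      moreover have "?B \<subseteq> P" by (rule affine_model_subset[OF subring_chart P])
      ultimately show "x \<in> mspan P (mspan ?B ?Y)" by (auto simp: mspan_mspan)
    qed
    then show ?thesis by (rule chart_smul_bound[OF AR gJ False Y])
  qed
  then show ?thesis by (rule exponent_for_generators[OF AR S])
qed

lemma stable_imp_R_finite_type:
  assumes mor: "\<And>j. n \<le> j \<Longrightarrow> birational_morphism (tower j) (tower (Suc j))"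
  shows "R_finite_type k V \<delta>s I"
  unfolding R_finite_type_def R_algebra_eq
proof
  fix A assume A: "A \<in> opens"
  have AR: "is_subring A" by (rule affine_opens_subring[OF A])
  have "\<exists>M g. fractional_ideal A M \<and> g \<in> M \<and> g \<noteq> 0 \<and> (\<forall>j. \<forall>x\<in>L (n + j) A.
      \<exists>p. \<forall>z\<in>spow A M p. x * z \<in> smul A (spow A M p) (spow A (L n A) (b ^ j)))"
  proof (cases "J n A = {0}")
    \<comment> \<open>If J_n vanishes on A, so do all later J and L, and A with g = 1 serves in
      place of J_n.\<close>
    case True
    have "J (n + j) A = {0}" for j
      by (induction j) (simp_all add: True J_Suc del: J_sheaf.simps)
    then have "L (n + j) A = {0}" for j unfolding L_eq by (simp add: F_mod_zero[OF \<delta>s])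
    moreover have "0 \<in> smul A X Y" for X Y by (rule submodule_0[OF submodule_smul])
    ultimately have "\<forall>j. \<forall>x\<in>L (n + j) A.
        \<exists>p. \<forall>z\<in>spow A A p. x * z \<in> smul A (spow A A p) (spow A (L n A) (b ^ j))"
      by simp
    then show ?thesis using fractional_ideal_ring[OF AR] subring_1[OF AR] one_neq_zero by blast
  next
    case False
    then obtain g where "g \<in> J n A" "g \<noteq> 0" using submodule_0[OF submodule_J[OF A]] by blast
    then show ?thesis using stable_imp_saturated[OF mor A] fractional_ideal_J[OF A] by blast
  qed
  then obtain M g where M: "fractional_ideal A M" "g \<in> M" "g \<noteq> 0"
    and sat: "\<And>j x. x \<in> L (n + j) A \<Longrightarrow>
      \<exists>p. \<forall>z\<in>spow A M p. x * z \<in> smul A (spow A M p) (spow A (L n A) (b ^ j))" by blast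
  show "fin_gen_algebra ((\<lambda>c. [:c:]) ` k) (graded_algebra (digit_prods A b (\<lambda>\<alpha>. L \<alpha> A)))"
  proof (rule stable_imp_finite_type[where n = n, OF k affine_opens_algebra[OF A] _ _ _ M])
    show "spow A (L \<alpha> A) b \<subseteq> L (Suc \<alpha>) A" for \<alpha> by (rule natural_inclusion[OF A])
    show "fractional_ideal A (L \<alpha> A)" for \<alpha> by (rule fractional_ideal_L[OF A])
  qed (simp, rule sat)
qed

lemma R_finite_type_tfae:
  "(R_finite_type k V \<delta>s I \<longleftrightarrow>
      (\<exists>n. \<forall>i\<ge>n. birational_isomorphism (gauss_tower k \<delta>s V I (Suc i)) (gauss_tower k \<delta>s V I i)))
   \<and> ((\<exists>n. \<forall>i\<ge>n. birational_isomorphism (gauss_tower k \<delta>s V I (Suc i)) (gauss_tower k \<delta>s V I i)) \<longleftrightarrow>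
      (\<exists>t. natural_map_iso k V \<delta>s (J t)))"
  (is "(?R \<longleftrightarrow> ?T) \<and> (?T \<longleftrightarrow> ?N)")
proof -
  have "?N" if "?R" using finite_type_imp_natural_map_iso[OF that] unfolding natural_map_iso_iff .
  moreover have "?T" if "?N"
  proof -
    obtain t where "\<And>A. A \<in> opens \<Longrightarrow> spow A (L t A) b = L (Suc t) A"
      using \<open>?N\<close> unfolding natural_map_iso_iff by blast
    then have "\<forall>i\<ge>Suc t. tower (Suc i) = tower i" by (rule natural_map_iso_imp_stable)
    moreover have "birational_isomorphism X X" for X :: "'a set set"
      unfolding birational_isomorphism_def birational_morphism_def dominates_def by blast
    ultimately show ?thesis unfolding gauss_tower_eq by (intro exI[of _ "Suc t"]) simp
  qed
  moreover have "?R" if "?T"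
    using that stable_imp_R_finite_type unfolding gauss_tower_eq birational_isomorphism_def by blast
  ultimately show ?thesis by blast
qed

end

theorem theorem3:
  fixes k :: "'a::field_char_0 set"
    and V :: "'a set set"
    and \<L> :: "('a \<Rightarrow> 'a) set"
    and \<delta>s :: "('a \<Rightarrow> 'a) list"
    and r :: nat
    and I :: "'a sheaf"
  assumes "is_subfield k"
    and "variety k V"
    and "singular_foliation k \<L>"
    and "fun_vs.dim \<L> = r"
    and "foliation_basis \<L> \<delta>s"
    and "nonzero_ideal_sheaf k V I"
  shows "(R_finite_type k V \<delta>s I \<longleftrightarrow>
           (\<exists>n. \<forall>i\<ge>n. birational_isomorphism (gauss_tower k \<delta>s V I (Suc i)) (gauss_tower k \<delta>s V I i)))
       \<and> ((\<exists>n. \<forall>i\<ge>n. birational_isomorphism (gauss_tower k \<delta>s V I (Suc i)) (gauss_tower k \<delta>s V I i)) \<longleftrightarrow>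
           (\<exists>t. natural_map_iso k V \<delta>s (J_sheaf \<delta>s I t)))"
  proof -
  have "set \<delta>s \<subseteq> \<L>"
    using assms(5) fun_vs.span_superset[of "set \<delta>s"] unfolding foliation_basis_def by simp
  then have "\<forall>\<delta>\<in>set \<delta>s. derivation k \<delta>"
    using assms(3) unfolding singular_foliation_def by blast
  then show ?thesis using R_finite_type_tfae assms(1,2,6) by blast
qed

end
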